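(* The decision problem Extension Locally Minimal Defensive Alliance is $\mathsf{NP}$-complete, even when restricted to planar bipartite input graphs of maximum degree at most $9$.
   Context: Graphs are finite, simple and undirected. For $G=(V,E)$, $X\subseteq V$ and $v\in V$, $\deg_X(v)$ is the number of neighbors of $v$ in $X$, and $\overline{X}=V\setminus X$. A set $A\subseteq V$ is a defensive alliance if $\deg_A(v)+1\ge \deg_{\overline{A}}(v)$ for every $v\in A$. A non-empty defensive alliance $A$ is locally minimal if for no $v\in A$ the set $A\setminus\{v\}$ is a non-empty defensive alliance. Problem Extension Locally Minimal Defensive Alliance. Input: a graph $G=(V,E)$ and sets $U,N\subseteq V$. Question: is there a locally minimal defensive alliance $A\subseteq V\setminus N$ of $G$ with $U\subseteq A$? *)

theory Defs
  imports "HOL-Analysis.Analysis" "HOL-Computational_Algebra.Polynomial"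
begin

section \<open>Deterministic multi-tape Turing machines\<close>

text \<open>
  States and tape symbols are natural numbers. The working states are those below
  \<open>num_states\<close>, with start state \<open>0\<close>; the number \<open>num_states\<close> itself is the only halting
  state. Symbol \<open>0\<close> is the blank, \<open>1\<close> and \<open>2\<close> stand for the bits \<open>False\<close> and \<open>True\<close>, and
  further symbols below \<open>num_symbols\<close> are available for working.
\<close>

datatype dir = Lft | Stay | Rgt

record tm =
  num_tapes :: nat
  num_symbols :: nat
  num_states :: nat
  delta :: "nat \<Rightarrow> nat list \<Rightarrow> nat \<times> (nat \<times> dir) list"

text \<open>The values of \<open>delta\<close> outside the domain described here are never consulted.\<close>

definition wf_tm :: "tm \<Rightarrow> bool" where
  "wf_tm M \<longleftrightarrow>
     num_tapes M \<ge> 1 \<and> num_symbols M \<ge> 3 \<and>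
     (\<forall>q ss. q < num_states M \<and> length ss = num_tapes M \<and> set ss \<subseteq> {..<num_symbols M} \<longrightarrow>
        fst (delta M q ss) \<le> num_states M \<and>
        length (snd (delta M q ss)) = num_tapes M \<and>
        (\<forall>a\<in>set (snd (delta M q ss)). fst a < num_symbols M))"

text \<open>
  A tape is infinite in both directions and is indexed relative to its head, which always
  scans cell \<open>0\<close>; moving the head shifts the contents.
\<close>

type_synonym tape = "int \<Rightarrow> nat"
type_synonym config = "nat \<times> tape list"

fun offset :: "dir \<Rightarrow> int" where
  "offset Lft = -1"
| "offset Stay = 0"
| "offset Rgt = 1"

definition act :: "nat \<times> dir \<Rightarrow> tape \<Rightarrow> tape" where
  "act a t = (\<lambda>i. (t(0 := fst a)) (i + offset (snd a)))"

fun step :: "tm \<Rightarrow> config \<Rightarrow> config" where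
  "step M (q, ts) =
     (if q < num_states M
      then let (q', as) = delta M q (map (\<lambda>t. t 0) ts) in (q', map2 act as ts)
      else (q, ts))"

definition bit_symbol :: "bool \<Rightarrow> nat" where
  "bit_symbol b = (if b then 2 else 1)"

definition blank_tape :: tape where
  "blank_tape = (\<lambda>i. 0)"

definition input_tape :: "bool list \<Rightarrow> tape" where
  "input_tape x = (\<lambda>i. if 0 \<le> i \<and> i < int (length x) then bit_symbol (x ! nat i) else 0)"

definition init_config :: "tm \<Rightarrow> bool list \<Rightarrow> config" where
  "init_config M x = (0, input_tape x # replicate (num_tapes M - 1) blank_tape)"

text \<open>The output is read on the first tape, from the head rightwards up to the first blank.\<close>

definition tape_output :: "tape \<Rightarrow> bool list \<Rightarrow> bool" where
  "tape_output t y \<longleftrightarrow>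
     (\<forall>i<length y. t (int i) = bit_symbol (y ! i)) \<and> t (int (length y)) = 0"

definition computes_within :: "tm \<Rightarrow> (bool list \<Rightarrow> bool list) \<Rightarrow> (nat \<Rightarrow> nat) \<Rightarrow> bool" where
  "computes_within M f T \<longleftrightarrow>
     (\<forall>x. \<exists>k \<le> T (length x). \<exists>ts.
        (step M ^^ k) (init_config M x) = (num_states M, ts) \<and> tape_output (hd ts) (f x))"

definition polytime :: "(bool list \<Rightarrow> bool list) \<Rightarrow> bool" where
  "polytime f \<longleftrightarrow> (\<exists>M (p :: nat poly). wf_tm M \<and> computes_within M f (poly p))"


section \<open>NP and NP-completeness\<close>

type_synonym lang = "bool list set"

definition pair :: "bool list \<Rightarrow> bool list \<Rightarrow> bool list" where
  "pair x u = concat (map (\<lambda>b. [True, b]) x) @ False # u"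

lemma pair_inject: "pair x u = pair y v \<longleftrightarrow> x = y \<and> u = v"
proof (induction x arbitrary: y)
  case Nil
  then show ?case by (cases y) (auto simp: pair_def)
next
  case (Cons a x)
  then show ?case by (cases y) (auto simp: pair_def)
qed

text \<open>A verifier is a total polynomial-time function; it accepts by outputting \<open>[True]\<close>.\<close>

definition NP :: "lang set" where
  "NP = {L. \<exists>V (p :: nat poly). polytime V \<and>
          (\<forall>x. x \<in> L \<longleftrightarrow> (\<exists>u. length u \<le> poly p (length x) \<and> V (pair x u) = [True]))}"

text \<open>
  The problem \<open>L\<close> restricted to the inputs in \<open>I\<close>: reductions may only produce inputs in \<open>I\<close>,
  and nothing is asked of an algorithm for the restricted problem on inputs outside \<open>I\<close>.
\<close>

definition NP_hard_on :: "lang \<Rightarrow> lang \<Rightarrow> bool" where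
  "NP_hard_on I L \<longleftrightarrow>
     (\<forall>K\<in>NP. \<exists>f. polytime f \<and> (\<forall>x. f x \<in> I \<and> (x \<in> K \<longleftrightarrow> f x \<in> L)))"

definition NP_complete_on :: "lang \<Rightarrow> lang \<Rightarrow> bool" where
  "NP_complete_on I L \<longleftrightarrow> (\<exists>K\<in>NP. L \<inter> I = K \<inter> I) \<and> NP_hard_on I L"

abbreviation NP_complete :: "lang \<Rightarrow> bool" where
  "NP_complete L \<equiv> NP_complete_on UNIV L"

lemma NP_complete_iff:
  "NP_complete L \<longleftrightarrow>
     L \<in> NP \<and> (\<forall>K\<in>NP. \<exists>f. polytime f \<and> (\<forall>x. x \<in> K \<longleftrightarrow> f x \<in> L))"
  by (auto simp: NP_complete_on_def NP_hard_on_def)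


section \<open>Finite simple graphs\<close>

definition simple_graph :: "'a set \<Rightarrow> 'a set set \<Rightarrow> bool" where
  "simple_graph V E \<longleftrightarrow> finite V \<and> (\<forall>e\<in>E. e \<subseteq> V \<and> card e = 2)"

definition deg_in :: "'a set set \<Rightarrow> 'a set \<Rightarrow> 'a \<Rightarrow> nat" where
  "deg_in E X v = card {u \<in> X. {u, v} \<in> E}"

definition max_degree_at_most :: "nat \<Rightarrow> 'a set \<Rightarrow> 'a set set \<Rightarrow> bool" where
  "max_degree_at_most k V E \<longleftrightarrow> (\<forall>v\<in>V. deg_in E V v \<le> k)"

definition bipartite :: "'a set \<Rightarrow> 'a set set \<Rightarrow> bool" where
  "bipartite V E \<longleftrightarrow>
     (\<exists>X Y. X \<union> Y = V \<and> X \<inter> Y = {} \<and> (\<forall>e\<in>E. \<exists>x\<in>X. \<exists>y\<in>Y. e = {x, y}))"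

text \<open>
  A drawing in the plane without crossings: vertices are distinct points, edges are arcs joining
  their end vertices and containing no other vertex, and two edges meet only in common end
  vertices.
\<close>

definition plane_drawing ::
    "'a set \<Rightarrow> 'a set set \<Rightarrow> ('a \<Rightarrow> complex) \<Rightarrow> ('a set \<Rightarrow> real \<Rightarrow> complex) \<Rightarrow> bool" where
  "plane_drawing V E pt crv \<longleftrightarrow>
     inj_on pt V \<and>
     (\<forall>e\<in>E. arc (crv e) \<and> {pathstart (crv e), pathfinish (crv e)} = pt ` e \<and>
             path_image (crv e) \<inter> pt ` V = pt ` e) \<and>
     (\<forall>e\<in>E. \<forall>e'\<in>E. e \<noteq> e' \<longrightarrow>
             path_image (crv e) \<inter> path_image (crv e') \<subseteq> pt ` (e \<inter> e'))"

definition planar :: "'a set \<Rightarrow> 'a set set \<Rightarrow> bool" where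
  "planar V E \<longleftrightarrow> (\<exists>pt crv. plane_drawing V E pt crv)"


section \<open>Locally minimal defensive alliances\<close>

definition defensive_alliance :: "'a set \<Rightarrow> 'a set set \<Rightarrow> 'a set \<Rightarrow> bool" where
  "defensive_alliance V E A \<longleftrightarrow>
     A \<subseteq> V \<and> (\<forall>v\<in>A. deg_in E A v + 1 \<ge> deg_in E (V - A) v)"

definition locally_minimal_defensive_alliance :: "'a set \<Rightarrow> 'a set set \<Rightarrow> 'a set \<Rightarrow> bool" where
  "locally_minimal_defensive_alliance V E A \<longleftrightarrow>
     A \<noteq> {} \<and> defensive_alliance V E A \<and>
     \<not> (\<exists>v\<in>A. A - {v} \<noteq> {} \<and> defensive_alliance V E (A - {v}))"


section \<open>The decision problem\<close>

text \<open>
  Input graphs have vertex set \<open>{..<n}\<close>. An instance is written as \<open>n\<close> in unary, followed by the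
  adjacency matrix and the characteristic vectors of \<open>U\<close> and \<open>N\<close>.
\<close>

definition instance_ok :: "nat \<Rightarrow> nat set set \<Rightarrow> nat set \<Rightarrow> nat set \<Rightarrow> bool" where
  "instance_ok n E U N \<longleftrightarrow> simple_graph {..<n} E \<and> U \<subseteq> {..<n} \<and> N \<subseteq> {..<n}"

definition encode :: "nat \<Rightarrow> nat set set \<Rightarrow> nat set \<Rightarrow> nat set \<Rightarrow> bool list" where
  "encode n E U N =
     replicate n True @ [False] @
     concat (map (\<lambda>i. map (\<lambda>j. {i, j} \<in> E) [0..<n]) [0..<n]) @
     map (\<lambda>i. i \<in> U) [0..<n] @ map (\<lambda>i. i \<in> N) [0..<n]"

lemma encode_inject:
  assumes "instance_ok n E U N" "instance_ok n' E' U' N'"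
    and eq: "encode n E U N = encode n' E' U' N'"
  shows "n = n' \<and> E = E' \<and> U = U' \<and> N = N'"
proof -
  have unary: "takeWhile id (replicate m True @ [False] @ xs) = replicate m True" for m xs
    by (induction m) auto
  have n: "n = n'"
    using arg_cong[OF eq, of "takeWhile id"] unfolding encode_def unary
    by (metis length_replicate)
  have len: "length (concat (map (\<lambda>i. map (\<lambda>j. {i, j} \<in> F) [0..<n]) [0..<m])) = n * m" for F m
    by (induction m) auto
  have *: "concat (map (\<lambda>i. map (\<lambda>j. {i, j} \<in> E) [0..<n]) [0..<n]) =
           concat (map (\<lambda>i. map (\<lambda>j. {i, j} \<in> E') [0..<n]) [0..<n])"
       "map (\<lambda>i. i \<in> U) [0..<n] = map (\<lambda>i. i \<in> U') [0..<n]"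
       "map (\<lambda>i. i \<in> N) [0..<n] = map (\<lambda>i. i \<in> N') [0..<n]"
    using eq by (simp_all add: encode_def len flip: n)
  have "map (\<lambda>i. map (\<lambda>j. {i, j} \<in> E) [0..<n]) [0..<n] =
        map (\<lambda>i. map (\<lambda>j. {i, j} \<in> E') [0..<n]) [0..<n]"
    by (rule concat_injective[OF *(1)]) (auto simp: zip_map1 zip_map2 set_zip)
  hence adj: "{i, j} \<in> E \<longleftrightarrow> {i, j} \<in> E'" if "i < n" "j < n" for i j
    using that by auto
  have "e \<in> E \<longleftrightarrow> e \<in> E'" for e
  proof (cases "e \<subseteq> {..<n} \<and> card e = 2")
    case True
    then obtain i j where "e = {i, j}" by (auto simp: card_2_iff)
    with True adj show ?thesis by auto
  next
    case False
    then show ?thesis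
      using assms(1,2) n by (auto simp: instance_ok_def simple_graph_def)
  qed
  moreover have "U = U'" "N = N'"
    using *(2,3) assms(1,2) n by (auto simp: instance_ok_def)
  ultimately show ?thesis using n by blast
qed

definition Ext_LMDA :: lang where
  "Ext_LMDA =
     {encode n E U N | n E U N. instance_ok n E U N \<and>
        (\<exists>A. A \<subseteq> {..<n} - N \<and> U \<subseteq> A \<and> locally_minimal_defensive_alliance {..<n} E A)}"

definition planar_bipartite_inputs :: "nat \<Rightarrow> lang" where
  "planar_bipartite_inputs k =
     {encode n E U N | n E U N. instance_ok n E U N \<and>
        planar {..<n} E \<and> bipartite {..<n} E \<and> max_degree_at_most k {..<n} E}"

end

theory Submission
  imports Defs
begin

text \<open>
  Membership in NP and the reduction are both described by terms of a small language with bounded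
  sums, whose terms are compiled, once and for all, to Turing machines with unary counters.

  For hardness, the space-time diagram of a verifier is read as a tiling of a rectangle, where the
  first row leaves the certificate open. A tiling is an exact cover of sites and of colors of edges.
  The incidence matrix of the cover is laid out as a planar grid: rows carry the choice of a set, columns
  the number of times that an element has been covered so far, and where they meet, constraints asking
  for exactly one of their neighbors let the signals pass or increment the column. Such a constraint is a
  forced vertex with a forced pendant neighbor, since local minimality at the pendant neighbor and
  the alliance condition at the vertex leave only one possible degree in the alliance.
\<close>

section \<open>Structured programs for Turing machines\<close>

text \<open>Terms have a fixed number of nested binders, so their values stay polynomially bounded
  and unary counters are affordable. What depends only on the language in NP (tiles, colors,
  transition tables) is finite and enters as constants. The reduction builds no data structure: the
  i-th output bit is a predicate of i and of the input, which is why vertices are numbered by a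
  closed formula in lattice coordinates. The obstacle to planarity is that every row of the
  incidence matrix crosses every column. A crossing stores which of the four combinations of signals
  it carries, and this takes only constraints on three or four variables. These sizes are dictated
  by the gadget: if a constraint vertex has \<open>m\<close> neighbors besides its forced pendant
  one and \<open>s\<close> of them are in the alliance, the alliance condition reads
  \<open>m - s \<le> s + 2\<close> and local minimality reads \<open>s < m - s\<close>. Both
  together mean \<open>s = 1\<close> exactly for \<open>m = 3\<close> and
  \<open>m = 4\<close>.\<close>

datatype com =
    Act "nat list \<Rightarrow> (nat \<times> dir) list"
  | Seq com com (infixr ";;" 60)
  | While "nat list \<Rightarrow> bool" com

fun csize :: "com \<Rightarrow> nat" where
  "csize (Act f) = 1"
| "csize (c ;; d) = csize c + csize d"
| "csize (While b c) = csize c + 2"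

definition keep :: "nat list \<Rightarrow> (nat \<times> dir) list" where
  "keep ss = map (\<lambda>s. (s, Stay)) ss"

text \<open>Jump targets are absolute, so \<open>a\<close> is the state number of the first
  instruction. A loop takes two extra states, the test in front and the jump back behind its
  body.\<close>

fun code :: "nat \<Rightarrow> com \<Rightarrow> (nat list \<Rightarrow> nat \<times> (nat \<times> dir) list) list" where
  "code a (Act f) = [\<lambda>ss. (a + 1, f ss)]"
| "code a (c ;; d) = code a c @ code (a + csize c) d"
| "code a (While b c) =
     [\<lambda>ss. (if b ss then a + 1 else a + csize c + 2, keep ss)] @ code (a + 1) c @ [\<lambda>ss. (a, keep ss)]"

lemma length_code [simp]: "length (code a c) = csize c"
  by (induction c arbitrary: a) auto

definition scan :: "tape list \<Rightarrow> nat list" where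
  "scan ts = map (\<lambda>t. t 0) ts"

lemma act_keep [simp]: "map2 act (keep (scan ts)) ts = ts"
  by (induction ts) (auto simp: keep_def scan_def act_def fun_eq_iff)

inductive exec :: "com \<Rightarrow> tape list \<Rightarrow> nat \<Rightarrow> tape list \<Rightarrow> bool" where
  Act: "exec (Act f) ts 1 (map2 act (f (scan ts)) ts)"
| Seq: "exec c ts n ts' \<Longrightarrow> exec d ts' m ts'' \<Longrightarrow> exec (c ;; d) ts (n + m) ts''"
| WhileF: "\<not> b (scan ts) \<Longrightarrow> exec (While b c) ts 1 ts"
| WhileT: "b (scan ts) \<Longrightarrow> exec c ts n ts' \<Longrightarrow> exec (While b c) ts' m ts'' \<Longrightarrow>
    exec (While b c) ts (1 + (n + (1 + m))) ts''"

definition machine :: "nat \<Rightarrow> com \<Rightarrow> tm" where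
  "machine k c = \<lparr>num_tapes = k, num_symbols = 3, num_states = csize c,
     delta = (\<lambda>q ss. (code 0 c ! q) ss)\<rparr>"

lemma funpow_add_apply: "(f ^^ (m + n)) x = (f ^^ n) ((f ^^ m) x)"
  by (metis add.commute comp_apply funpow_add)

text \<open>Because addresses are absolute, the fragment must sit at position
  \<open>length xs\<close> of the whole program \<open>P\<close>. Keeping \<open>xs\<close> and
  \<open>ys\<close> arbitrary lets the induction descend into sequences and loop bodies.\<close>

lemma exec_step:
  assumes "exec c ts n ts'"
    and "num_states M = length P" "delta M = (\<lambda>q ss. (P ! q) ss)"
    and "P = xs @ code (length xs) c @ ys"
  shows "(step M ^^ n) (length xs, ts) = (length xs + csize c, ts')"
  using assms
proof (induction arbitrary: xs ys rule: exec.induct)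
  case (Act f ts)
  then show ?case by (simp add: nth_append scan_def)
next
  case (Seq c ts n ts' d m ts'')
  have "(step M ^^ n) (length xs, ts) = (length xs + csize c, ts')"
    using Seq.IH(1)[of xs "code (length xs + csize c) d @ ys"] Seq.prems by simp
  moreover have "(step M ^^ m) (length xs + csize c, ts') = (length xs + csize c + csize d, ts'')"
    using Seq.IH(2)[of "xs @ code (length xs) c" ys] Seq.prems by simp
  ultimately show ?case by (simp add: funpow_add_apply add.assoc)
next
  case (WhileF b ts c)
  then show ?case by (simp add: nth_append flip: scan_def)
next
  case (WhileT b ts c n ts' m ts'')
  let ?h = "\<lambda>ss. (if b ss then length xs + 1 else length xs + csize c + 2, keep ss)"
  have 1: "(step M ^^ 1) (length xs, ts) = (length xs + 1, ts)"
    using WhileT.hyps(1) WhileT.prems by (simp add: nth_append flip: scan_def)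
  have 2: "(step M ^^ n) (length xs + 1, ts) = (length xs + 1 + csize c, ts')"
    using WhileT.IH(1)[of "xs @ [?h]" "[\<lambda>ss. (length xs, keep ss)] @ ys"] WhileT.prems by simp
  have "P ! (length xs + 1 + csize c) = (\<lambda>ss. (length xs, keep ss))"
    using WhileT.prems by (simp add: nth_append nth_Cons')
  then have 3: "(step M ^^ 1) (length xs + 1 + csize c, ts') = (length xs, ts')"
    using WhileT.prems by (simp flip: scan_def)
  have 4: "(step M ^^ m) (length xs, ts') = (length xs + csize (While b c), ts'')"
    using WhileT.IH(2)[of xs ys] WhileT.prems by simp
  show ?case
    unfolding funpow_add_apply 1 2 3 4 ..
qed

fun acts_ok :: "nat \<Rightarrow> com \<Rightarrow> bool" where
  "acts_ok k (Act f) \<longleftrightarrow> (\<forall>ss. length ss = k \<and> set ss \<subseteq> {..<3} \<longrightarrow>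
     length (f ss) = k \<and> (\<forall>a\<in>set (f ss). fst a < 3))"
| "acts_ok k (c ;; d) \<longleftrightarrow> acts_ok k c \<and> acts_ok k d"
| "acts_ok k (While b c) \<longleftrightarrow> acts_ok k c"

lemma code_ok:
  assumes "acts_ok k c" "g \<in> set (code a c)" "length ss = k" "set ss \<subseteq> {..<3}"
  shows "fst (g ss) \<le> a + csize c \<and> length (snd (g ss)) = k \<and> (\<forall>x\<in>set (snd (g ss)). fst x < 3)"
  using assms
proof (induction c arbitrary: a)
  case (Seq c d)
  consider "g \<in> set (code a c)" | "g \<in> set (code (a + csize c) d)"
    using Seq.prems(2) by auto
  then show ?case
  proof cases
    case 1
    then show ?thesis using Seq.IH(1)[of a] Seq.prems by (auto simp: trans_le_add1)
  next
    case 2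
    then show ?thesis using Seq.IH(2)[of "a + csize c"] Seq.prems by (auto simp: add.assoc)
  qed
next
  case (While b c)
  consider "g \<in> set (code (Suc a) c)"
    | "g = (\<lambda>ss. (if b ss then a + 1 else a + csize c + 2, keep ss))" | "g = (\<lambda>ss. (a, keep ss))"
    using While.prems(2) by auto
  then show ?case
  proof cases
    case 1
    then show ?thesis using While.IH[of "Suc a"] While.prems by auto
  qed (use While.prems in \<open>auto simp: keep_def\<close>)
qed auto

lemma wf_machine:
  assumes "acts_ok k c" "k \<ge> 1"
  shows "wf_tm (machine k c)"
proof -
  have "fst ((code 0 c ! q) ss) \<le> csize c \<and> length (snd ((code 0 c ! q) ss)) = k \<and>
      (\<forall>a\<in>set (snd ((code 0 c ! q) ss)). fst a < 3)"
    if "q < csize c" "length ss = k" "set ss \<subseteq> {..<3}" for q ss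
    using code_ok[OF assms(1) _ that(2,3), of "code 0 c ! q" 0] that(1) nth_mem[of q "code 0 c"]
    by (simp del: nth_mem)
  then show ?thesis
    using assms(2) unfolding wf_tm_def machine_def by auto
qed

section \<open>Execution within a time bound\<close>

definition runs :: "com \<Rightarrow> tape list \<Rightarrow> nat \<Rightarrow> tape list \<Rightarrow> bool" where
  "runs c ts N ts' \<longleftrightarrow> (\<exists>n\<le>N. exec c ts n ts')"

lemma runs_Act: "map2 act (f (scan ts)) ts = ts' \<Longrightarrow> runs (Act f) ts 1 ts'"
  unfolding runs_def using exec.Act by blast

lemma runs_Seq: "runs c ts n ts' \<Longrightarrow> runs d ts' m ts'' \<Longrightarrow> runs (c ;; d) ts (n + m) ts''"
  unfolding runs_def using exec.Seq add_mono by blast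

lemma runs_mono: "runs c ts n ts' \<Longrightarrow> n \<le> m \<Longrightarrow> runs c ts m ts'"
  unfolding runs_def using le_trans by blast

text \<open>A loop is given by the sequence \<open>S\<close> of tape contents at its test. Each
  round pays for the body, the test and the jump back, hence \<open>B + 2\<close>; the failing test
  is the final step.\<close>

lemma runs_While:
  assumes "\<And>i. i < n \<Longrightarrow> b (scan (S i))" "\<not> b (scan (S n))"
    and "\<And>i. i < n \<Longrightarrow> runs c (S i) B (S (Suc i))"
  shows "runs (While b c) (S 0) (n * (B + 2) + 1) (S n)"
  using assms
proof (induction n arbitrary: S)
  case 0
  have "exec (While b c) (S 0) 1 (S 0)" using 0 by (intro exec.WhileF) simp
  then show ?case by (auto simp: runs_def)
next
  case (Suc n)
  have "runs (While b c) (S (Suc 0)) (n * (B + 2) + 1) (S (Suc n))"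
    by (rule Suc.IH) (use Suc.prems in auto)
  then obtain m where m: "m \<le> n * (B + 2) + 1" "exec (While b c) (S (Suc 0)) m (S (Suc n))"
    by (auto simp: runs_def)
  obtain k where k: "k \<le> B" "exec c (S 0) k (S (Suc 0))"
    using Suc.prems(3)[of 0] by (auto simp: runs_def)
  have "exec (While b c) (S 0) (1 + (k + (1 + m))) (S (Suc n))"
    using Suc.prems(1) k m by (intro exec.WhileT) auto
  moreover have "1 + (k + (1 + m)) \<le> Suc n * (B + 2) + 1"
    using k(1) m(1) by simp
  ultimately show ?case unfolding runs_def by blast
qed

lemma runs_computes:
  assumes "acts_ok k c" "k \<ge> 1"
    and "\<And>x. \<exists>ts. runs c (input_tape x # replicate (k - 1) blank_tape) (poly p (length x)) ts \<and>
            tape_output (hd ts) (f x)"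
  shows "polytime f"
proof -
  define M where "M = machine k c"
  have M: "num_tapes M = k" "num_states M = length (code 0 c)" "delta M = (\<lambda>q ss. (code 0 c ! q) ss)"
    by (simp_all add: M_def machine_def)
  have "\<exists>n\<le>poly p (length x). \<exists>ts. (step M ^^ n) (init_config M x) = (num_states M, ts) \<and>
      tape_output (hd ts) (f x)" for x
  proof -
    obtain ts where r: "runs c (input_tape x # replicate (k - 1) blank_tape) (poly p (length x)) ts"
      and o: "tape_output (hd ts) (f x)"
      using assms(3) by metis
    obtain n where n: "n \<le> poly p (length x)"
      and e: "exec c (input_tape x # replicate (k - 1) blank_tape) n ts"
      using r unfolding runs_def by (elim exE conjE)
    have "(step M ^^ n) (init_config M x) = (num_states M, ts)"
      using exec_step[OF e M(2,3), of "[]" "[]"] by (simp add: M init_config_def)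
    with n o show ?thesis by metis
  qed
  then have "computes_within M f (poly p)"
    by (simp add: computes_within_def)
  then show ?thesis
    unfolding polytime_def using wf_machine[OF assms(1,2)] M_def by metis
qed

section \<open>A term language of polynomial-time functions\<close>

datatype trm =
    Var nat
  | One
  | Len
  | Bit trm
  | Add trm trm
  | Sub trm trm
  | Sum trm trm

text \<open>
  \<open>Sum b s\<close> binds a variable in \<open>s\<close>, referred to by index \<open>0\<close>. Subtraction is truncated.
\<close>

fun eval :: "trm \<Rightarrow> bool list \<Rightarrow> (nat \<Rightarrow> nat) \<Rightarrow> nat" where
  "eval (Var i) x e = e i"
| "eval One x e = 1"
| "eval Len x e = length x"
| "eval (Bit t) x e = of_bool (eval t x e < length x \<and> x ! eval t x e)"
| "eval (Add s t) x e = eval s x e + eval t x e"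
| "eval (Sub s t) x e = eval s x e - eval t x e"
| "eval (Sum b s) x e = (\<Sum>v<eval b x e. eval s x (case_nat v e))"

text \<open>
  Tape \<open>0\<close> is the output tape, tape \<open>1\<close> carries the input with the head at offset \<open>h\<close>, and
  tape \<open>j + 2\<close> is a counter: its head stands \<open>c j\<close> cells to the right of the only marked cell.
\<close>

definition tapes :: "bool list \<Rightarrow> nat \<Rightarrow> tape \<Rightarrow> nat \<Rightarrow> (nat \<Rightarrow> nat) \<Rightarrow> tape list" where
  "tapes x K u h c =
     u # (\<lambda>i. input_tape x (i + int h)) # map (\<lambda>j i. if i = - int (c j) then 1 else 0) [0..<K]"

definition mv :: "nat \<Rightarrow> dir \<Rightarrow> nat list \<Rightarrow> (nat \<times> dir) list" where
  "mv j d ss = map (\<lambda>i. (ss ! i, if i = j then d else Stay)) [0..<length ss]"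

lemma act_mv: "map2 act (mv j d (scan ts)) ts = ts[j := (\<lambda>i. (ts ! j) (i + offset d))]"
  by (rule nth_equalityI) (auto simp: mv_def scan_def act_def fun_eq_iff nth_list_update)

abbreviation Inc :: "nat \<Rightarrow> com" where
  "Inc j \<equiv> Act (mv (j + 2) Rgt)"

text \<open>At zero the head stays on the mark, which makes subtraction truncated without any
  further test.\<close>

definition Dec :: "nat \<Rightarrow> com" where
  "Dec j = Act (\<lambda>ss. if ss ! (j + 2) = 1 then keep ss else mv (j + 2) Lft ss)"

text \<open>Symbol \<open>2\<close> is the bit \<open>True\<close>. Beyond the input a blank is
  scanned, so an index out of range adds nothing.\<close>

definition IncBit :: "nat \<Rightarrow> com" where
  "IncBit j = Act (\<lambda>ss. if ss ! 1 = 2 then mv (j + 2) Rgt ss else keep ss)"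

definition nz :: "nat \<Rightarrow> nat list \<Rightarrow> bool" where
  "nz j ss \<longleftrightarrow> ss ! (j + 2) \<noteq> 1"

lemma nz_tapes: "j < K \<Longrightarrow> nz j (scan (tapes x K u h c)) \<longleftrightarrow> c j \<noteq> 0"
  by (simp add: nz_def scan_def tapes_def)

lemma tapes_upd:
  "j < K \<Longrightarrow> (tapes x K u h c)[j + 2 := (\<lambda>i. if i = - int n then 1 else 0)] = tapes x K u h (c(j := n))"
  unfolding tapes_def by simp (rule nth_equalityI, auto simp: nth_list_update)

lemma tapes_nth: "j < K \<Longrightarrow> tapes x K u h c ! (j + 2) = (\<lambda>i. if i = - int (c j) then 1 else 0)"
  by (simp add: tapes_def)

lemma runs_Inc: "j < K \<Longrightarrow> runs (Inc j) (tapes x K u h c) 1 (tapes x K u h (c(j := c j + 1)))"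
  by (rule runs_Act)
    (simp only: act_mv tapes_nth tapes_upd[symmetric], auto simp: fun_eq_iff intro!: arg_cong2[of _ _ _ _ "\<lambda>a. list_update _ a"])

lemma runs_Dec: "j < K \<Longrightarrow> runs (Dec j) (tapes x K u h c) 1 (tapes x K u h (c(j := c j - 1)))"
proof (cases "c j = 0")
  case True
  assume "j < K"
  with True have "scan (tapes x K u h c) ! (j + 2) = 1" by (simp add: scan_def tapes_def)
  with True show ?thesis
    unfolding Dec_def by (intro runs_Act) (simp add: fun_upd_idem)
next
  case False
  assume j: "j < K"
  with False have "scan (tapes x K u h c) ! (j + 2) \<noteq> 1" by (simp add: scan_def tapes_def)
  moreover have "(\<lambda>i. if i + offset Lft = - int (c j) then 1 else 0) =
      (\<lambda>i. if i = - int (c j - 1) then 1 else (0::nat))"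
    using False by (auto simp: fun_eq_iff of_nat_diff)
  ultimately show ?thesis
    unfolding Dec_def using j
    by (intro runs_Act) (simp only: act_mv tapes_nth tapes_upd[symmetric] if_False)
qed

lemma runs_in_Rgt: "runs (Act (mv 1 Rgt)) (tapes x K u h c) 1 (tapes x K u (h + 1) c)"
  by (rule runs_Act, simp only: act_mv) (simp add: tapes_def add.commute add.left_commute)

lemma runs_in_Lft: "h > 0 \<Longrightarrow> runs (Act (mv 1 Lft)) (tapes x K u h c) 1 (tapes x K u (h - 1) c)"
  by (rule runs_Act, simp only: act_mv) (simp add: tapes_def of_nat_diff algebra_simps)

lemma runs_IncBit:
  "j < K \<Longrightarrow> runs (IncBit j) (tapes x K u h c) 1
     (tapes x K u h (c(j := c j + of_bool (h < length x \<and> x ! h))))"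
proof -
  assume j: "j < K"
  have "scan (tapes x K u h c) ! 1 = 2 \<longleftrightarrow> h < length x \<and> x ! h"
    by (simp add: scan_def tapes_def input_tape_def bit_symbol_def)
  moreover have "map2 act (mv (j + 2) Rgt (scan (tapes x K u h c))) (tapes x K u h c) =
      tapes x K u h (c(j := c j + 1))"
    using j
    by (simp only: act_mv tapes_nth tapes_upd[symmetric]) (auto simp: fun_eq_iff intro!: arg_cong2[of _ _ _ _ "\<lambda>a. list_update _ a"])
  ultimately show ?thesis
    unfolding IncBit_def by (intro runs_Act) (simp add: fun_upd_triv)
qed

text \<open>
  \<open>compile t \<sigma> d r\<close> adds the value of \<open>t\<close> to counter \<open>r\<close>, where \<open>\<sigma>\<close> says in which counter a
  variable is held, and all counters from \<open>d\<close> on are free; these are \<open>0\<close> before and after.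
\<close>

fun compile :: "trm \<Rightarrow> (nat \<Rightarrow> nat) \<Rightarrow> nat \<Rightarrow> nat \<Rightarrow> com" where
  "compile (Var i) \<sigma> d r =
     While (nz (\<sigma> i)) (Dec (\<sigma> i) ;; Inc r ;; Inc d) ;; While (nz d) (Dec d ;; Inc (\<sigma> i))"
| "compile One \<sigma> d r = Inc r"
| "compile Len \<sigma> d r =
     While (\<lambda>ss. ss ! 1 \<noteq> 0) (Act (mv 1 Rgt) ;; Inc r ;; Inc d) ;;
     While (nz d) (Dec d ;; Act (mv 1 Lft))"
| "compile (Bit t) \<sigma> d r =
     compile t \<sigma> (d + 2) d ;;
     While (nz d) (Dec d ;; Inc (d + 1) ;; Act (mv 1 Rgt)) ;;
     IncBit r ;;
     While (nz (d + 1)) (Dec (d + 1) ;; Act (mv 1 Lft))"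
| "compile (Add s t) \<sigma> d r = compile s \<sigma> d r ;; compile t \<sigma> d r"
| "compile (Sub s t) \<sigma> d r =
     compile s \<sigma> (d + 2) d ;;
     compile t \<sigma> (d + 2) (d + 1) ;;
     While (nz (d + 1)) (Dec (d + 1) ;; Dec d) ;;
     While (nz d) (Dec d ;; Inc r)"
| "compile (Sum b s) \<sigma> d r =
     compile b \<sigma> (d + 2) d ;;
     While (nz d) (compile s (case_nat (d + 1) \<sigma>) (d + 2) r ;; Dec d ;; Inc (d + 1)) ;;
     While (nz (d + 1)) (Dec (d + 1))"

text \<open>The number of scratch counters. They return to \<open>0\<close>, so the subterms can
  share them and the maximum suffices.\<close>

fun need :: "trm \<Rightarrow> nat" where
  "need (Var i) = 1"
| "need One = 0"
| "need Len = 1"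
| "need (Bit t) = 2 + need t"
| "need (Add s t) = max (need s) (need t)"
| "need (Sub s t) = 2 + max (need s) (need t)"
| "need (Sum b s) = 2 + max (need b) (need s)"

text \<open>Bounds on value and cost in terms of an upper bound on input length plus variables.\<close>

fun valb :: "trm \<Rightarrow> nat \<Rightarrow> nat" where
  "valb (Var i) = (\<lambda>N. N)"
| "valb One = (\<lambda>N. 1)"
| "valb Len = (\<lambda>N. N)"
| "valb (Bit t) = (\<lambda>N. 1)"
| "valb (Add s t) = (\<lambda>N. valb s N + valb t N)"
| "valb (Sub s t) = valb s"
| "valb (Sum b s) = (\<lambda>N. valb b N * valb s (N + valb b N))"

fun cost :: "trm \<Rightarrow> nat \<Rightarrow> nat" where
  "cost (Var i) = (\<lambda>N. 9 * N + 2)"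
| "cost One = (\<lambda>N. 1)"
| "cost Len = (\<lambda>N. 9 * N + 2)"
| "cost (Bit t) = (\<lambda>N. cost t N + 9 * valb t N + 3)"
| "cost (Add s t) = (\<lambda>N. cost s N + cost t N)"
| "cost (Sub s t) = (\<lambda>N. cost s N + cost t N + 4 * valb t N + 4 * valb s N + 2)"
| "cost (Sum b s) = (\<lambda>N. cost b N + valb b N * (cost s (N + valb b N) + 7) + 2)"

lemma eval_le_valb: "length x \<le> N \<Longrightarrow> (\<And>i. e i \<le> N) \<Longrightarrow> eval t x e \<le> valb t N"
proof (induction t arbitrary: e N)
  case (Sum b s)
  have b: "eval b x e \<le> valb b N" by (rule Sum.IH(1)) (use Sum.prems in auto)
  have "eval s x (case_nat v e) \<le> valb s (N + valb b N)" if "v < eval b x e" for v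
    using that b Sum.prems
    by (intro Sum.IH(2)) (auto split: nat.split intro: trans_le_add1)
  then have "eval (Sum b s) x e \<le> eval b x e * valb s (N + valb b N)"
    using sum_bounded_above[of "{..<eval b x e}" "\<lambda>v. eval s x (case_nat v e)"] by simp
  also have "\<dots> \<le> valb b N * valb s (N + valb b N)" using b by simp
  finally show ?case by simp
next
  case (Add s t)
  then show ?case by (simp add: add_mono)
next
  case (Sub s t)
  then show ?case by (simp add: le_diff_conv trans_le_add1)
qed auto

section \<open>Correctness and running time of compiled terms\<close>

lemma runs_eq: "runs c ts n ts' \<Longrightarrow> ts' = ts'' \<Longrightarrow> n \<le> m \<Longrightarrow> runs c ts m ts''"
  using runs_mono by blast

lemma tapes_eq: "c = c' \<Longrightarrow> h = h' \<Longrightarrow> tapes x K u h c = tapes x K u h' c'"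
  by simp

lemma runs_eq2: "runs c ts n ts' \<Longrightarrow> ts = us \<Longrightarrow> ts' = ts'' \<Longrightarrow> n \<le> m \<Longrightarrow> runs c us m ts''"
  using runs_mono by blast

lemma runs_loop:
  assumes "\<And>k. k \<le> n \<Longrightarrow> b (scan (tapes x K u (g k) (f k))) \<longleftrightarrow> k < n"
    and "\<And>k. k < n \<Longrightarrow> runs body (tapes x K u (g k) (f k)) B (tapes x K u (g (Suc k)) (f (Suc k)))"
    and "f 0 = c" "g 0 = h" "f n = c'" "g n = h'" "n * (B + 2) + 1 \<le> N"
  shows "runs (While b body) (tapes x K u h c) N (tapes x K u h' c')"
  by (rule runs_eq2[OF runs_While[where S = "\<lambda>k. tapes x K u (g k) (f k)" and n = n and B = B]])
    (use assms in auto)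

text \<open>Reading a counter destroys it; the second copy in \<open>d\<close> is there to restore
  it afterwards.\<close>

lemma runs_move:
  assumes "i < K" "r < K" "d < K" "i \<noteq> r" "i \<noteq> d" "r \<noteq> d" "c d = 0"
  shows "runs (While (nz i) (Dec i ;; Inc r ;; Inc d)) (tapes x K u h c) (5 * c i + 1)
    (tapes x K u h (c(i := 0, r := c r + c i, d := c i)))"
proof (rule runs_loop[where n = "c i" and g = "\<lambda>k. h" and B = "1 + (1 + 1)"
      and f = "\<lambda>k. c(i := c i - k, r := c r + k, d := k)"])
  show "runs (Dec i ;; Inc r ;; Inc d) (tapes x K u h (c(i := c i - k, r := c r + k, d := k))) (1 + (1 + 1))
      (tapes x K u h (c(i := c i - Suc k, r := c r + Suc k, d := Suc k)))" for k
    by (rule runs_eq, (rule runs_Seq runs_Dec runs_Inc, (rule assms)?)+) (use assms in \<open>auto intro!: tapes_eq\<close>)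
qed (use assms in \<open>auto simp: nz_tapes fun_eq_iff\<close>)

lemma runs_add:
  assumes "i < K" "d < K" "i \<noteq> d"
  shows "runs (While (nz d) (Dec d ;; Inc i)) (tapes x K u h c) (4 * c d + 1)
    (tapes x K u h (c(i := c i + c d, d := 0)))"
proof (rule runs_loop[where n = "c d" and g = "\<lambda>k. h" and B = "1 + 1"
      and f = "\<lambda>k. c(i := c i + k, d := c d - k)"])
  show "runs (Dec d ;; Inc i) (tapes x K u h (c(i := c i + k, d := c d - k))) (1 + 1)
      (tapes x K u h (c(i := c i + Suc k, d := c d - Suc k)))" for k
    by (rule runs_eq, (rule runs_Seq runs_Dec runs_Inc, (rule assms)?)+) (use assms in \<open>auto intro!: tapes_eq\<close>)
qed (use assms in \<open>auto simp: nz_tapes fun_eq_iff\<close>)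

lemma runs_sub:
  assumes "i < K" "d < K" "i \<noteq> d"
  shows "runs (While (nz d) (Dec d ;; Dec i)) (tapes x K u h c) (4 * c d + 1)
    (tapes x K u h (c(i := c i - c d, d := 0)))"
proof (rule runs_loop[where n = "c d" and g = "\<lambda>k. h" and B = "1 + 1"
      and f = "\<lambda>k. c(i := c i - k, d := c d - k)"])
  show "runs (Dec d ;; Dec i) (tapes x K u h (c(i := c i - k, d := c d - k))) (1 + 1)
      (tapes x K u h (c(i := c i - Suc k, d := c d - Suc k)))" for k
    by (rule runs_eq, (rule runs_Seq runs_Dec, (rule assms)?)+) (use assms in \<open>auto intro!: tapes_eq\<close>)
qed (use assms in \<open>auto simp: nz_tapes fun_eq_iff\<close>)

lemma runs_clear:
  assumes "d < K"
  shows "runs (While (nz d) (Dec d)) (tapes x K u h c) (3 * c d + 1) (tapes x K u h (c(d := 0)))"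
proof (rule runs_loop[where n = "c d" and g = "\<lambda>k. h" and B = 1 and f = "\<lambda>k. c(d := c d - k)"])
  show "runs (Dec d) (tapes x K u h (c(d := c d - k))) 1 (tapes x K u h (c(d := c d - Suc k)))" for k
    by (rule runs_eq[OF runs_Dec[OF assms]]) (auto intro!: tapes_eq)
qed (use assms in \<open>auto simp: nz_tapes fun_eq_iff\<close>)

lemma runs_seek:
  assumes "i < K" "d < K" "i \<noteq> d" "c i = 0"
  shows "runs (While (nz d) (Dec d ;; Inc i ;; Act (mv 1 Rgt))) (tapes x K u 0 c) (5 * c d + 1)
    (tapes x K u (c d) (c(i := c d, d := 0)))"
proof (rule runs_loop[where n = "c d" and g = "\<lambda>k. k" and B = "1 + (1 + 1)"
      and f = "\<lambda>k. c(i := k, d := c d - k)"])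
  show "runs (Dec d ;; Inc i ;; Act (mv 1 Rgt)) (tapes x K u k (c(i := k, d := c d - k))) (1 + (1 + 1))
      (tapes x K u (Suc k) (c(i := Suc k, d := c d - Suc k)))" for k
    by (rule runs_eq, (rule runs_Seq runs_Dec runs_in_Rgt runs_Inc, (rule assms)?)+)
      (use assms in \<open>auto intro!: tapes_eq\<close>)
qed (use assms in \<open>auto simp: nz_tapes fun_eq_iff\<close>)

lemma runs_rewind:
  assumes "d < K"
  shows "runs (While (nz d) (Dec d ;; Act (mv 1 Lft))) (tapes x K u (c d) c) (4 * c d + 1)
    (tapes x K u 0 (c(d := 0)))"
proof (rule runs_loop[where n = "c d" and g = "\<lambda>k. c d - k" and B = "1 + 1" and f = "\<lambda>k. c(d := c d - k)"])
  show "runs (Dec d ;; Act (mv 1 Lft)) (tapes x K u (c d - k) (c(d := c d - k))) (1 + 1)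
      (tapes x K u (c d - Suc k) (c(d := c d - Suc k)))" if "k < c d" for k
    by (rule runs_eq, (rule runs_Seq runs_Dec runs_in_Lft, (rule assms)?)+) (use that in \<open>auto intro!: tapes_eq\<close>)
qed (use assms in \<open>auto simp: nz_tapes fun_eq_iff\<close>)

lemma runs_len:
  assumes "r < K" "d < K" "r \<noteq> d" "c d = 0"
  shows "runs (While (\<lambda>ss. ss ! 1 \<noteq> 0) (Act (mv 1 Rgt) ;; Inc r ;; Inc d)) (tapes x K u 0 c)
    (5 * length x + 1) (tapes x K u (length x) (c(r := c r + length x, d := length x)))"
proof (rule runs_loop[where n = "length x" and g = "\<lambda>k. k" and B = "1 + (1 + 1)"
      and f = "\<lambda>k. c(r := c r + k, d := k)"])
  show "runs (Act (mv 1 Rgt) ;; Inc r ;; Inc d) (tapes x K u k (c(r := c r + k, d := k))) (1 + (1 + 1))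
      (tapes x K u (Suc k) (c(r := c r + Suc k, d := Suc k)))" for k
    by (rule runs_eq, (rule runs_Seq runs_in_Rgt runs_Inc, (rule assms)?)+)
      (use assms in \<open>auto intro!: tapes_eq\<close>)
qed (use assms in \<open>auto simp: tapes_def scan_def input_tape_def bit_symbol_def fun_eq_iff\<close>)

text \<open>The hypotheses are a register discipline: variables and target lie below
  \<open>d\<close>, the target holds no variable, and scratch counters are zero. Only
  \<open>r\<close> changes, so the discipline holds again for the next subterm. \<open>N\<close>
  bounds the input length and all variables.\<close>

lemma runs_compile:
  assumes "length x \<le> N" "\<And>i. c (\<sigma> i) \<le> N" "\<And>i. \<sigma> i < d" "\<And>i. \<sigma> i \<noteq> r" "r < d"
    "\<And>j. j \<ge> d \<Longrightarrow> c j = 0" "d + need t \<le> K"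
  shows "runs (compile t \<sigma> d r) (tapes x K u 0 c) (cost t N)
           (tapes x K u 0 (c(r := c r + eval t x (\<lambda>i. c (\<sigma> i)))))"
  using assms
proof (induction t arbitrary: N c \<sigma> d r)
  case (Var i)
  have "\<sigma> i < K" "r < K" "d < K" "\<sigma> i \<noteq> r" "\<sigma> i \<noteq> d" "r \<noteq> d" "c d = 0"
    using Var.prems(3,4)[of i] Var.prems(5,6,7) by auto
  note * = this
  show ?case
    unfolding compile.simps
    by (rule runs_eq, rule runs_Seq, rule runs_move[where c = c, OF *], rule runs_add[OF *(1,3,5)])
      (use * Var.prems(2)[of i] in \<open>auto intro!: tapes_eq\<close>)
next
  case One
  then have "r < K" by simp
  then show ?case unfolding compile.simps by (rule runs_eq[OF runs_Inc]) (auto intro!: tapes_eq)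
next
  case Len
  then have *: "r < K" "d < K" "r \<noteq> d" "c d = 0"
    by auto
  have "runs (While (nz d) (Dec d ;; Act (mv 1 Lft))) (tapes x K u (length x) (c(r := c r + length x, d := length x)))
      (4 * length x + 1) (tapes x K u 0 (c(r := c r + length x, d := 0)))"
    by (rule runs_eq2[OF runs_rewind[OF *(2), where c = "c(r := c r + length x, d := length x)"]])
      (auto intro!: tapes_eq)
  from runs_Seq[OF runs_len[where c = c, OF *] this]
  show ?case
    unfolding compile.simps
    by (rule runs_eq) (use * Len.prems(1) in \<open>auto intro!: tapes_eq\<close>)
next
  case (Bit t)
  define v where "v = eval t x (\<lambda>i. c (\<sigma> i))"
  have ne: "\<sigma> i \<noteq> d" "\<sigma> i \<noteq> d + 1" for i using Bit.prems(3)[of i] by auto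
  have *: "d < K" "d + 1 < K" "r < K" "r \<noteq> d" "r \<noteq> d + 1" "d + 1 \<noteq> d" "c d = 0" "c (d + 1) = 0"
    using Bit.prems by auto
  have v: "v \<le> valb t N" unfolding v_def using Bit.prems by (intro eval_le_valb) auto
  have 1: "runs (compile t \<sigma> (d + 2) d) (tapes x K u 0 c) (cost t N) (tapes x K u 0 (c(d := v)))"
    by (rule runs_eq[OF Bit.IH[where N = N]]) (use Bit.prems ne * in \<open>auto simp: v_def less_SucI intro!: tapes_eq\<close>)
  \<comment> \<open>The index moves to \<open>d + 1\<close> while the input head advances, so that
    it later tells how far to rewind.\<close>
  have 2: "runs (While (nz d) (Dec d ;; Inc (d + 1) ;; Act (mv 1 Rgt))) (tapes x K u 0 (c(d := v)))
      (5 * v + 1) (tapes x K u v (c(d + 1 := v)))"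
    by (rule runs_eq[OF runs_seek[OF *(2,1,6)]]) (use * in \<open>auto intro!: tapes_eq\<close>)
  let ?c = "c(d + 1 := v, r := c r + of_bool (v < length x \<and> x ! v))"
  have 3: "runs (IncBit r) (tapes x K u v (c(d + 1 := v))) 1 (tapes x K u v ?c)"
    by (rule runs_eq[OF runs_IncBit[OF *(3)]]) (use * in \<open>auto intro!: tapes_eq\<close>)
  have 4: "runs (While (nz (d + 1)) (Dec (d + 1) ;; Act (mv 1 Lft))) (tapes x K u v ?c) (4 * v + 1)
      (tapes x K u 0 (?c(d + 1 := 0)))"
    by (rule runs_eq2[OF runs_rewind[OF *(2), where c = ?c]]) (use * in \<open>auto intro!: tapes_eq\<close>)
  from runs_Seq[OF 1 runs_Seq[OF 2 runs_Seq[OF 3 4]]]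
  show ?case
    unfolding compile.simps
    by (rule runs_eq) (use * v in \<open>auto simp: v_def intro!: tapes_eq\<close>)
next
  case (Add s t)
  let ?c = "c(r := c r + eval s x (\<lambda>i. c (\<sigma> i)))"
  have 1: "runs (compile s \<sigma> d r) (tapes x K u 0 c) (cost s N) (tapes x K u 0 ?c)"
    by (rule Add.IH) (use Add.prems in auto)
  have 2: "runs (compile t \<sigma> d r) (tapes x K u 0 ?c) (cost t N)
      (tapes x K u 0 (?c(r := ?c r + eval t x (\<lambda>i. ?c (\<sigma> i)))))"
    by (rule Add.IH) (use Add.prems in auto)
  from runs_Seq[OF 1 2] show ?case
    unfolding compile.simps
    by (rule runs_eq) (use Add.prems(4) in \<open>auto intro!: tapes_eq\<close>)
next
  case (Sub s t)
  define v where "v = eval s x (\<lambda>i. c (\<sigma> i))"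
  define w where "w = eval t x (\<lambda>i. c (\<sigma> i))"
  have ne: "\<sigma> i \<noteq> d" "\<sigma> i \<noteq> d + 1" for i using Sub.prems(3)[of i] by auto
  have *: "d < K" "d + 1 < K" "r < K" "r \<noteq> d" "r \<noteq> d + 1" "d + 1 \<noteq> d" "c d = 0" "c (d + 1) = 0"
    using Sub.prems by auto
  have v: "v \<le> valb s N" unfolding v_def using Sub.prems by (intro eval_le_valb) auto
  have w: "w \<le> valb t N" unfolding w_def using Sub.prems by (intro eval_le_valb) auto
  have 1: "runs (compile s \<sigma> (d + 2) d) (tapes x K u 0 c) (cost s N) (tapes x K u 0 (c(d := v)))"
    by (rule runs_eq[OF Sub.IH(1)[where N = N]]) (use Sub.prems ne * in \<open>auto simp: v_def less_SucI intro!: tapes_eq\<close>)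
  have 2: "runs (compile t \<sigma> (d + 2) (d + 1)) (tapes x K u 0 (c(d := v))) (cost t N)
      (tapes x K u 0 (c(d := v, d + 1 := w)))"
    by (rule runs_eq[OF Sub.IH(2)[where N = N]]) (use Sub.prems ne * in \<open>auto simp: w_def less_SucI intro!: tapes_eq\<close>)
  have 3: "runs (While (nz (d + 1)) (Dec (d + 1) ;; Dec d)) (tapes x K u 0 (c(d := v, d + 1 := w))) (4 * w + 1)
      (tapes x K u 0 (c(d := v - w)))"
    by (rule runs_eq[OF runs_sub[OF *(1,2) *(6)[symmetric]]]) (use * in \<open>auto intro!: tapes_eq\<close>)
  have 4: "runs (While (nz d) (Dec d ;; Inc r)) (tapes x K u 0 (c(d := v - w))) (4 * v + 1)
      (tapes x K u 0 (c(r := c r + (v - w))))"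
    by (rule runs_eq[OF runs_add[OF *(3,1,4)]]) (use * in \<open>auto intro!: tapes_eq\<close>)
  from runs_Seq[OF 1 runs_Seq[OF 2 runs_Seq[OF 3 4]]]
  show ?case
    unfolding compile.simps
    by (rule runs_eq) (use v w in \<open>auto simp: v_def w_def intro!: tapes_eq\<close>)
next
  case (Sum b s)
  let ?e = "\<lambda>i. c (\<sigma> i)"
  define n where "n = eval b x ?e"
  \<comment> \<open>The bound variable stays below the value of \<open>b\<close>, so
    \<open>M\<close> bounds all variables inside the sum.\<close>
  define M where "M = N + valb b N"
  have ne: "\<sigma> i \<noteq> d" "\<sigma> i \<noteq> d + 1" for i using Sum.prems(3)[of i] by auto
  have *: "d < K" "d + 1 < K" "r < K" "r \<noteq> d" "r \<noteq> d + 1" "d + 1 \<noteq> d" "c d = 0" "c (d + 1) = 0"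
    using Sum.prems by auto
  have n: "n \<le> valb b N" unfolding n_def using Sum.prems by (intro eval_le_valb) auto
  have 1: "runs (compile b \<sigma> (d + 2) d) (tapes x K u 0 c) (cost b N) (tapes x K u 0 (c(d := n)))"
    by (rule runs_eq[OF Sum.IH(1)[where N = N]]) (use Sum.prems ne * in \<open>auto simp: n_def less_SucI intro!: tapes_eq\<close>)
  \<comment> \<open>Counter \<open>d\<close> holds the rounds left; \<open>d + 1\<close> counts up
    and is the bound variable itself.\<close>
  define S where "S k = tapes x K u 0
    (c(d := n - k, d + 1 := k, r := c r + (\<Sum>v<k. eval s x (case_nat v ?e))))" for k
  let ?body = "compile s (case_nat (d + 1) \<sigma>) (d + 2) r ;; Dec d ;; Inc (d + 1)"
  have 2: "runs (While (nz d) ?body) (S 0) (n * ((cost s M + (1 + 1)) + 2) + 1) (S n)"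
  proof (rule runs_While)
    fix k assume k: "k < n"
    then show "nz d (scan (S k))" using * by (simp add: S_def nz_tapes)
    let ?c = "c(d := n - k, d + 1 := k, r := c r + (\<Sum>v<k. eval s x (case_nat v ?e)))"
    have e: "(\<lambda>i. ?c (case_nat (d + 1) \<sigma> i)) = case_nat k ?e"
      using ne * Sum.prems(4) by (auto simp: fun_eq_iff split: nat.split)
    have "runs (compile s (case_nat (d + 1) \<sigma>) (d + 2) r) (tapes x K u 0 ?c) (cost s M)
        (tapes x K u 0 (?c(r := ?c r + eval s x (\<lambda>i. ?c (case_nat (d + 1) \<sigma> i)))))"
    proof (rule Sum.IH(2))
      fix i
      show "?c (case_nat (d + 1) \<sigma> i) \<le> M"
        using fun_cong[OF e, of i] k n Sum.prems(2) 
        by (auto simp: M_def trans_le_add1 split: nat.split)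
      show "case_nat (d + 1) \<sigma> i < d + 2" "case_nat (d + 1) \<sigma> i \<noteq> r"
        using Sum.prems(3)[of "i - 1"] Sum.prems(4)[of "i - 1"] * by (auto split: nat.split)
    qed (use Sum.prems in \<open>auto simp: M_def\<close>)
    then show "runs ?body (S k) (cost s M + (1 + 1)) (S (Suc k))"
      unfolding S_def e
      by (intro runs_eq[OF runs_Seq[OF _ runs_Seq[OF runs_Dec[OF *(1)] runs_Inc[OF *(2)]]]])
        (use * in \<open>auto intro!: tapes_eq\<close>)
  qed (use * in \<open>simp add: S_def nz_tapes\<close>)
  have S0: "S 0 = tapes x K u 0 (c(d := n))"
    unfolding S_def using * by (auto intro!: tapes_eq)
  have 3: "runs (While (nz (d + 1)) (Dec (d + 1))) (S n) (3 * n + 1)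
      (tapes x K u 0 (c(r := c r + (\<Sum>v<n. eval s x (case_nat v ?e)))))"
    unfolding S_def
    by (rule runs_eq[OF runs_clear[OF *(2)]]) (use * in \<open>auto intro!: tapes_eq\<close>)
  have le: "n * (cost s M + 7) \<le> valb b N * (cost s M + 7)" using n by (rule mult_right_mono) simp
  show ?case
    unfolding compile.simps
    by (rule runs_eq[OF runs_Seq[OF 1 runs_Seq[OF 2[unfolded S0] 3]]])
      (use le in \<open>auto simp: n_def M_def algebra_simps intro!: tapes_eq\<close>)
qed

section \<open>A program printing a word bit by bit\<close>

text \<open>Both heads advance, so tape \<open>0\<close> ends up behind the input, where the output
  will be written.\<close>

definition copy :: "nat list \<Rightarrow> (nat \<times> dir) list" where
  "copy ss = (ss ! 0, Rgt) # (ss ! 0, Rgt) # keep (drop 2 ss)"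

text \<open>The extra step to the right on tape \<open>0\<close> leaves a blank between input and
  output, which stops the final rewinding in front of the first output bit.\<close>

definition mark :: "nat list \<Rightarrow> (nat \<times> dir) list" where
  "mark ss = (ss ! 0, Rgt) # (ss ! 1, Lft) # map (\<lambda>_. (1, Stay)) (drop 2 ss)"

text \<open>Tape \<open>4\<close> is counter \<open>2\<close>; if its mark is scanned, the value is
  zero and \<open>False\<close> is printed.\<close>

definition emit :: "nat list \<Rightarrow> (nat \<times> dir) list" where
  "emit ss = (if ss ! 4 = 1 then 1 else 2, Rgt) # keep (tl ss)"

text \<open>Counter \<open>0\<close> is the position being printed, counter \<open>1\<close> the
  number of bits left, counter \<open>2\<close> the value of \<open>t\<close>. Every free variable
  reads counter \<open>0\<close>.\<close>

definition prog :: "trm \<Rightarrow> trm \<Rightarrow> com" where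
  "prog t p =
     While (\<lambda>ss. ss ! 0 \<noteq> 0) (Act copy) ;; Act mark ;;
     While (\<lambda>ss. ss ! 1 \<noteq> 0) (Act (mv 1 Lft)) ;; Act (mv 1 Rgt) ;;
     compile p (\<lambda>_. 0) 3 1 ;;
     While (nz 1) (compile t (\<lambda>_. 0) 3 2 ;; Act emit ;; While (nz 2) (Dec 2) ;; Inc 0 ;; Dec 1) ;;
     Act (mv 0 Lft) ;; While (\<lambda>ss. ss ! 0 \<noteq> 0) (Act (mv 0 Lft)) ;; Act (mv 0 Rgt)"

lemma set_lt3: "set ss \<subseteq> {..<3} \<longleftrightarrow> (\<forall>i<length ss. ss ! i < (3::nat))"
  by (auto simp: subset_iff in_set_conv_nth)

lemma acts_ok_basic [simp]:
  "acts_ok k (Act (mv j d))" "acts_ok k (Dec j)" "acts_ok k (IncBit j)"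
  "k > 1 \<Longrightarrow> acts_ok k (Act copy)" "k > 1 \<Longrightarrow> acts_ok k (Act mark)" "k > 0 \<Longrightarrow> acts_ok k (Act emit)"
  by (auto simp: Dec_def IncBit_def mv_def keep_def copy_def mark_def emit_def set_lt3 in_set_conv_nth nth_tl)

lemma acts_ok_compile [simp]: "acts_ok k (compile t \<sigma> d r)"
  by (induction t arbitrary: \<sigma> d r) (simp_all del: acts_ok.simps(1))

lemma acts_ok_prog: "k > 1 \<Longrightarrow> acts_ok k (prog t p)"
  by (simp add: prog_def del: acts_ok.simps(1))

section \<open>Polynomial bounds\<close>

text \<open>Starting at \<open>N = 2\<close> makes bare powers suffice: constants and factors such
  as \<open>2\<close> are absorbed by the exponent.\<close>

definition pol_bounded :: "(nat \<Rightarrow> nat) \<Rightarrow> bool" where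
  "pol_bounded f \<longleftrightarrow> (\<exists>k. \<forall>N\<ge>2. f N \<le> N ^ k)"

lemma pol_bounded_const [intro]: "pol_bounded (\<lambda>N. a)"
proof -
  have "a \<le> N ^ a" if "N \<ge> 2" for N
    using less_exp[of a] power_mono[OF that, of a] by linarith
  then show ?thesis unfolding pol_bounded_def by blast
qed

lemma pol_bounded_id [intro]: "pol_bounded (\<lambda>N. N)"
  unfolding pol_bounded_def by (rule exI[of _ 1]) simp

lemma pol_bounded_mult [intro]:
  assumes "pol_bounded f" "pol_bounded g"
  shows "pol_bounded (\<lambda>N. f N * g N)"
proof -
  obtain k l where "\<forall>N\<ge>2. f N \<le> N ^ k" "\<forall>N\<ge>2. g N \<le> N ^ l"
    using assms unfolding pol_bounded_def by blast
  then have "\<forall>N\<ge>2. f N * g N \<le> N ^ (k + l)"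
    by (simp add: power_add mult_mono)
  then show ?thesis unfolding pol_bounded_def by blast
qed

lemma pol_bounded_add [intro]:
  assumes "pol_bounded f" "pol_bounded g"
  shows "pol_bounded (\<lambda>N. f N + g N)"
proof -
  obtain k l where kl: "\<forall>N\<ge>2. f N \<le> N ^ k" "\<forall>N\<ge>2. g N \<le> N ^ l"
    using assms unfolding pol_bounded_def by blast
  have "f N + g N \<le> N ^ (k + l + 1)" if N: "N \<ge> 2" for N
  proof -
    have "f N \<le> N ^ (k + l)" "g N \<le> N ^ (k + l)"
      using kl N power_increasing[of k "k + l" N] power_increasing[of l "k + l" N]
      by (meson le_add1 le_add2 le_trans one_le_numeral)+
    then have "f N + g N \<le> 2 * N ^ (k + l)" by simp
    also have "\<dots> \<le> N * N ^ (k + l)" using N by (rule mult_right_mono) simp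
    finally show ?thesis by simp
  qed
  then show ?thesis unfolding pol_bounded_def by blast
qed

text \<open>The substitution that \<open>valb\<close> and \<open>cost\<close> of a sum apply to the
  bounds of its body.\<close>

lemma pol_bounded_shift:
  assumes "pol_bounded f" "pol_bounded g"
  shows "pol_bounded (\<lambda>N. f (N + g N))"
proof -
  have "pol_bounded (\<lambda>N. N + g N)" by (intro pol_bounded_add pol_bounded_id assms(2))
  then obtain k l where k: "\<forall>N\<ge>2. f N \<le> N ^ k" and l: "\<forall>N\<ge>2. N + g N \<le> N ^ l"
    using assms(1) unfolding pol_bounded_def by blast
  have "f (N + g N) \<le> N ^ (l * k)" if N: "N \<ge> 2" for N
  proof -
    have "f (N + g N) \<le> (N + g N) ^ k" using k N by simp
    also have "\<dots> \<le> (N ^ l) ^ k" using l N by (intro power_mono) auto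
    finally show ?thesis by (simp add: power_mult)
  qed
  then show ?thesis unfolding pol_bounded_def by blast
qed

lemma pol_bounded_valb: "pol_bounded (valb t)"
  by (induction t)
    (simp_all only: valb.simps pol_bounded_const pol_bounded_id pol_bounded_add pol_bounded_mult pol_bounded_shift)

lemma pol_bounded_cost: "pol_bounded (cost t)"
  by (induction t)
    (simp_all only: cost.simps pol_bounded_const pol_bounded_id pol_bounded_add pol_bounded_mult
      pol_bounded_shift pol_bounded_valb)

section \<open>Running the printing program\<close>

lemma runs_prog_init:
  fixes x :: "bool list"
  defines "n \<equiv> length x"
  shows "runs (While (\<lambda>ss. ss ! 0 \<noteq> 0) (Act copy)) (input_tape x # replicate (K + 1) blank_tape)
    (3 * n + 1) ((\<lambda>i. input_tape x (i + int n)) # (\<lambda>i. input_tape x (i + int n)) # replicate K blank_tape)"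
proof -
  define S where "S k = (\<lambda>i. input_tape x (i + int k)) #
    (\<lambda>i. if i < 0 then input_tape x (i + int k) else 0) # replicate K blank_tape" for k
  have "runs (While (\<lambda>ss. ss ! 0 \<noteq> 0) (Act copy)) (S 0) (n * (1 + 2) + 1) (S n)"
  proof (rule runs_While)
    fix k assume "k < n"
    then show "scan (S k) ! 0 \<noteq> 0"
      by (simp add: S_def scan_def input_tape_def bit_symbol_def n_def)
    have "map2 act (keep (drop 2 (scan (S k)))) (replicate K blank_tape) = replicate K blank_tape"
      using act_keep[of "replicate K blank_tape"] by (simp add: S_def scan_def)
    moreover have "act (scan (S k) ! 0, Rgt) (S k ! 0) = S (Suc k) ! 0"
      by (auto simp: S_def act_def scan_def fun_eq_iff algebra_simps simp flip: eq_neg_iff_add_eq_0)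
    moreover have "act (scan (S k) ! 0, Rgt) (S k ! 1) = S (Suc k) ! 1"
      by (auto simp: S_def act_def scan_def fun_eq_iff algebra_simps simp flip: eq_neg_iff_add_eq_0)
    ultimately show "runs (Act copy) (S k) 1 (S (Suc k))"
      by (intro runs_Act) (simp add: copy_def S_def scan_def)
  qed (simp add: S_def scan_def input_tape_def n_def)
  then show ?thesis
    by (rule runs_eq2) (auto simp: S_def fun_eq_iff input_tape_def n_def blank_tape_def)
qed

text \<open>The rest \<open>d\<close> of the program is a parameter because sequencing associates to
  the right.\<close>

lemma runs_prog_start:
  fixes x :: "bool list"
  defines "n \<equiv> length x"
  assumes d: "runs d (tapes x K (\<lambda>i. input_tape x (i + int n + 1)) 0 (\<lambda>_. 0)) m ts"
  shows "runs (Act mark ;; While (\<lambda>ss. ss ! 1 \<noteq> 0) (Act (mv 1 Lft)) ;; Act (mv 1 Rgt) ;; d)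
    ((\<lambda>i. input_tape x (i + int n)) # (\<lambda>i. input_tape x (i + int n)) # replicate K blank_tape)
    (3 * n + 3 + m) ts"
proof -
  define S where "S k = (\<lambda>i. input_tape x (i + int n + 1)) # (\<lambda>i. input_tape x (i + int n - 1 - int k)) #
    replicate K (\<lambda>i. if i = 0 then 1 else 0)" for k
  let ?ts = "(\<lambda>i. input_tape x (i + int n)) # (\<lambda>i. input_tape x (i + int n)) # replicate K blank_tape"
  have 1: "runs (Act mark) ?ts 1 (S 0)"
  proof (rule runs_Act)
    have "map2 act (map (\<lambda>_. (1, Stay)) (scan (replicate K blank_tape))) (replicate K blank_tape) =
        replicate K (\<lambda>i. if i = 0 then 1 else 0)"
      by (rule nth_equalityI) (auto simp: act_def blank_tape_def fun_eq_iff scan_def)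
    then show "map2 act (mark (scan ?ts)) ?ts = S 0"
      by (auto simp: mark_def scan_def S_def act_def fun_eq_iff algebra_simps simp flip: eq_neg_iff_add_eq_0)
  qed
  have 2: "runs (While (\<lambda>ss. ss ! 1 \<noteq> 0) (Act (mv 1 Lft))) (S 0) (n * (1 + 2) + 1) (S n)"
  proof (rule runs_While)
    fix k assume "k < n"
    then show "scan (S k) ! 1 \<noteq> 0"
      by (simp add: S_def scan_def input_tape_def bit_symbol_def n_def)
    show "runs (Act (mv 1 Lft)) (S k) 1 (S (Suc k))"
      by (rule runs_Act, simp only: act_mv) (simp add: S_def algebra_simps)
  qed (simp add: S_def scan_def input_tape_def)
  have 3: "runs (Act (mv 1 Rgt)) (S n) 1 (tapes x K (\<lambda>i. input_tape x (i + int n + 1)) 0 (\<lambda>_. 0))"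
    by (rule runs_Act, simp only: act_mv) (simp add: S_def tapes_def algebra_simps map_replicate_const)
  show ?thesis
    by (rule runs_eq[OF runs_Seq[OF 1 runs_Seq[OF 2 runs_Seq[OF 3 d]]]]) auto
qed

lemma runs_prog:
  fixes t p :: trm and x :: "bool list"
  defines "K \<equiv> 3 + max (need t) (need p)" and "f \<equiv> \<lambda>i. eval t x (\<lambda>_. i) \<noteq> 0"
    and "N \<equiv> length x + 2" and "L \<equiv> eval p x (\<lambda>_. 0)"
  defines "B \<equiv> valb p N"
  shows "\<exists>ts. runs (prog t p) (input_tape x # replicate (K + 1) blank_tape)
      (10 * N + cost p N + B * (cost t (N + B) + 3 * valb t (N + B) + 10)) ts \<and>
    tape_output (hd ts) (map f [0..<L])"
proof -
  define n where "n = length x"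
  define u where "u = (\<lambda>i. input_tape x (i + int n + 1))"
  \<comment> \<open>Tape \<open>0\<close> after printing \<open>ys\<close>: these bits end just left
    of the head, and the rest is the old content \<open>u\<close>, blank from one cell before the
    output on.\<close>
  define w where "w ys = (\<lambda>i. if 0 \<le> i + int (length ys) \<and> i < 0 then bit_symbol (ys ! nat (i + int (length ys)))
    else u (i + int (length ys)))" for ys
  have K: "0 < K" "1 < K" "2 < K" by (auto simp: K_def)
  have LB: "L \<le> B" unfolding L_def B_def by (rule eval_le_valb) (auto simp: N_def)
  have 3: "runs (compile p (\<lambda>_. 0) 3 1) (tapes x K u 0 (\<lambda>_. 0)) (cost p N) (tapes x K u 0 ((\<lambda>_. 0)(1 := L)))"
    by (rule runs_eq[OF runs_compile[where N = N]]) (auto simp: N_def K_def L_def)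
  define S where "S k = tapes x K (w (map f [0..<k])) 0 ((\<lambda>_. 0)(0 := k, 1 := L - k))" for k
  let ?body = "compile t (\<lambda>_. 0) 3 2 ;; Act emit ;; While (nz 2) (Dec 2) ;; Inc 0 ;; Dec 1"
  let ?T = "cost t (N + B)"  let ?V = "valb t (N + B)"
  have 4: "runs (While (nz 1) ?body) (S 0) (L * ((?T + (1 + ((3 * ?V + 1) + (1 + 1)))) + 2) + 1) (S L)"
  proof (rule runs_While)
    fix k assume k: "k < L"
    then show "nz 1 (scan (S k))" using K by (simp add: S_def nz_tapes)
    define v where "v = eval t x (\<lambda>_. k)"
    let ?c = "(\<lambda>_. 0)(0 := k, 1 := L - k)"
    let ?w = "w (map f [0..<k])"  let ?w' = "w (map f [0..<Suc k])"
    have v: "v \<le> ?V" unfolding v_def by (rule eval_le_valb) (use k LB in \<open>auto simp: N_def\<close>)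
    have a: "runs (compile t (\<lambda>_. 0) 3 2) (S k) ?T (tapes x K ?w 0 (?c(2 := v)))"
      unfolding S_def
      by (rule runs_eq[OF runs_compile[where N = "N + B"]]) (use k LB in \<open>auto simp: N_def K_def v_def\<close>)
    have b: "runs (Act emit) (tapes x K ?w 0 (?c(2 := v))) 1 (tapes x K ?w' 0 (?c(2 := v)))"
    proof (rule runs_Act)
      let ?t = "tapes x K ?w 0 (?c(2 := v))"
      have s4: "scan ?t ! 4 = (if f k then 0 else 1)"
        using K nth_map[of 2 "[0..<K]" "\<lambda>j i. if i = - int ((?c(2 := v)) j) then 1 else (0::nat)"]
        by (simp add: scan_def tapes_def f_def v_def)
      have "act (if scan ?t ! 4 = 1 then 1 else 2, Rgt) ?w = ?w'"
        unfolding s4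
        by (auto simp: act_def w_def fun_eq_iff bit_symbol_def nth_append algebra_simps nat_less_iff)
      moreover have "map2 act (keep (tl (scan ?t))) (tl ?t) = tl ?t"
        using act_keep[of "tl ?t"] by (simp add: scan_def map_tl)
      ultimately show "map2 act (emit (scan ?t)) ?t = tapes x K ?w' 0 (?c(2 := v))"
        by (simp add: emit_def tapes_def scan_def)
    qed
    have c: "runs (While (nz 2) (Dec 2)) (tapes x K ?w' 0 (?c(2 := v))) (3 * ?V + 1) (tapes x K ?w' 0 ?c)"
      by (rule runs_eq[OF runs_clear[OF K(3)]]) (use v in \<open>auto intro!: tapes_eq\<close>)
    show "runs ?body (S k) (?T + (1 + ((3 * ?V + 1) + (1 + 1)))) (S (Suc k))"
      by (rule runs_eq[OF runs_Seq[OF a runs_Seq[OF b runs_Seq[OF c runs_Seq[OF runs_Inc[OF K(1)] runs_Dec[OF K(2)]]]]]])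
        (auto simp: S_def intro!: tapes_eq)
  qed (use K in \<open>simp add: S_def nz_tapes\<close>)
  have "w [] = u" by (auto simp: w_def fun_eq_iff)
  then have S0: "S 0 = tapes x K u 0 ((\<lambda>_. 0)(1 := L))" unfolding S_def by (auto intro!: tapes_eq)
  let ?ys = "map f [0..<L]"
  define R where "R k = (\<lambda>i. w ?ys (i - 1 - int k)) # tl (S L)" for k
  have 5: "runs (Act (mv 0 Lft)) (S L) 1 (R 0)"
    by (rule runs_Act, simp only: act_mv) (simp add: S_def R_def tapes_def)
  have 6: "runs (While (\<lambda>ss. ss ! 0 \<noteq> 0) (Act (mv 0 Lft))) (R 0) (L * (1 + 2) + 1) (R L)"
  proof (rule runs_While)
    fix k assume "k < L"
    then show "scan (R k) ! 0 \<noteq> 0"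
      by (simp add: R_def scan_def w_def bit_symbol_def)
    show "runs (Act (mv 0 Lft)) (R k) 1 (R (Suc k))"
      by (rule runs_Act, simp only: act_mv) (simp add: R_def algebra_simps)
  qed (simp add: R_def scan_def w_def u_def input_tape_def n_def)
  have 7: "runs (Act (mv 0 Rgt)) (R L) 1 ((\<lambda>i. w ?ys (i - int L)) # tl (S L))"
    by (rule runs_Act, simp only: act_mv) (simp add: R_def)
  have out: "tape_output (\<lambda>i. w ?ys (i - int L)) ?ys"
    by (auto simp: tape_output_def w_def u_def input_tape_def n_def)
  have L: "L * (?T + 3 * ?V + 10) \<le> B * (?T + 3 * ?V + 10)" using LB by (rule mult_right_mono) simp
  note rest = runs_Seq[OF 3 runs_Seq[OF 4[unfolded S0] runs_Seq[OF 5 runs_Seq[OF 6 7]]]]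
  have "runs (prog t p) (input_tape x # replicate (K + 1) blank_tape)
      (10 * N + cost p N + B * (?T + 3 * ?V + 10)) ((\<lambda>i. w ?ys (i - int L)) # tl (S L))"
    unfolding prog_def
    by (rule runs_eq[OF runs_Seq[OF runs_prog_init runs_prog_start[OF rest[unfolded u_def n_def]]]])
      (use L in \<open>auto simp: N_def algebra_simps\<close>)
  with out show ?thesis by force
qed

text \<open>
  \<open>e\<close> is the environment of a term under binders.
\<close>

definition D :: "(bool list \<Rightarrow> (nat \<Rightarrow> nat) \<Rightarrow> nat) \<Rightarrow> bool" where
  "D f \<longleftrightarrow> (\<exists>t. \<forall>x e. eval t x e = f x e)"

definition DP :: "(bool list \<Rightarrow> (nat \<Rightarrow> nat) \<Rightarrow> bool) \<Rightarrow> bool" where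
  "DP P \<longleftrightarrow> D (\<lambda>x e. of_bool (P x e))"

text \<open>This is the only way in which polynomial-time functions are obtained: definable bits and
  a definable length.\<close>

theorem polytime_map:
  assumes "DP (\<lambda>x e. P x (e 0))" "D (\<lambda>x e. l x)"
  shows "polytime (\<lambda>x. map (P x) [0..<l x])"
proof -
  obtain t p where t: "\<And>x e. eval t x e = of_bool (P x (e 0))" and p: "\<And>x e. eval p x e = l x"
    using assms unfolding DP_def D_def by blast
  let ?K = "3 + max (need t) (need p)"
  let ?B = "valb p"
  have "pol_bounded (\<lambda>N. 10 * N + cost p N + ?B N * (cost t (N + ?B N) + 3 * valb t (N + ?B N) + 10))"
    by (intro pol_bounded_add pol_bounded_mult pol_bounded_const pol_bounded_id pol_bounded_cost
        pol_bounded_valb pol_bounded_shift)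
  then obtain k where k: "\<And>N. N \<ge> 2 \<Longrightarrow>
      10 * N + cost p N + ?B N * (cost t (N + ?B N) + 3 * valb t (N + ?B N) + 10) \<le> N ^ k"
    unfolding pol_bounded_def by blast
  show ?thesis
  \<comment> \<open>The time bound is \<open>(length x + 2) ^ k\<close>; the shift by
    \<open>2\<close> matches the range of \<open>pol_bounded\<close>.\<close>
  proof (rule runs_computes[of "?K + 2" "prog t p" "[:2, 1:] ^ k"])
    fix x
    obtain ts where r: "runs (prog t p) (input_tape x # replicate (?K + 1) blank_tape)
        (10 * (length x + 2) + cost p (length x + 2) + ?B (length x + 2) *
          (cost t ((length x + 2) + ?B (length x + 2)) + 3 * valb t ((length x + 2) + ?B (length x + 2)) + 10)) ts"
      and out: "tape_output (hd ts) (map (\<lambda>i. eval t x (\<lambda>_. i) \<noteq> 0) [0..<eval p x (\<lambda>_. 0)])"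
      using runs_prog[where t = t and p = p and x = x] by metis
    have "runs (prog t p) (input_tape x # replicate (?K + 2 - 1) blank_tape)
        (poly ([:2, 1:] ^ k) (length x)) ts"
      using runs_mono[OF r k] by (simp add: poly_power add.commute)
    with out show "\<exists>ts. runs (prog t p) (input_tape x # replicate (?K + 2 - 1) blank_tape)
        (poly ([:2, 1:] ^ k) (length x)) ts \<and> tape_output (hd ts) (map (P x) [0..<l x])"
      by (auto simp: t p)
  qed (simp_all add: acts_ok_prog)
qed

section \<open>Closure properties of definable functions and predicates\<close>

lemma D_env: "D (\<lambda>x e. e i)"
  unfolding D_def by (rule exI[of _ "Var i"]) simp

lemma D_len: "D (\<lambda>x e. length x)"
  unfolding D_def by (rule exI[of _ Len]) simp

lemma D_bit: "D f \<Longrightarrow> DP (\<lambda>x e. f x e < length x \<and> x ! f x e)"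
  unfolding D_def DP_def by (metis eval.simps(4))

lemma D_add: "D f \<Longrightarrow> D g \<Longrightarrow> D (\<lambda>x e. f x e + g x e)"
  unfolding D_def by (metis eval.simps(5))

lemma D_sub: "D f \<Longrightarrow> D g \<Longrightarrow> D (\<lambda>x e. f x e - g x e)"
  unfolding D_def by (metis eval.simps(6))

lemma D_const: "D (\<lambda>x e. n)"
proof (induction n)
  case 0
  show ?case unfolding D_def by (rule exI[of _ "Sub One One"]) simp
next
  case (Suc n)
  then obtain t where "\<And>x e. eval t x e = n" unfolding D_def by blast
  then show ?case unfolding D_def by (intro exI[of _ "Add One t"]) simp
qed

text \<open>The second premise is the body in de Bruijn style: the summation index at position
  \<open>0\<close>, the outer environment shifted by one.\<close>

lemma D_sum:
  assumes "D b" "D (\<lambda>x e. s x (\<lambda>n. e (Suc n)) (e 0))"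
  shows "D (\<lambda>x e. \<Sum>v<b x e. s x e v)"
proof -
  obtain tb ts where "\<And>x e. eval tb x e = b x e" "\<And>x e. eval ts x e = s x (\<lambda>n. e (Suc n)) (e 0)"
    using assms unfolding D_def by blast
  then show ?thesis unfolding D_def by (intro exI[of _ "Sum tb ts"]) simp
qed

text \<open>Renaming lets a term for the outer variables be reused under a binder, where all of them
  are shifted.\<close>

fun ren :: "trm \<Rightarrow> (nat \<Rightarrow> nat) \<Rightarrow> trm" where
  "ren (Var i) \<rho> = Var (\<rho> i)"
| "ren One \<rho> = One"
| "ren Len \<rho> = Len"
| "ren (Bit t) \<rho> = Bit (ren t \<rho>)"
| "ren (Add s t) \<rho> = Add (ren s \<rho>) (ren t \<rho>)"
| "ren (Sub s t) \<rho> = Sub (ren s \<rho>) (ren t \<rho>)"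
| "ren (Sum b s) \<rho> = Sum (ren b \<rho>) (ren s (case_nat 0 (\<lambda>i. Suc (\<rho> i))))"

lemma case_nat_comp: "(\<lambda>i. case_nat v e (case_nat 0 (\<lambda>i. Suc (\<rho> i)) i)) = case_nat v (\<lambda>i. e (\<rho> i))"
  by (auto simp: fun_eq_iff split: nat.split)

lemma eval_ren: "eval (ren t \<rho>) x e = eval t x (\<lambda>i. e (\<rho> i))"
  by (induction t arbitrary: \<rho> e) (simp_all add: case_nat_comp)

lemma D_weaken:
  assumes "D f"
  shows "D (\<lambda>x e. f x (\<lambda>n. e (Suc n)))"
proof -
  obtain t where "\<And>x e. eval t x e = f x e" using assms unfolding D_def by blast
  then show ?thesis unfolding D_def by (intro exI[of _ "ren t Suc"]) (simp add: eval_ren)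
qed

lemma D_mult: "D f \<Longrightarrow> D g \<Longrightarrow> D (\<lambda>x e. f x e * g x e)"
  using D_sum[where s = "\<lambda>x e v. g x e", OF _ D_weaken] by simp

lemma DP_less: assumes "D f" "D g" shows "DP (\<lambda>x e. f x e < g x e)"
proof -
  \<comment> \<open>Truncated subtraction from \<open>1\<close>, applied twice, turns any positive
    difference into \<open>1\<close>.\<close>
  have "D (\<lambda>x e. 1 - (1 - (g x e - f x e)))"
    by (intro D_sub D_const assms)
  moreover have "1 - (1 - (g x e - f x e)) = of_bool (f x e < g x e)" for x e by auto
  ultimately show ?thesis by (simp add: DP_def)
qed

lemma DP_not: assumes "DP P" shows "DP (\<lambda>x e. \<not> P x e)"
proof -
  have "D (\<lambda>x e. 1 - of_bool (P x e))"
    using assms unfolding DP_def by (intro D_sub D_const)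
  moreover have "1 - of_bool b = (of_bool (\<not> b) :: nat)" for b by simp
  ultimately show ?thesis by (simp only: DP_def)
qed

lemma DP_conj: assumes "DP P" "DP Q" shows "DP (\<lambda>x e. P x e \<and> Q x e)"
  using D_mult[OF assms[unfolded DP_def]] by (simp add: DP_def of_bool_conj)

lemma DP_disj: assumes "DP P" "DP Q" shows "DP (\<lambda>x e. P x e \<or> Q x e)"
  using DP_not[OF DP_conj[OF DP_not[OF assms(1)] DP_not[OF assms(2)]]] by simp

lemma DP_imp: assumes "DP P" "DP Q" shows "DP (\<lambda>x e. P x e \<longrightarrow> Q x e)"
  using DP_disj[OF DP_not[OF assms(1)] assms(2)] by (simp only: imp_conv_disj)

lemma DP_le: assumes "D f" "D g" shows "DP (\<lambda>x e. f x e \<le> g x e)"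
  using DP_not[OF DP_less[OF assms(2,1)]] by (simp add: not_less)

lemma DP_eq: assumes "D f" "D g" shows "DP (\<lambda>x e. f x e = g x e)"
  using DP_conj[OF DP_le[OF assms] DP_le[OF assms(2,1)]] by (simp add: order_eq_iff)

lemma D_if:
  assumes "DP P" "D f" "D g"
  shows "D (\<lambda>x e. if P x e then f x e else g x e)"
proof -
  have "D (\<lambda>x e. of_bool (P x e) * f x e + of_bool (\<not> P x e) * g x e)"
    using assms(1) DP_not[OF assms(1)] assms(2,3) unfolding DP_def by (intro D_add D_mult)
  moreover have "of_bool (P x e) * f x e + of_bool (\<not> P x e) * g x e = (if P x e then f x e else g x e)" for x e
    by simp
  ultimately show ?thesis by simp
qed

lemma D_card:
  assumes "D b" "DP (\<lambda>x e. P x (\<lambda>n. e (Suc n)) (e 0))"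
  shows "D (\<lambda>x e. card {v. v < b x e \<and> P x e v})"
proof -
  have "D (\<lambda>x e. \<Sum>v<b x e. of_bool (P x e v))"
    using assms unfolding DP_def by (rule D_sum)
  moreover have "(\<Sum>v<n. of_bool (Q v)) = card {v. v < n \<and> Q v}" for n and Q :: "nat \<Rightarrow> bool"
    by (simp add: sum.If_cases Int_def)
  ultimately show ?thesis by simp
qed

lemma DP_ex:
  assumes "D b" "DP (\<lambda>x e. P x (\<lambda>n. e (Suc n)) (e 0))"
  shows "DP (\<lambda>x e. \<exists>v<b x e. P x e v)"
proof -
  have "DP (\<lambda>x e. 0 < card {v. v < b x e \<and> P x e v})"
    by (intro DP_less D_const D_card assms)
  moreover have "0 < card {v. v < n \<and> Q v} \<longleftrightarrow> (\<exists>v<n. Q v)" for n and Q :: "nat \<Rightarrow> bool"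
    by (auto simp: card_gt_0_iff)
  ultimately show ?thesis by simp
qed

lemma DP_all:
  assumes "D b" "DP (\<lambda>x e. P x (\<lambda>n. e (Suc n)) (e 0))"
  shows "DP (\<lambda>x e. \<forall>v<b x e. P x e v)"
  using DP_not[OF DP_ex[OF assms(1) DP_not[OF assms(2)]]] by simp

text \<open>A function vanishing from a constant on is a finite table. This is how data of an
  arbitrary machine, given by no formula, gets into terms.\<close>

lemma D_fin:
  assumes "D f" "\<And>n. n \<ge> b \<Longrightarrow> g n = 0"
  shows "D (\<lambda>x e. g (f x e))"
proof -
  have "D (\<lambda>x e. \<Sum>i<k. of_bool (f x e = i) * g i)" for k
  proof (induction k)
    case (Suc k)
    then show ?case
      using DP_eq[OF assms(1) D_const[of k]] unfolding DP_def
      by (simp, intro D_add D_mult D_const)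
  qed (simp add: D_const)
  then have "D (\<lambda>x e. \<Sum>i<b. of_bool (f x e = i) * g i)" .
  moreover have "(\<Sum>i<b. of_bool (n = i) * g i) = g n" for n
  proof -
    have "(\<Sum>i<b. of_bool (n = i) * g i) = (\<Sum>i<b. if n = i then g i else 0)"
      by (rule sum.cong) auto
    then show ?thesis using assms(2)[of n] by simp
  qed
  ultimately show ?thesis by (simp only:)
qed

lemma DP_fin: "D f \<Longrightarrow> (\<And>n. P n \<Longrightarrow> n < b) \<Longrightarrow> DP (\<lambda>x e. P (f x e))"
  unfolding DP_def by (rule D_fin[where b = b]) (auto simp: not_less[symmetric])

lemma D_poly: "D f \<Longrightarrow> D (\<lambda>x e. poly p (f x e))"
  by (induction p) (simp_all add: D_const D_add D_mult)

lemma D_div: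
  assumes "D f" "D g"
  shows "D (\<lambda>x e. f x e div g x e)"
proof -
  \<comment> \<open>The quotient is found by counting the positive multiples of the divisor up to
    the dividend.\<close>
  have "D (\<lambda>x e. if g x e = 0 then 0 else card {v. v < f x e \<and> (v + 1) * g x e \<le> f x e})"
    by (intro D_if DP_eq D_env D_const D_card DP_le D_mult D_add D_weaken assms)
  moreover have "(if b = 0 then 0 else card {v. v < a \<and> (v + 1) * b \<le> a}) = a div b" for a b :: nat
  proof -
    have "{v. v < a \<and> (v + 1) * b \<le> a} = {..<a div b}" if "b > 0"
    proof -
      have "v < a" if "(v + 1) * b \<le> a" for v
      proof -
        have "(v + 1) * 1 \<le> (v + 1) * b" using \<open>b > 0\<close> by (intro mult_le_mono2) simp
        from le_trans[OF this that] show ?thesis by simp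
      qed
      moreover have "(v + 1) * b \<le> a \<longleftrightarrow> v < a div b" for v
        using that by (simp only: less_eq_div_iff_mult_less_eq[symmetric] Suc_eq_plus1[symmetric] Suc_le_eq)
      ultimately show ?thesis by auto
    qed
    then show ?thesis by simp
  qed
  ultimately show ?thesis by (simp only:)
qed

lemma D_mod:
  assumes "D f" "D g"
  shows "D (\<lambda>x e. f x e mod g x e)"
proof -
  have "D (\<lambda>x e. f x e - f x e div g x e * g x e)"
    by (intro D_sub D_mult D_div assms)
  then show ?thesis by (simp add: minus_div_mult_eq_mod)
qed

lemmas D_intros = DP_conj DP_disj DP_imp DP_not DP_all DP_ex DP_le DP_less DP_eq
  D_env D_len D_const D_add D_sub D_mult D_div D_mod D_card D_poly

section \<open>Membership in NP\<close>

definition bitat :: "bool list \<Rightarrow> nat \<Rightarrow> bool" where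
  "bitat x i \<longleftrightarrow> i < length x \<and> x ! i"

lemma DP_bitat: "D f \<Longrightarrow> DP (\<lambda>x e. bitat x (f x e))"
  unfolding bitat_def by (rule D_bit)

text \<open>The bits of an encoding as a predicate of their position. Position \<open>n\<close>
  satisfies no disjunct: it is the \<open>False\<close> that ends the unary number.\<close>

definition code_bit :: "nat \<Rightarrow> (nat \<Rightarrow> nat \<Rightarrow> bool) \<Rightarrow> (nat \<Rightarrow> bool) \<Rightarrow> (nat \<Rightarrow> bool) \<Rightarrow> nat \<Rightarrow> bool" where
  "code_bit n a U N i \<longleftrightarrow>
     i < n \<or>
     (n < i \<and> i < n + 1 + n * n \<and> a ((i - (n + 1)) div n) ((i - (n + 1)) mod n)) \<or>
     (n + 1 + n * n \<le> i \<and> i < n + 1 + n * n + n \<and> U (i - (n + 1 + n * n))) \<or>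
     (n + 1 + n * n + n \<le> i \<and> N (i - (n + 1 + n * n + n)))"

lemma map_upt_shift: "map f [a..<a + n] = map (\<lambda>i. f (a + i)) [0..<n]"
  by (rule nth_equalityI) simp_all

lemma DP_iff: "DP P \<Longrightarrow> DP Q \<Longrightarrow> DP (\<lambda>x e. P x e = Q x e)"
  unfolding iff_conv_conj_imp by (intro D_intros)

lemma concat_map_upt:
  "concat (map (\<lambda>i. map (f i) [0..<n]) [0..<m]) = map (\<lambda>k. f (k div n) (k mod n)) [0..<m * n]"
proof (induction m)
  case (Suc m)
  have "map (\<lambda>k. f (k div n) (k mod n)) [m * n..<m * n + n] = map (f m) [0..<n]"
  proof -
    have "(m * n + i) div n = m" "(m * n + i) mod n = i" if "i < n" for i
      using that by simp_all
    then show ?thesis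
      unfolding map_upt_shift by (intro map_cong refl) simp
  qed
  then show ?case
    using Suc.IH upt_add_eq_append[of 0 "m * n" n] by (simp add: add.commute[of n])
qed simp

lemma encode_map:
  assumes E: "\<And>i j. i < n \<Longrightarrow> j < n \<Longrightarrow> {i, j} \<in> E \<longleftrightarrow> a i j"
    and UN: "\<And>i. i < n \<Longrightarrow> i \<in> U \<longleftrightarrow> U' i" "\<And>i. i < n \<Longrightarrow> i \<in> N \<longleftrightarrow> N' i"
  shows "encode n E U N = map (code_bit n a U' N') [0..<n + 1 + n * n + n + n]"
proof -
  let ?c = "code_bit n a U' N'"
  have 1: "map ?c [0..<n] = replicate n True"
  proof -
    have "map ?c [0..<n] = map (\<lambda>_. True) [0..<n]" by (rule map_cong) (auto simp: code_bit_def)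
    then show ?thesis by (simp add: map_replicate_const)
  qed
  have 2: "map ?c [n..<n + 1] = [False]"
    unfolding map_upt_shift by (simp add: code_bit_def)
  have 3: "map ?c [n + 1..<n + 1 + n * n] = concat (map (\<lambda>i. map (\<lambda>j. {i, j} \<in> E) [0..<n]) [0..<n])"
  proof -
    have "k mod n < n" if "k < n * n" for k using that by (cases n) simp_all
    then show ?thesis
      unfolding concat_map_upt map_upt_shift
      by (intro map_cong refl) (simp add: code_bit_def E less_mult_imp_div_less)
  qed
  have 4: "map ?c [n + 1 + n * n..<n + 1 + n * n + n] = map (\<lambda>i. i \<in> U) [0..<n]"
    unfolding map_upt_shift by (rule map_cong) (auto simp: code_bit_def UN)
  have 5: "map ?c [n + 1 + n * n + n..<n + 1 + n * n + n + n] = map (\<lambda>i. i \<in> N) [0..<n]"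
    unfolding map_upt_shift by (rule map_cong) (auto simp: code_bit_def UN)
  show ?thesis
    unfolding encode_def 1[symmetric] 2[symmetric] 3[symmetric] 4[symmetric] 5[symmetric]
    by (simp only: upt_add_eq_append[OF le0] map_append append_assoc)
qed

text \<open>Only entries above the diagonal are read, so the relation is symmetric and irreflexive
  for every word.\<close>

definition edge :: "(nat \<Rightarrow> bool) \<Rightarrow> nat \<Rightarrow> nat \<Rightarrow> nat \<Rightarrow> bool" where
  "edge X n i j \<longleftrightarrow> i < j \<and> X (n + 1 + i * n + j) \<or> j < i \<and> X (n + 1 + j * n + i)"

text \<open>Encoding what was read off from \<open>X\<close> must give \<open>X\<close> back; this
  rejects asymmetric matrices and diagonal entries.\<close>

definition valid_code :: "(nat \<Rightarrow> bool) \<Rightarrow> nat \<Rightarrow> nat \<Rightarrow> bool" where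
  "valid_code X m n \<longleftrightarrow> m = n + 1 + n * n + n + n \<and>
     (\<forall>i<m. X i = code_bit n (edge X n) (\<lambda>i. X (n + 1 + n * n + i)) (\<lambda>i. X (n + 1 + n * n + n + i)) i)"

definition deg :: "(nat \<Rightarrow> bool) \<Rightarrow> nat \<Rightarrow> (nat \<Rightarrow> bool) \<Rightarrow> nat \<Rightarrow> nat" where
  "deg X n P v = card {u. u < n \<and> P u \<and> edge X n u v}"

text \<open>The problem with all quantifiers bounded by \<open>n\<close> and degrees as
  cardinalities, hence definable. The last conjunct names, for each \<open>v\<close> that is not the
  only member, a member whose condition fails once \<open>v\<close> is gone.\<close>

definition solves :: "(nat \<Rightarrow> bool) \<Rightarrow> nat \<Rightarrow> (nat \<Rightarrow> bool) \<Rightarrow> bool" where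
  "solves X n w \<longleftrightarrow>
     (\<forall>i<n. X (n + 1 + n * n + i) \<longrightarrow> w i) \<and> (\<forall>i<n. X (n + 1 + n * n + n + i) \<longrightarrow> \<not> w i) \<and> (\<exists>i<n. w i) \<and>
     (\<forall>v<n. w v \<longrightarrow> deg X n (\<lambda>u. \<not> w u) v \<le> deg X n w v + 1) \<and>
     (\<forall>v<n. w v \<longrightarrow> (\<forall>u<n. w u \<longrightarrow> u = v) \<or>
        (\<exists>t<n. w t \<and> t \<noteq> v \<and> deg X n (\<lambda>u. w u \<and> u \<noteq> v) t + 1 < deg X n (\<lambda>u. \<not> (w u \<and> u \<noteq> v)) t))"

lemma solves_cong: "(\<And>i. i < n \<Longrightarrow> w i = w' i) \<Longrightarrow> solves X n w = solves X n w'"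
  unfolding solves_def deg_def by (simp cong: conj_cong imp_cong)

lemma solves_iff:
  assumes "\<And>i j. i < n \<Longrightarrow> j < n \<Longrightarrow> {i, j} \<in> E \<longleftrightarrow> edge X n i j"
    and "\<And>i. i < n \<Longrightarrow> X (n + 1 + n * n + i) \<longleftrightarrow> i \<in> U" "U \<subseteq> {..<n}"
    and "\<And>i. i < n \<Longrightarrow> X (n + 1 + n * n + n + i) \<longleftrightarrow> i \<in> N" "N \<subseteq> {..<n}"
    and "A \<subseteq> {..<n}"
  shows "solves X n (\<lambda>i. i \<in> A) \<longleftrightarrow>
    A \<subseteq> {..<n} - N \<and> U \<subseteq> A \<and> locally_minimal_defensive_alliance {..<n} E A"
proof -
  have deg: "deg_in E B v = deg X n P v" if "v < n" "B = {u. u < n \<and> P u}" for B P v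
    unfolding deg_in_def deg_def that(2) using assms(1) that(1) by (intro arg_cong[of _ _ card]) auto
  have in_A: "v \<in> A \<Longrightarrow> v < n" for v using assms(6) by auto
  have "deg_in E A v = deg X n (\<lambda>u. u \<in> A) v" "deg_in E ({..<n} - A) v = deg X n (\<lambda>u. u \<notin> A) v" if "v < n" for v
    by (rule deg[OF that], use in_A in blast)+
  then have 1: "defensive_alliance {..<n} E A \<longleftrightarrow>
      (\<forall>v<n. v \<in> A \<longrightarrow> deg X n (\<lambda>u. u \<notin> A) v \<le> deg X n (\<lambda>u. u \<in> A) v + 1)"
    unfolding defensive_alliance_def using in_A assms(6) by (metis (no_types, lifting))
  have "deg_in E (A - {t}) v = deg X n (\<lambda>u. u \<in> A \<and> u \<noteq> t) v"
    "deg_in E ({..<n} - (A - {t})) v = deg X n (\<lambda>u. \<not> (u \<in> A \<and> u \<noteq> t)) v" if "v < n" for v t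
    by (rule deg[OF that], use in_A in blast)+
  moreover have "A - {v} \<subseteq> {..<n}" for v using assms(6) by blast
  ultimately have 2: "defensive_alliance {..<n} E (A - {v}) \<longleftrightarrow>
      \<not> (\<exists>t<n. t \<in> A \<and> t \<noteq> v \<and>
         deg X n (\<lambda>u. u \<in> A \<and> u \<noteq> v) t + 1 < deg X n (\<lambda>u. \<not> (u \<in> A \<and> u \<noteq> v)) t)" for v
    unfolding defensive_alliance_def using in_A
    by (metis (no_types, lifting) Diff_iff insert_iff empty_iff not_le)
  have 3: "A - {v} \<noteq> {} \<longleftrightarrow> \<not> (\<forall>u<n. u \<in> A \<longrightarrow> u = v)" if "v \<in> A" for v
    using assms(6) by auto
  have 4: "A \<subseteq> {..<n} - N \<longleftrightarrow> (\<forall>i<n. X (n + 1 + n * n + n + i) \<longrightarrow> i \<notin> A)"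
    using assms(4,5,6) by auto
  have 5: "U \<subseteq> A \<longleftrightarrow> (\<forall>i<n. X (n + 1 + n * n + i) \<longrightarrow> i \<in> A)"
    using assms(2,3) by auto
  have 6: "A \<noteq> {} \<longleftrightarrow> (\<exists>i<n. i \<in> A)" using assms(6) by auto
  have 7: "\<not> (\<exists>v\<in>A. A - {v} \<noteq> {} \<and> defensive_alliance {..<n} E (A - {v})) \<longleftrightarrow>
    (\<forall>v<n. v \<in> A \<longrightarrow> (\<forall>u<n. u \<in> A \<longrightarrow> u = v) \<or> \<not> defensive_alliance {..<n} E (A - {v}))"
    using assms(6) 3 by blast
  show ?thesis
    unfolding solves_def locally_minimal_defensive_alliance_def 4 5 6 7 unfolding 1 2 not_not
    by blast
qed

lemma Ext_LMDA_iff: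
  "x \<in> Ext_LMDA \<longleftrightarrow> (\<exists>n<length x. \<exists>w. valid_code (bitat x) (length x) n \<and> solves (bitat x) n w)"
proof
  assume "x \<in> Ext_LMDA"
  then obtain n E U N A where x: "x = encode n E U N" and ok: "instance_ok n E U N"
    and A: "A \<subseteq> {..<n} - N \<and> U \<subseteq> A \<and> locally_minimal_defensive_alliance {..<n} E A"
    unfolding Ext_LMDA_def by blast
  have x': "x = map (code_bit n (\<lambda>i j. {i, j} \<in> E) (\<lambda>i. i \<in> U) (\<lambda>i. i \<in> N)) [0..<n + 1 + n * n + n + n]"
    unfolding x by (rule encode_map) simp_all
  then have X: "bitat x i \<longleftrightarrow> i < n + 1 + n * n + n + n \<and>
      code_bit n (\<lambda>i j. {i, j} \<in> E) (\<lambda>i. i \<in> U) (\<lambda>i. i \<in> N) i" for i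
    unfolding bitat_def by (auto simp del: upt_Suc)
  have ij: "i * n + j < n * n" if "i < n" "j < n" for i j
  proof -
    have "i * n + j < (i + 1) * n" using that by simp
    also have "\<dots> \<le> n * n" using that by (intro mult_right_mono) auto
    finally show ?thesis .
  qed
  have "bitat x (n + 1 + i * n + j) \<longleftrightarrow> {i, j} \<in> E" if "i < n" "j < n" for i j
    unfolding X using ij[OF that] that by (auto simp: code_bit_def)
  moreover have "{i, i} \<notin> E" for i
    using ok unfolding instance_ok_def simple_graph_def by fastforce
  ultimately have adj: "{i, j} \<in> E \<longleftrightarrow> edge (bitat x) n i j" if "i < n" "j < n" for i j
    using that unfolding edge_def by (metis insert_commute linorder_neqE_nat less_irrefl)
  have UN: "bitat x (n + 1 + n * n + i) \<longleftrightarrow> i \<in> U" "bitat x (n + 1 + n * n + n + i) \<longleftrightarrow> i \<in> N" if "i < n" for i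
    unfolding X using that by (auto simp: code_bit_def)
  then have "solves (bitat x) n (\<lambda>i. i \<in> A)"
    by (subst solves_iff[OF adj _ _ _ _]) (use ok A in \<open>auto simp: instance_ok_def\<close>)
  moreover have "encode n E U N = map (code_bit n (edge (bitat x) n) (\<lambda>i. bitat x (n + 1 + n * n + i))
      (\<lambda>i. bitat x (n + 1 + n * n + n + i))) [0..<n + 1 + n * n + n + n]" (is "_ = map ?c [0..<?m]")
    by (rule encode_map) (simp_all only: adj UN)
  then have eq: "x = map ?c [0..<?m]" by (rule trans[OF x])
  have len: "length x = ?m" using arg_cong[OF eq, of length] by (simp only: length_map length_upt diff_zero)
  have "x ! i = ?c i" if "i < ?m" for i
    using arg_cong[OF eq, of "\<lambda>l. l ! i"] nth_map_upt[of i ?m 0 ?c] that by (simp only: diff_zero add_0)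
  then have "valid_code (bitat x) (length x) n"
    unfolding valid_code_def len using len by (simp add: bitat_def[of x i for i])
  moreover have "n < length x" by (simp add: len)
  ultimately show "\<exists>n<length x. \<exists>w. valid_code (bitat x) (length x) n \<and> solves (bitat x) n w" by blast
next
  assume "\<exists>n<length x. \<exists>w. valid_code (bitat x) (length x) n \<and> solves (bitat x) n w"
  then obtain n w where wf: "valid_code (bitat x) (length x) n" and s: "solves (bitat x) n w" by blast
  define E where "E = {{i, j} | i j. i < n \<and> j < n \<and> edge (bitat x) n i j}"
  define U where "U = {i. i < n \<and> bitat x (n + 1 + n * n + i)}"
  define N where "N = {i. i < n \<and> bitat x (n + 1 + n * n + n + i)}"
  define A where "A = {i. i < n \<and> w i}"
  have adj: "{i, j} \<in> E \<longleftrightarrow> edge (bitat x) n i j" if "i < n" "j < n" for i j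
    using that unfolding E_def edge_def by (auto simp: doubleton_eq_iff)
  have ok: "instance_ok n E U N"
    unfolding instance_ok_def simple_graph_def by (auto simp: E_def U_def N_def edge_def)
  have "encode n E U N = map (code_bit n (edge (bitat x) n) (\<lambda>i. bitat x (n + 1 + n * n + i))
      (\<lambda>i. bitat x (n + 1 + n * n + n + i))) [0..<n + 1 + n * n + n + n]"
    by (rule encode_map) (simp_all add: adj U_def N_def)
  also have "\<dots> = map (bitat x) [0..<length x]"
    using wf unfolding valid_code_def by (intro map_cong) auto
  also have "\<dots> = x" by (rule nth_equalityI) (simp_all add: bitat_def)
  finally have "x = encode n E U N" by (rule sym)
  moreover have "solves (bitat x) n (\<lambda>i. i \<in> A)"
    using s solves_cong[of n w "\<lambda>i. i \<in> A"] by (simp add: A_def)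
  then have "A \<subseteq> {..<n} - N \<and> U \<subseteq> A \<and> locally_minimal_defensive_alliance {..<n} E A"
    by (subst (asm) solves_iff[OF adj, where U = U and N = N]) (auto simp: U_def N_def A_def)
  ultimately show "x \<in> Ext_LMDA" unfolding Ext_LMDA_def using ok by blast
qed

section \<open>Recovering input and certificate from a pair\<close>

lemma length_pair: "length (pair x u) = 2 * length x + 1 + length u"
  by (induction x) (auto simp: pair_def)

lemma pair_nth:
  "i < length x \<Longrightarrow> pair x u ! (2 * i)"
  "i < length x \<Longrightarrow> pair x u ! (2 * i + 1) = x ! i"
  "\<not> pair x u ! (2 * length x)"
  "pair x u ! (2 * length x + 1 + i) = u ! i"
proof -
  have c: "pair (b # x) u = True # b # pair x u" for b x by (simp add: pair_def)
  show "i < length x \<Longrightarrow> pair x u ! (2 * i)"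
  proof (induction x arbitrary: i)
    case (Cons b x)
    then show ?case by (cases i) (simp_all add: c)
  qed simp
  show "i < length x \<Longrightarrow> pair x u ! (2 * i + 1) = x ! i"
  proof (induction x arbitrary: i)
    case (Cons b x)
    then show ?case by (cases i) (simp_all add: c)
  qed simp
  show "\<not> pair x u ! (2 * length x)" "pair x u ! (2 * length x + 1 + i) = u ! i"
    by (induction x) (simp_all add: c, simp_all add: pair_def)
qed

text \<open>The input length \<open>m\<close> is found by search: the even positions of a pair carry
  markers, \<open>True\<close> before each input bit, and the first \<open>False\<close> comes right
  before the certificate.\<close>

definition verify :: "bool list \<Rightarrow> bool" where
  "verify z \<longleftrightarrow> (\<exists>m<length z. \<not> bitat z (2 * m) \<and> (\<forall>i<m. bitat z (2 * i)) \<and>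
     (\<exists>n<m. valid_code (\<lambda>i. i < m \<and> bitat z (2 * i + 1)) m n \<and>
        solves (\<lambda>i. i < m \<and> bitat z (2 * i + 1)) n (\<lambda>j. bitat z (2 * m + 1 + j))))"

lemma verify_pair:
  "verify (pair x u) \<longleftrightarrow> (\<exists>n<length x. valid_code (bitat x) (length x) n \<and> solves (bitat x) n (bitat u))"
proof -
  define z where "z = pair x u"
  define R where "R m \<longleftrightarrow> (\<exists>n<m. valid_code (\<lambda>i. i < m \<and> bitat z (2 * i + 1)) m n \<and>
    solves (\<lambda>i. i < m \<and> bitat z (2 * i + 1)) n (\<lambda>j. bitat z (2 * m + 1 + j)))" for m
  have len: "length z = 2 * length x + 1 + length u" by (simp add: z_def length_pair)
  have even: "bitat z (2 * i)" if "i < length x" for i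
    using pair_nth(1)[OF that] that by (simp add: bitat_def len z_def length_pair)
  have fin: "\<not> bitat z (2 * length x)"
    using pair_nth(3) by (simp add: bitat_def z_def)
  have X: "(\<lambda>i. i < length x \<and> bitat z (2 * i + 1)) = bitat x"
    using pair_nth(2) by (auto simp: bitat_def len z_def length_pair fun_eq_iff)
  have w: "(\<lambda>j. bitat z (2 * length x + 1 + j)) = bitat u"
    unfolding bitat_def len using pair_nth(4) by (simp add: z_def fun_eq_iff)
  have "(\<exists>m<length z. \<not> bitat z (2 * m) \<and> (\<forall>i<m. bitat z (2 * i)) \<and> R m) \<longleftrightarrow> R (length x)"
  proof
    assume "\<exists>m<length z. \<not> bitat z (2 * m) \<and> (\<forall>i<m. bitat z (2 * i)) \<and> R m"
    then obtain m where m: "\<not> bitat z (2 * m)" "\<forall>i<m. bitat z (2 * i)" "R m" by blast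
    then have "m = length x" using even fin by (meson linorder_neqE_nat)
    with m show "R (length x)" by simp
  qed (use even fin len in \<open>auto intro!: exI[of _ "length x"]\<close>)
  then show ?thesis
    unfolding R_def verify_def X w z_def[symmetric] .
qed

lemma DP_verify: "DP (\<lambda>x e. verify x)"
  unfolding verify_def valid_code_def solves_def deg_def edge_def code_bit_def
  by (intro D_intros DP_iff DP_bitat)

lemma Ext_LMDA_NP: "Ext_LMDA \<in> NP"
proof -
  have "polytime (\<lambda>z. map (\<lambda>i. verify z) [0..<1])"
    by (rule polytime_map) (intro DP_verify D_const)+
  then have V: "polytime (\<lambda>z. [verify z])" by simp
  moreover have "x \<in> Ext_LMDA \<longleftrightarrow> (\<exists>u. length u \<le> poly [:0, 1:] (length x) \<and> [verify (pair x u)] = [True])" for x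
  proof -
    \<comment> \<open>Only the first \<open>n\<close> bits matter, so any set fits into a
      certificate as long as the word itself.\<close>
    have w: "solves (bitat x) n w = solves (bitat x) n (bitat (map w [0..<length x]))" if "n < length x" for n w
      using that by (intro solves_cong) (auto simp: bitat_def)
    show ?thesis
    proof
      assume "x \<in> Ext_LMDA"
      then obtain n w where n: "n < length x" "valid_code (bitat x) (length x) n" "solves (bitat x) n w"
        unfolding Ext_LMDA_iff by blast
      then have "verify (pair x (map w [0..<length x]))"
        unfolding verify_pair using w by blast
      then show "\<exists>u. length u \<le> poly [:0, 1:] (length x) \<and> [verify (pair x u)] = [True]"
        by (intro exI[of _ "map w [0..<length x]"]) simp
    next
      assume "\<exists>u. length u \<le> poly [:0, 1:] (length x) \<and> [verify (pair x u)] = [True]"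
      then obtain u where "verify (pair x u)" by auto
      then show "x \<in> Ext_LMDA" unfolding Ext_LMDA_iff verify_pair by blast
    qed
  qed
  ultimately show ?thesis unfolding NP_def by blast
qed

section \<open>Locally minimal alliances solve one-in-all constraint nets\<close>

lemma deg_in_Int: "X \<subseteq> V \<Longrightarrow> deg_in E X v = card (X \<inter> {u \<in> V. {u, v} \<in> E})"
  unfolding deg_in_def by (rule arg_cong[of _ _ card]) blast

text \<open>
  Every constraint vertex \<open>w\<close> carries a path \<open>w - l w - z w\<close> with \<open>l w\<close> forced into and
  \<open>z w\<close> kept out of the alliance. As \<open>w\<close> is the only neighbor of \<open>l w\<close> in the alliance,
  removing \<open>l w\<close> can only be prevented by \<open>w\<close>, which bounds the degree of \<open>w\<close> in the alliance
  from above, whereas being an alliance bounds it from below.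
\<close>

lemma lmda_net:
  fixes V F C :: "'a set" and l z :: "'a \<Rightarrow> 'a" and M :: "'a \<Rightarrow> 'a set"
  defines "U \<equiv> C \<union> l ` C"
  assumes V: "finite V" "C \<subseteq> V" "l ` C \<subseteq> V" "F \<subseteq> V - U" "C \<noteq> {}" "C \<inter> l ` C = {}"
    and M: "\<And>w. w \<in> C \<Longrightarrow> {u \<in> V. {u, w} \<in> E} = insert (l w) (M w)"
      "\<And>w. w \<in> C \<Longrightarrow> M w \<subseteq> V - U" "\<And>w. w \<in> C \<Longrightarrow> card (M w) \<in> {3, 4}"
    and l: "\<And>w. w \<in> C \<Longrightarrow> {u \<in> V. {u, l w} \<in> E} = {w, z w}"
      "\<And>w. w \<in> C \<Longrightarrow> z w \<in> V - U - F"
    and F: "\<And>v. v \<in> F \<Longrightarrow> {u \<in> V. {u, v} \<in> E} \<subseteq> C"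
  shows "(\<exists>A. A \<subseteq> V - (V - U - F) \<and> U \<subseteq> A \<and> locally_minimal_defensive_alliance V E A) \<longleftrightarrow>
    (\<exists>S\<subseteq>F. \<forall>w\<in>C. card (S \<inter> M w) = 1)"
proof -
  have basic: "w \<in> U" "l w \<in> U" "l w \<noteq> w" "l w \<notin> M w" "z w \<notin> U" "z w \<notin> F" "z w \<in> V" "w \<in> V"
    if "w \<in> C" for w
  proof -
    show lw: "w \<in> U" "l w \<in> U" using that by (simp_all add: U_def)
    show "l w \<notin> M w" using lw M(2)[OF that] by blast
    show "l w \<noteq> w" using that V(6) imageI[OF that, of l] by (metis IntI empty_iff)
    show "z w \<notin> U" "z w \<notin> F" "z w \<in> V" using l(2)[OF that] by simp_all
    show "w \<in> V" using that V(2) by blast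
  qed
  have FU: "v \<notin> U" if "v \<in> F" for v using that V(4) by blast
  show ?thesis
  proof
  assume "\<exists>A. A \<subseteq> V - (V - U - F) \<and> U \<subseteq> A \<and> locally_minimal_defensive_alliance V E A"
  then obtain A where A0: "A \<subseteq> V - (V - U - F)" "U \<subseteq> A"
    and L: "locally_minimal_defensive_alliance V E A"
    by (elim exE conjE)
  have A: "A \<subseteq> U \<union> F" "U \<subseteq> A" using A0 by auto
  have da: "defensive_alliance V E A"
    and lm: "\<And>v. v \<in> A \<Longrightarrow> A - {v} \<noteq> {} \<Longrightarrow> \<not> defensive_alliance V E (A - {v})"
    using L unfolding locally_minimal_defensive_alliance_def by auto
  define S where "S = A \<inter> F"
  have AV: "A \<subseteq> V" using da by (simp add: defensive_alliance_def)
  have "card (S \<inter> M w) = 1" if w: "w \<in> C" for w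
  proof -
    note N = M(1)[OF w]
    have lw: "l w \<in> A" "w \<in> A" "l w \<noteq> w" "l w \<notin> M w" "l w \<notin> S"
      using basic[OF w] A(2) FU by (auto simp: S_def)
    have fin: "finite (M w)" using M(2)[OF w] V(1) finite_subset by blast
    define s where "s = card (S \<inter> M w)"
    have s: "card (M w - S) = card (M w) - s" "s \<le> card (M w)"
      using fin by (auto simp: s_def card_Diff_subset_Int Int_commute intro: card_mono)
    have "A \<inter> insert (l w) (M w) = insert (l w) (S \<inter> M w)"
      using A M(2)[OF w] lw by (auto simp: S_def)
    then have 1: "deg_in E A w = 1 + s"
      using lw fin by (simp add: deg_in_Int[OF AV] N s_def)
    have "(V - A) \<inter> insert (l w) (M w) = M w - S"
      using A M(2)[OF w] lw by (auto simp: S_def)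
    then have 2: "deg_in E (V - A) w = card (M w) - s"
      by (simp add: deg_in_Int[of "V - A" V] N s)
    \<comment> \<open>The alliance condition at \<open>w\<close>, where \<open>l w\<close> is one of
      the neighbors inside.\<close>
    have low: "card (M w) - s \<le> 1 + s + 1"
    proof -
      have "deg_in E (V - A) w \<le> deg_in E A w + 1" using da lw(2) by (simp add: defensive_alliance_def)
      then show ?thesis by (simp only: 1 2)
    qed
    have "w \<in> A - {l w}" using lw by simp
    then have "A - {l w} \<noteq> {}" by auto
    from lm[OF lw(1) this] AV obtain u where u: "u \<in> A" "u \<noteq> l w"
      and bad: "deg_in E (A - {l w}) u + 1 < deg_in E (V - (A - {l w})) u"
      unfolding defensive_alliance_def by (auto simp: not_le)
    \<comment> \<open>Removing \<open>l w\<close> affects only its neighbors \<open>w\<close> and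
      \<open>z w\<close>, and \<open>z w\<close> is outside the alliance.\<close>
    have "u = w"
    proof (rule ccontr)
      assume "u \<noteq> w"
      have "u \<noteq> z w" using l(2)[OF w] u(1) A by auto
      then have "u \<notin> {u \<in> V. {u, l w} \<in> E}" using \<open>u \<noteq> w\<close> by (simp add: l(1)[OF w])
      then have nl: "{l w, u} \<notin> E" using u(1) AV by (auto simp: insert_commute)
      have "deg_in E (A - {l w}) u = deg_in E A u" "deg_in E (V - (A - {l w})) u = deg_in E (V - A) u"
        unfolding deg_in_def using nl by (auto intro!: arg_cong[of _ _ card])
      with bad da u(1) show False unfolding defensive_alliance_def by fastforce
    qed
    have "(A - {l w}) \<inter> insert (l w) (M w) = S \<inter> M w"
      using A M(2)[OF w] lw by (auto simp: S_def)
    then have 3: "deg_in E (A - {l w}) w = s"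
      using AV by (simp add: deg_in_Int[of "A - {l w}" V] subset_iff N s_def)
    have "(V - (A - {l w})) \<inter> insert (l w) (M w) = insert (l w) (M w - S)"
      using A M(2)[OF w] lw AV by (auto simp: S_def)
    then have 4: "deg_in E (V - (A - {l w})) w = card (M w) - s + 1"
      using lw fin by (simp add: deg_in_Int[of "V - (A - {l w})" V] subset_iff N s)
    \<comment> \<open>With \<open>low\<close> this gives \<open>card (M w) \<le> 2 * s + 2\<close>
      and \<open>2 * s < card (M w)\<close>, which for sizes \<open>3\<close> and \<open>4\<close>
      forces \<open>s = 1\<close>.\<close>
    have "s + 1 < card (M w) - s + 1" using bad unfolding \<open>u = w\<close> 3 4 .
    with low M(3)[OF w] show ?thesis unfolding s_def[symmetric] by auto
  qed
  then show "\<exists>S\<subseteq>F. \<forall>w\<in>C. card (S \<inter> M w) = 1" by (intro exI[of _ S]) (auto simp: S_def)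
next
  assume "\<exists>S\<subseteq>F. \<forall>w\<in>C. card (S \<inter> M w) = 1"
  then obtain S0 where S0: "S0 \<subseteq> F" "\<And>w. w \<in> C \<Longrightarrow> card (S0 \<inter> M w) = 1" by blast
  \<comment> \<open>Vertices that no constraint sees are dropped: each of them could be removed
    without harm, against local minimality.\<close>
  define S where "S = S0 \<inter> (\<Union>w\<in>C. M w)"
  have "S \<inter> M w = S0 \<inter> M w" if "w \<in> C" for w using that by (auto simp: S_def)
  then have S: "card (S \<inter> M w) = 1" if "w \<in> C" for w using S0(2) that by simp
  have SF: "S \<subseteq> F" using S0(1) by (auto simp: S_def)
  define A where "A = U \<union> S"
  have AV: "A \<subseteq> V" using V SF by (auto simp: A_def U_def)
  have fin: "finite (M w)" if "w \<in> C" for w using M(2)[OF that] V(1) finite_subset by blast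
  have cM: "card (M w - S) = card (M w) - 1" if "w \<in> C" for w
    using S[OF that] fin[OF that] by (simp add: card_Diff_subset_Int Int_commute)
  have in_A: "l w \<in> A" "w \<in> A" "l w \<noteq> w" "l w \<notin> M w" "z w \<notin> A" "z w \<noteq> w" "z w \<in> V" "w \<in> V"
    if "w \<in> C" for w
    using basic[OF that] SF by (auto simp: A_def)
  have "defensive_alliance V E A"
    unfolding defensive_alliance_def
  proof (intro conjI ballI AV)
    fix v assume "v \<in> A"
    then consider "v \<in> C" | w where "w \<in> C" "v = l w" | "v \<in> S" by (auto simp: A_def U_def)
    then show "deg_in E (V - A) v \<le> deg_in E A v + 1"
    proof cases
      case 1
      have "A \<inter> insert (l v) (M v) = insert (l v) (S \<inter> M v)"
        "(V - A) \<inter> insert (l v) (M v) = M v - S"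
        using 1 M(2)[OF 1] in_A[OF 1] by (auto simp: A_def)
      then have "deg_in E A v = 2" "deg_in E (V - A) v = card (M v) - 1"
        using in_A[OF 1] S[OF 1] cM[OF 1] fin[OF 1]
        by (simp_all add: deg_in_Int[OF AV] deg_in_Int[of "V - A" V] M(1)[OF 1])
      then show ?thesis using M(3)[OF 1] by auto
    next
      case 2
      have "A \<inter> {w, z w} = {w}" "(V - A) \<inter> {w, z w} = {z w}" using in_A[OF 2(1)] by auto
      then show ?thesis
        by (simp add: deg_in_Int[OF AV] deg_in_Int[of "V - A" V] 2(2) l(1)[OF 2(1)])
    next
      case 3
      have "(V - A) \<inter> {u \<in> V. {u, v} \<in> E} = {}"
        using F[of v] 3 SF by (auto simp: A_def U_def)
      then have "deg_in E (V - A) v = 0" by (simp add: deg_in_Int[of "V - A" V])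
      then show ?thesis by simp
    qed
  qed
  moreover have "\<not> defensive_alliance V E (A - {v})" if v: "v \<in> A" for v
  proof -
    have *: "\<not> defensive_alliance V E (A - {v})"
      if "u \<in> A" "u \<noteq> v" "card ((A - {v}) \<inter> {x \<in> V. {x, u} \<in> E}) + 1 < card ((V - (A - {v})) \<inter> {x \<in> V. {x, u} \<in> E})"
      for u
      using that AV unfolding defensive_alliance_def
      by (auto simp: deg_in_Int[of "A - {v}" V] deg_in_Int[of "V - (A - {v})" V] subset_iff not_le intro!: bexI[of _ u])
    from v consider "v \<in> C" | w where "w \<in> C" "v = l w" | "v \<in> S" by (auto simp: A_def U_def)
    then show ?thesis
    proof cases
      case 1
      \<comment> \<open>Without \<open>v\<close>, its pendant neighbor \<open>l v\<close> has no
        neighbor inside and two outside.\<close>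
      have "(A - {v}) \<inter> {v, z v} = {}" "(V - (A - {v})) \<inter> {v, z v} = {v, z v}"
        using in_A[OF 1] by auto
      then show ?thesis using in_A[OF 1] by (intro *[of "l v"]) (simp_all only: l(1)[OF 1], auto)
    next
      case 2
      have "(A - {v}) \<inter> insert (l w) (M w) = S \<inter> M w"
        "(V - (A - {v})) \<inter> insert (l w) (M w) = insert (l w) (M w - S)"
        using 2 M(2)[OF 2(1)] in_A[OF 2(1)] AV by (auto simp: A_def)
      moreover have "card (S \<inter> M w) + 1 < card (insert (l w) (M w - S))"
        using in_A(4)[OF 2(1)] S[OF 2(1)] cM[OF 2(1)] fin[OF 2(1)] M(3)[OF 2(1)] by auto
      ultimately have "card ((A - {v}) \<inter> insert (l w) (M w)) + 1 < card ((V - (A - {v})) \<inter> insert (l w) (M w))"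
        by (simp only:)
      moreover have "w \<noteq> v" using in_A(3)[OF 2(1)] 2(2) by metis
      ultimately show ?thesis
        by (intro *[OF in_A(2)[OF 2(1)]]) (simp_all only: M(1)[OF 2(1)] not_False_eq_True)
    next
      case 3
      then obtain w where w: "w \<in> C" "v \<in> M w" by (auto simp: S_def)
      \<comment> \<open>As \<open>v\<close> was the only selected neighbor of \<open>w\<close>, its
        removal leaves just \<open>l w\<close> inside against at least three outside.\<close>
      have "S \<inter> M w = {v}" using S[OF w(1)] 3 w(2) by (metis IntI card_1_singletonE singletonD)
      then have "(A - {v}) \<inter> insert (l w) (M w) = {l w}"
        "(V - (A - {v})) \<inter> insert (l w) (M w) = M w"
        using 3 w M(2)[OF w(1)] in_A[OF w(1)] AV by (auto simp: A_def)
      moreover have "card {l w} + 1 < card (M w)"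
        using M(3)[OF w(1)] by auto
      ultimately have "card ((A - {v}) \<inter> insert (l w) (M w)) + 1 < card ((V - (A - {v})) \<inter> insert (l w) (M w))"
        by (simp only:)
      moreover have "w \<noteq> v" using basic(1)[OF w(1)] 3 SF FU by blast
      ultimately show ?thesis
        by (intro *[OF in_A(2)[OF w(1)]]) (simp_all only: M(1)[OF w(1)] not_False_eq_True)
    qed
  qed
  moreover have "A \<noteq> {}" using V(5) by (auto simp: A_def U_def)
  ultimately have "locally_minimal_defensive_alliance V E A"
    unfolding locally_minimal_defensive_alliance_def by blast
  moreover have "A \<subseteq> V - (V - U - F)" "U \<subseteq> A" using AV SF by (auto simp: A_def)
  ultimately show "\<exists>A. A \<subseteq> V - (V - U - F) \<and> U \<subseteq> A \<and> locally_minimal_defensive_alliance V E A" by blast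
  qed
qed

section \<open>A planar net for exact cover\<close>

text \<open>
  A matrix with \<open>Q\<close> rows (sets) and \<open>P\<close> columns (elements) becomes a grid of blocks of
  \<open>4 \<times> 4\<close> lattice points. Lattice points with odd coordinate sum are variables, some of the
  others are constraints. In block \<open>(p, q)\<close> the variable at \<open>(0, 3)\<close> says that set \<open>q\<close> is chosen,
  the one at \<open>(1, 0)\<close> that element \<open>p\<close> is covered by one of the sets below \<open>q\<close>, and
  \<open>(0, 1)\<close> and \<open>(3, 0)\<close> are the complements of these. The ring of the variables \<open>(1, 2)\<close>, \<open>(2, 1)\<close>,
  \<open>(3, 2)\<close>, \<open>(2, 3)\<close> around the constraint \<open>(2, 2)\<close> encodes, one-hot, which of the four
  combinations of both signals is present, so that the signals cross. If \<open>inc p q\<close> holds, one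
  combination is forbidden and the constraint at \<open>(3, 3)\<close> has one more neighbor, so that the
  vertical signal is incremented.
\<close>

locale net =
  fixes P Q :: nat and inc :: "nat \<Rightarrow> nat \<Rightarrow> bool" and ok :: "nat \<Rightarrow> bool"
begin

text \<open>One block more than the matrix has, to hold the right border of the last blocks.\<close>

definition W :: nat where "W = 4 * (P + 1)"

definition H :: nat where "H = 4 * (Q + 1)"

text \<open>The first disjunct gives the five constraints inside a block. The other two lie on block
  borders, between a signal and its complement; the outer left and lower borders, where signals
  start, have none.\<close>

definition clause :: "nat \<Rightarrow> nat \<Rightarrow> bool" where
  "clause X Y \<longleftrightarrow>
     (X div 4 < P \<and> Y div 4 < Q \<and>
        ((X mod 4 = 1 \<or> X mod 4 = 3) \<and> (Y mod 4 = 1 \<or> Y mod 4 = 3) \<or> X mod 4 = 2 \<and> Y mod 4 = 2)) \<or>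
     (X mod 4 = 0 \<and> Y mod 4 = 2 \<and> 0 < X div 4 \<and> X div 4 \<le> P \<and> Y div 4 < Q) \<or>
     (X mod 4 = 2 \<and> Y mod 4 = 0 \<and> X div 4 < P \<and> 0 < Y div 4 \<and> Y div 4 \<le> Q)"

definition rt :: "nat \<Rightarrow> nat \<Rightarrow> bool" where
  "rt X Y \<longleftrightarrow> X mod 4 \<noteq> 0 \<and> (X mod 4 = 3 \<and> Y mod 4 = 3 \<longrightarrow> inc (X div 4) (Y div 4))"

definition lf :: "nat \<Rightarrow> nat \<Rightarrow> bool" where
  "lf X Y \<longleftrightarrow> X mod 4 \<noteq> 0 \<and> \<not> (X mod 4 = 1 \<and> Y mod 4 = 1)"

definition up :: "nat \<Rightarrow> nat \<Rightarrow> bool" where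
  "up X Y \<longleftrightarrow> Y mod 4 \<noteq> 0 \<and> \<not> (X mod 4 = 1 \<and> Y mod 4 = 3)"

definition dn :: "nat \<Rightarrow> nat \<Rightarrow> bool" where
  "dn X Y \<longleftrightarrow> Y mod 4 \<noteq> 0 \<and> \<not> (X mod 4 = 3 \<and> Y mod 4 = 1)"

text \<open>Border constraints see only two variables. A banned pendant vertex supplies the third
  neighbor that the gadget demands.\<close>

definition neg :: "nat \<Rightarrow> nat \<Rightarrow> bool" where
  "neg X Y \<longleftrightarrow> X mod 4 = 0 \<or> Y mod 4 = 0"

text \<open>The exclusions are boundary conditions: chosen sets are admissible, nothing is covered
  before the first row, everything is covered after the last, and nothing is covered twice.\<close>

definition free :: "nat \<Rightarrow> nat \<Rightarrow> bool" where
  "free X Y \<longleftrightarrow> odd (X + Y) \<and> \<not> (X = 0 \<and> Y mod 4 = 3 \<and> \<not> ok (Y div 4)) \<and> \<not> (Y = 0 \<and> X mod 4 = 1) \<and>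
     \<not> (Y = 4 * Q \<and> X mod 4 = 3) \<and> \<not> (X mod 4 = 3 \<and> Y mod 4 = 2 \<and> inc (X div 4) (Y div 4))"

text \<open>Layer \<open>0\<close> is the lattice, layers \<open>1\<close> and \<open>2\<close> are the pendant paths, layer \<open>3\<close> pendant vertices.\<close>

definition vid :: "nat \<Rightarrow> nat \<Rightarrow> nat \<Rightarrow> nat" where
  "vid X Y k = (Y * W + X) * 4 + k"

text \<open>Directed away from the constraint at \<open>(X, Y)\<close>, which owns its edges and its
  pendant path. Neighborhoods and drawing thus become local to one lattice point.\<close>

definition lnk :: "nat \<Rightarrow> nat \<Rightarrow> nat \<Rightarrow> nat \<Rightarrow> nat \<Rightarrow> nat \<Rightarrow> bool" where
  "lnk X Y k X' Y' k' \<longleftrightarrow> clause X Y \<and>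
     (k = 0 \<and> k' = 0 \<and> (X' = X + 1 \<and> Y' = Y \<and> rt X Y \<or> X' + 1 = X \<and> Y' = Y \<and> lf X Y \<or>
                       X' = X \<and> Y' = Y + 1 \<and> up X Y \<or> X' = X \<and> Y' + 1 = Y \<and> dn X Y) \<or>
      k = 0 \<and> X' = X \<and> Y' = Y \<and> (k' = 1 \<or> k' = 3 \<and> neg X Y) \<or>
      k = 1 \<and> k' = 2 \<and> X' = X \<and> Y' = Y)"

definition size :: nat where "size = W * H * 4"

definition E :: "nat set set" where
  "E = {{vid X Y k, vid X' Y' k'} | X Y k X' Y' k'. lnk X Y k X' Y' k'}"

definition C :: "nat set" where "C = {vid X Y 0 | X Y. clause X Y}"

definition U :: "nat set" where "U = C \<union> Suc ` C"

definition Fr :: "nat set" where "Fr = {vid X Y 0 | X Y. X < W \<and> Y < H \<and> free X Y}"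

definition N :: "nat set" where "N = {..<size} - U - Fr"

definition M :: "nat \<Rightarrow> nat \<Rightarrow> nat set" where
  "M X Y = (if rt X Y then {vid (X + 1) Y 0} else {}) \<union> ((if lf X Y then {vid (X - 1) Y 0} else {}) \<union>
     ((if up X Y then {vid X (Y + 1) 0} else {}) \<union> ((if dn X Y then {vid X (Y - 1) 0} else {}) \<union>
     (if neg X Y then {vid X Y 3} else {}))))"

section \<open>Vertex numbers and neighborhoods\<close>

lemma vid_mod: "k < 4 \<Longrightarrow> vid X Y k mod 4 = k"
  unfolding vid_def by (simp only: mod_mult_self3 mod_less)

lemma vid_div: "k < 4 \<Longrightarrow> vid X Y k div 4 = Y * W + X"
  unfolding vid_def by (subst div_mult_self3) simp_all

lemma vid_eq:
  assumes "X < W" "X' < W" "k < 4" "k' < 4"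
  shows "vid X Y k = vid X' Y' k' \<longleftrightarrow> X = X' \<and> Y = Y' \<and> k = k'"
proof
  assume eq: "vid X Y k = vid X' Y' k'"
  have k: "k = k'" using arg_cong[OF eq, of "\<lambda>v. v mod 4"] assms by (simp add: vid_mod)
  have *: "Y * W + X = Y' * W + X'"
    using arg_cong[OF eq, of "\<lambda>v. v div 4"] assms by (simp add: vid_div)
  show "X = X' \<and> Y = Y' \<and> k = k'"
    using arg_cong[OF *, of "\<lambda>v. v mod W"] arg_cong[OF *, of "\<lambda>v. v div W"] assms k by simp
qed simp

lemma vid_less: "X < W \<Longrightarrow> Y < H \<Longrightarrow> k < 4 \<Longrightarrow> vid X Y k < size"
proof -
  assume "X < W" "Y < H" "k < 4"
  then have "Y * W + X < (Y + 1) * W" by simp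
  also have "\<dots> \<le> H * W" using \<open>Y < H\<close> by (intro mult_right_mono) auto
  finally show ?thesis using \<open>k < 4\<close> by (simp add: vid_def size_def mult.commute)
qed

lemma vid_cases:
  assumes "v < size"
  obtains X Y k where "v = vid X Y k" "X < W" "Y < H" "k < 4"
proof (rule that)
  have "W > 0" by (simp add: W_def)
  show "v = vid (v div 4 mod W) (v div 4 div W) (v mod 4)" by (simp add: vid_def)
  show "v div 4 mod W < W" using \<open>W > 0\<close> by simp
  show "v div 4 div W < H"
    using assms by (simp add: size_def less_mult_imp_div_less mult.commute mult.left_commute)
qed simp

lemma clause_block: "clause X Y \<Longrightarrow> X div 4 \<le> P \<and> Y div 4 \<le> Q"
  by (auto simp: clause_def)

lemma less_block: "n < 4 * (n div 4) + (4 :: nat)"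
  using div_mult_mod_eq[of n 4] mod_less_divisor[of 4 n] by linarith

lemma clause_bounds: "clause X Y \<Longrightarrow> X < W \<and> Y < H"
  using clause_block[of X Y] less_block[of X] less_block[of Y] by (auto simp: W_def H_def)

lemma clause_right:
  assumes "clause X Y" "rt X Y"
  shows "X + 1 < W"
proof -
  have "X div 4 < P" using assms by (auto simp: clause_def rt_def)
  then show ?thesis using less_block[of X] by (auto simp: W_def)
qed

lemma clause_up:
  assumes "clause X Y" "up X Y"
  shows "Y + 1 < H"
proof -
  have "Y div 4 < Q" using assms by (auto simp: clause_def up_def)
  then show ?thesis using less_block[of Y] by (auto simp: H_def)
qed

lemma clause_even: "clause X Y \<Longrightarrow> even (X + Y)"
  unfolding even_add even_even_mod_4_iff[of X] even_even_mod_4_iff[of Y] by (auto simp: clause_def)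

lemma lf_pos: "lf X Y \<Longrightarrow> X > 0"
  by (auto simp: lf_def intro: gr0I)

lemma dn_pos: "dn X Y \<Longrightarrow> Y > 0"
  by (auto simp: dn_def intro: gr0I)

lemma lnk_bounds:
  assumes "lnk X Y k X' Y' k'"
  shows "X < W" "Y < H" "k < 4" "X' < W" "Y' < H" "k' < 4"
  using assms clause_bounds[of X Y] clause_right[of X Y] clause_up[of X Y] unfolding lnk_def by auto

lemma edge_iff:
  assumes "X < W" "k < 4" "X' < W" "k' < 4"
  shows "{vid X Y k, vid X' Y' k'} \<in> E \<longleftrightarrow> lnk X Y k X' Y' k' \<or> lnk X' Y' k' X Y k"
proof
  assume "{vid X Y k, vid X' Y' k'} \<in> E"
  then obtain A B c A' B' c' where a: "lnk A B c A' B' c'"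
    and "{vid X Y k, vid X' Y' k'} = {vid A B c, vid A' B' c'}"
    unfolding E_def by blast
  then show "lnk X Y k X' Y' k' \<or> lnk X' Y' k' X Y k"
    using lnk_bounds[OF a] assms by (auto simp: doubleton_eq_iff vid_eq)
next
  assume "lnk X Y k X' Y' k' \<or> lnk X' Y' k' X Y k"
  moreover have "{vid A B c, vid A' B' c'} \<in> E" if "lnk A B c A' B' c'" for A B c A' B' c'
    unfolding E_def mem_Collect_eq using that by blast
  ultimately show "{vid X Y k, vid X' Y' k'} \<in> E"
    by (metis insert_commute)
qed

lemma simple_graph_E: "simple_graph {..<size} E"
  unfolding simple_graph_def
proof (intro conjI ballI)
  fix e assume "e \<in> E"
  then obtain X Y k X' Y' k' where a: "lnk X Y k X' Y' k'" and e: "e = {vid X Y k, vid X' Y' k'}"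
    unfolding E_def by blast
  note b = lnk_bounds[OF a]
  show "e \<subseteq> {..<size}" using b by (auto simp: e vid_less)
  have "vid X Y k \<noteq> vid X' Y' k'" using a b by (auto simp: vid_eq lnk_def)
  then show "card e = 2" by (simp add: e)
qed simp

lemma U_N_bounds: "U \<subseteq> {..<size}" "N \<subseteq> {..<size}"
proof -
  have "vid X Y 1 < size" "vid X Y 0 < size" if "clause X Y" for X Y
    using clause_bounds[OF that] by (simp_all add: vid_less)
  then show "U \<subseteq> {..<size}" by (auto simp: U_def C_def vid_def)
qed (auto simp: N_def)

lemma card_if:
  "finite B \<Longrightarrow> (c \<Longrightarrow> a \<notin> B) \<Longrightarrow>
    card (T \<inter> ((if c then {a} else {}) \<union> B)) = of_bool (c \<and> a \<in> T) + card (T \<inter> B)"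
  by (auto simp: Int_Un_distrib card_insert_if)

lemma card_Int_M:
  assumes "clause X Y"
  shows "card (T \<inter> M X Y) = of_bool (rt X Y \<and> vid (X + 1) Y 0 \<in> T) + (of_bool (lf X Y \<and> vid (X - 1) Y 0 \<in> T) +
    (of_bool (up X Y \<and> vid X (Y + 1) 0 \<in> T) + (of_bool (dn X Y \<and> vid X (Y - 1) 0 \<in> T) +
    of_bool (neg X Y \<and> vid X Y 3 \<in> T))))"
proof -
  note b = clause_bounds[OF assms] lf_pos[of X Y] dn_pos[of X Y]
  have b': "rt X Y \<Longrightarrow> X + 1 < W" "X - 1 < W" "X < W" using b clause_right[OF assms] by auto
  have last: "card (T \<inter> (if neg X Y then {vid X Y 3} else {})) = of_bool (neg X Y \<and> vid X Y 3 \<in> T)" by auto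
  show ?thesis
    unfolding M_def using b b' by (subst card_if, simp, auto simp: vid_eq split: if_splits)+
qed

lemma card_M: "clause X Y \<Longrightarrow> card (M X Y) \<in> {3, 4}"
  using card_Int_M[of X Y UNIV] by (auto simp: clause_def rt_def lf_def up_def dn_def neg_def)

lemma vid_mem:
  assumes "X < W" "k < 4"
  shows "vid X Y k \<in> C \<longleftrightarrow> k = 0 \<and> clause X Y" "vid X Y k \<in> Suc ` C \<longleftrightarrow> k = 1 \<and> clause X Y"
    "vid X Y k \<in> Fr \<longleftrightarrow> k = 0 \<and> Y < H \<and> free X Y"
proof -
  have S: "Suc (vid A B 0) = vid A B 1" for A B by (simp add: vid_def)
  show "vid X Y k \<in> C \<longleftrightarrow> k = 0 \<and> clause X Y"
    using assms clause_bounds by (auto simp: C_def vid_eq)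
  show "vid X Y k \<in> Suc ` C \<longleftrightarrow> k = 1 \<and> clause X Y"
    using assms clause_bounds by (force simp: C_def vid_eq S image_iff)
  show "vid X Y k \<in> Fr \<longleftrightarrow> k = 0 \<and> Y < H \<and> free X Y"
    using assms by (auto simp: Fr_def vid_eq)
qed

lemma vid_not_mem:
  assumes "X < W" "k < 4" "\<not> clause X Y \<or> 2 \<le> k \<or> k \<noteq> 1 \<and> k \<noteq> 0"
  shows "vid X Y k \<notin> C \<union> Suc ` C"
  unfolding Un_iff vid_mem[OF assms(1,2)] using assms(3) by auto

lemma lnk_odd: "lnk X Y k X' Y' 0 \<Longrightarrow> odd (X' + Y')"
  using clause_even[of X Y] by (auto simp: lnk_def)

lemma neighbors_iff:
  assumes "X < W" "Y < H" "k < 4"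
  shows "u \<in> {u \<in> {..<size}. {u, vid X Y k} \<in> E} \<longleftrightarrow>
    (\<exists>A B c. u = vid A B c \<and> (lnk X Y k A B c \<or> lnk A B c X Y k))"
proof
  assume "u \<in> {u \<in> {..<size}. {u, vid X Y k} \<in> E}"
  then have u: "u < size" and e: "{u, vid X Y k} \<in> E" by auto
  from u obtain A B c where u: "u = vid A B c" "A < W" "B < H" "c < 4" by (rule vid_cases)
  from e show "\<exists>A B c. u = vid A B c \<and> (lnk X Y k A B c \<or> lnk A B c X Y k)"
    unfolding u(1) edge_iff[OF u(2,4) assms(1,3)] by blast
next
  assume "\<exists>A B c. u = vid A B c \<and> (lnk X Y k A B c \<or> lnk A B c X Y k)"
  then obtain A B c where u: "u = vid A B c" and l: "lnk X Y k A B c \<or> lnk A B c X Y k" by blast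
  from l have b: "A < W" "B < H" "c < 4" by (auto dest: lnk_bounds)
  with l u show "u \<in> {u \<in> {..<size}. {u, vid X Y k} \<in> E}"
    using edge_iff[OF b(1,3) assms(1,3)] by (auto simp: vid_less)
qed

lemma M_iff:
  assumes "clause X Y"
  shows "u \<in> insert (vid X Y 1) (M X Y) \<longleftrightarrow> (\<exists>A B c. u = vid A B c \<and> lnk X Y 0 A B c)"
proof
  assume "u \<in> insert (vid X Y 1) (M X Y)"
  then consider "u = vid X Y 1" | "u = vid (X + 1) Y 0" "rt X Y" | "u = vid (X - 1) Y 0" "lf X Y"
    | "u = vid X (Y + 1) 0" "up X Y" | "u = vid X (Y - 1) 0" "dn X Y" | "u = vid X Y 3" "neg X Y"
    by (auto simp: M_def split: if_splits)
  then show "\<exists>A B c. u = vid A B c \<and> lnk X Y 0 A B c"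
  proof cases
    case 1
    then show ?thesis using assms by (intro exI[of _ X] exI[of _ Y] exI[of _ 1]) (simp add: lnk_def)
  next
    case 2
    then show ?thesis using assms by (intro exI[of _ "X + 1"] exI[of _ Y] exI[of _ 0]) (simp add: lnk_def)
  next
    case 3
    then show ?thesis
      using assms lf_pos[of X Y] by (intro exI[of _ "X - 1"] exI[of _ Y] exI[of _ 0]) (simp add: lnk_def)
  next
    case 4
    then show ?thesis using assms by (intro exI[of _ X] exI[of _ "Y + 1"] exI[of _ 0]) (simp add: lnk_def)
  next
    case 5
    then show ?thesis
      using assms dn_pos[of X Y] by (intro exI[of _ X] exI[of _ "Y - 1"] exI[of _ 0]) (simp add: lnk_def)
  next
    case 6
    then show ?thesis using assms by (intro exI[of _ X] exI[of _ Y] exI[of _ 3]) (simp add: lnk_def)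
  qed
next
  assume "\<exists>A B c. u = vid A B c \<and> lnk X Y 0 A B c"
  then obtain A B c where "u = vid A B c" "lnk X Y 0 A B c" by blast
  then show "u \<in> insert (vid X Y 1) (M X Y)" by (auto simp: M_def lnk_def)
qed

lemma vid_Suc: "Suc (vid X Y 0) = vid X Y 1" "Suc (vid X Y 1) = vid X Y 2"
  by (simp_all add: vid_def)

definition Mv :: "nat \<Rightarrow> nat set" where
  "Mv w = M (w div 4 mod W) (w div 4 div W)"

lemma Mv_vid: "X < W \<Longrightarrow> Mv (vid X Y 0) = M X Y"
  by (simp add: Mv_def vid_div)

lemma lmda_iff_net:
  assumes "P > 0" "Q > 0"
  shows "(\<exists>A. A \<subseteq> {..<size} - N \<and> U \<subseteq> A \<and> locally_minimal_defensive_alliance {..<size} E A) \<longleftrightarrow>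
    (\<exists>S\<subseteq>Fr. \<forall>w\<in>C. card (S \<inter> Mv w) = 1)"
  unfolding N_def U_def
\<comment> \<open>The layer is the lowest digit of a vertex number, so the pendant path of
  \<open>w\<close> consists of its two successors.\<close>
proof (rule lmda_net[where z = "\<lambda>w. Suc (Suc w)"])
  have U: "C \<union> Suc ` C \<subseteq> {..<size}" using U_N_bounds by (simp add: U_def)
  then show "C \<subseteq> {..<size}" "Suc ` C \<subseteq> {..<size}" by auto
  have "clause 2 2" using assms by (simp add: clause_def)
  then show "C \<noteq> {}" by (auto simp: C_def)
  have not_clause: "\<not> clause X Y" if "free X Y" for X Y
    using clause_even[of X Y] that by (auto simp: free_def)
  show "Fr \<subseteq> {..<size} - (C \<union> Suc ` C)"
  proof
    fix v assume "v \<in> Fr"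
    then obtain X Y where v: "v = vid X Y 0" "X < W" "Y < H" "free X Y" by (auto simp: Fr_def)
    show "v \<in> {..<size} - (C \<union> Suc ` C)"
      unfolding v(1) using v(2,3) not_clause[OF v(4)] vid_not_mem[of X 0 Y] by (simp add: vid_less)
  qed
  show "C \<inter> Suc ` C = {}"
  proof -
    have "w \<notin> Suc ` C" if "w \<in> C" for w
    proof -
      obtain X Y where w: "w = vid X Y 0" "clause X Y" using \<open>w \<in> C\<close> by (auto simp: C_def)
      show ?thesis unfolding w(1) using vid_mem(2)[of X 0 Y] clause_bounds[OF w(2)] by simp
    qed
    then show ?thesis by blast
  qed
  fix w assume "w \<in> C"
  then obtain X Y where w: "w = vid X Y 0" and cl: "clause X Y" by (auto simp: C_def)
  note b = clause_bounds[OF cl]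
  have w': "Mv w = M X Y" "Suc w = vid X Y 1" "Suc (Suc w) = vid X Y 2" using b by (simp_all only: w Mv_vid vid_Suc)
  show "card (Mv w) \<in> {3, 4}" unfolding w' by (rule card_M[OF cl])
  show "{u \<in> {..<size}. {u, w} \<in> E} = insert (Suc w) (Mv w)"
  proof (rule set_eqI)
    fix u
    have "u \<in> {u \<in> {..<size}. {u, vid X Y 0} \<in> E} \<longleftrightarrow> (\<exists>A B c. u = vid A B c \<and> lnk X Y 0 A B c)"
    proof -
      have "\<not> lnk A B c X Y 0" for A B c using lnk_odd clause_even[OF cl] by blast
      then show ?thesis using neighbors_iff[of X Y 0 u] b by simp
    qed
    then show "u \<in> {u \<in> {..<size}. {u, w} \<in> E} \<longleftrightarrow> u \<in> insert (Suc w) (Mv w)"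
      unfolding w' M_iff[OF cl] unfolding w .
  qed
  show "Mv w \<subseteq> {..<size} - (C \<union> Suc ` C)"
  proof
    fix u assume u: "u \<in> Mv w"
    then obtain A B c where A: "u = vid A B c" "lnk X Y 0 A B c"
      using M_iff[OF cl, of u] unfolding w' by blast
    note b' = lnk_bounds[OF A(2)]
    have "c \<noteq> 1"
    proof
      assume c: "c = 1"
      then have "A = X" "B = Y" using A(2) by (auto simp: lnk_def)
      with c A u b show False
        using clause_right[OF cl] by (auto simp: w' M_def vid_eq split: if_splits)
    qed
    moreover have "c = 0 \<Longrightarrow> \<not> clause A B" using A(2) lnk_odd clause_even by blast
    ultimately show "u \<in> {..<size} - (C \<union> Suc ` C)"
      unfolding A(1) using b' vid_not_mem[of A c B] by (cases "c = 0") (simp_all add: vid_less)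
  qed
  show "{u \<in> {..<size}. {u, Suc w} \<in> E} = {w, Suc (Suc w)}"
    unfolding w'(3) unfolding w'(2) unfolding w using neighbors_iff[of X Y 1] b cl by (auto simp: lnk_def)
  show "Suc (Suc w) \<in> {..<size} - (C \<union> Suc ` C) - Fr"
    unfolding w'(3) using b vid_mem(3)[of X 2 Y] vid_not_mem[of X 2 Y] by (simp add: vid_less)
next
  fix v assume "v \<in> Fr"
  then obtain X Y where v: "v = vid X Y 0" "X < W" "Y < H" "free X Y" by (auto simp: Fr_def)
  show "{u \<in> {..<size}. {u, v} \<in> E} \<subseteq> C"
  proof
    fix u assume "u \<in> {u \<in> {..<size}. {u, v} \<in> E}"
    then obtain A B c where A: "u = vid A B c" "lnk X Y 0 A B c \<or> lnk A B c X Y 0"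
      unfolding v(1) neighbors_iff[OF v(2,3) zero_less_numeral] by blast
    have "\<not> clause X Y" using v(4) clause_even by (auto simp: free_def)
    with A(2) have "clause A B" "c = 0" by (auto simp: lnk_def)
    then show "u \<in> C" unfolding A(1) C_def by blast
  qed
qed simp

end

section \<open>Solutions of the net are exact covers\<close>

context net
begin

text \<open>The pendant vertex of layer \<open>3\<close> is left out, being banned.\<close>

definition tot :: "(nat \<Rightarrow> nat \<Rightarrow> bool) \<Rightarrow> nat \<Rightarrow> nat \<Rightarrow> nat" where
  "tot s X Y = of_bool (rt X Y \<and> s (X + 1) Y) + (of_bool (lf X Y \<and> s (X - 1) Y) +
     (of_bool (up X Y \<and> s X (Y + 1)) + of_bool (dn X Y \<and> s X (Y - 1))))"

lemma card_Fr_Int: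
  assumes "clause X Y" "S \<subseteq> Fr"
  shows "card (S \<inter> Mv (vid X Y 0)) = tot (\<lambda>X Y. vid X Y 0 \<in> S) X Y"
proof -
  note b = clause_bounds[OF assms(1)]
  have "vid X Y 3 \<notin> S" using assms(2) vid_mem(3)[of X 3 Y] b by auto
  then show ?thesis
    using b by (simp add: card_Int_M[OF assms(1)] Mv_vid tot_def)
qed

lemma net_iff_assignment:
  "(\<exists>S\<subseteq>Fr. \<forall>w\<in>C. card (S \<inter> Mv w) = 1) \<longleftrightarrow>
   (\<exists>s. (\<forall>X Y. X < W \<and> Y < H \<and> s X Y \<longrightarrow> free X Y) \<and> (\<forall>X Y. clause X Y \<longrightarrow> tot s X Y = 1))"
proof
  assume "\<exists>S\<subseteq>Fr. \<forall>w\<in>C. card (S \<inter> Mv w) = 1"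
  then obtain S where S: "S \<subseteq> Fr" "\<And>w. w \<in> C \<Longrightarrow> card (S \<inter> Mv w) = 1" by blast
  have "tot (\<lambda>X Y. vid X Y 0 \<in> S) X Y = 1" if "clause X Y" for X Y
    using S(2)[of "vid X Y 0"] that card_Fr_Int[OF that S(1)] by (auto simp: C_def)
  moreover have "free X Y" if "X < W" "vid X Y 0 \<in> S" for X Y
    using that S(1) vid_mem(3)[of X 0 Y] by auto
  ultimately show "\<exists>s. (\<forall>X Y. X < W \<and> Y < H \<and> s X Y \<longrightarrow> free X Y) \<and> (\<forall>X Y. clause X Y \<longrightarrow> tot s X Y = 1)"
    by (intro exI[of _ "\<lambda>X Y. vid X Y 0 \<in> S"]) blast
next
  assume "\<exists>s. (\<forall>X Y. X < W \<and> Y < H \<and> s X Y \<longrightarrow> free X Y) \<and> (\<forall>X Y. clause X Y \<longrightarrow> tot s X Y = 1)"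
  then obtain s where s: "\<And>X Y. X < W \<Longrightarrow> Y < H \<Longrightarrow> s X Y \<Longrightarrow> free X Y"
    and t: "\<And>X Y. clause X Y \<Longrightarrow> tot s X Y = 1" by blast
  define S where "S = {vid X Y 0 | X Y. X < W \<and> Y < H \<and> s X Y}"
  have SF: "S \<subseteq> Fr" using s unfolding S_def Fr_def by blast
  have S: "vid X Y 0 \<in> S \<longleftrightarrow> s X Y" if "X < W" "Y < H" for X Y
    using that by (auto simp: S_def vid_eq)
  have "card (S \<inter> Mv w) = 1" if w: "w \<in> C" for w
  proof -
    obtain X Y where w: "w = vid X Y 0" and cl: "clause X Y" using w by (auto simp: C_def)
    have "tot (\<lambda>X Y. vid X Y 0 \<in> S) X Y = tot s X Y"
    proof -
      note b = clause_bounds[OF cl]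
      have "(rt X Y \<and> vid (X + 1) Y 0 \<in> S) = (rt X Y \<and> s (X + 1) Y)"
        using b clause_right[OF cl] S[of "X + 1" Y] by blast
      moreover have "(lf X Y \<and> vid (X - 1) Y 0 \<in> S) = (lf X Y \<and> s (X - 1) Y)"
        using b S[of "X - 1" Y] less_imp_diff_less[of X W 1] by blast
      moreover have "(up X Y \<and> vid X (Y + 1) 0 \<in> S) = (up X Y \<and> s X (Y + 1))"
        using b clause_up[OF cl] S[of X "Y + 1"] by blast
      moreover have "(dn X Y \<and> vid X (Y - 1) 0 \<in> S) = (dn X Y \<and> s X (Y - 1))"
        using b S[of X "Y - 1"] less_imp_diff_less[of Y H 1] by blast
      ultimately show ?thesis unfolding tot_def by (simp only:)
    qed
    then show ?thesis unfolding w card_Fr_Int[OF cl SF] using t[OF cl] by simp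
  qed
  with SF show "\<exists>S\<subseteq>Fr. \<forall>w\<in>C. card (S \<inter> Mv w) = 1" by blast
qed

lemma dm: "d < 4 \<Longrightarrow> (4 * p + d) div 4 = p" "d < 4 \<Longrightarrow> (4 * p + d) mod 4 = (d :: nat)"
  by simp_all

lemma dm_Suc:
  "Suc (4 * p) mod 4 = 1" "Suc (Suc (4 * p)) mod 4 = 2" "(4 * p + 3) mod 4 = 3" "(4 * p) mod 4 = 0"
  "Suc (4 * p) div 4 = p" "Suc (Suc (4 * p)) div 4 = p" "(4 * p + 3) div 4 = p" "(4 * p) div 4 = (p :: nat)"
  using dm[of 1 p] dm[of 2 p] dm[of 3 p] dm[of 0 p] by simp_all

text \<open>The inner constraints of a block and those on its right and upper border, so that each
  constraint belongs to exactly one block.\<close>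

definition blk :: "(nat \<Rightarrow> nat \<Rightarrow> bool) \<Rightarrow> nat \<Rightarrow> nat \<Rightarrow> bool" where
  "blk s p q \<longleftrightarrow>
     tot s (4 * p + 1) (4 * q + 3) = 1 \<and> tot s (4 * p + 1) (4 * q + 1) = 1 \<and> tot s (4 * p + 3) (4 * q + 1) = 1 \<and>
     tot s (4 * p + 3) (4 * q + 3) = 1 \<and> tot s (4 * p + 2) (4 * q + 2) = 1 \<and>
     tot s (4 * (p + 1)) (4 * q + 2) = 1 \<and> tot s (4 * p + 2) (4 * (q + 1)) = 1"

lemma tot_block:
  "tot s (4 * p + 1) (4 * q + 3) =
    of_bool (s (4 * p) (4 * q + 3)) + of_bool (s (4 * p + 1) (4 * q + 2)) + of_bool (s (4 * p + 2) (4 * q + 3))" (is ?t1)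
  "tot s (4 * p + 1) (4 * q + 1) =
    of_bool (s (4 * p + 1) (4 * q)) + of_bool (s (4 * p + 1) (4 * q + 2)) + of_bool (s (4 * p + 2) (4 * q + 1))" (is ?t2)
  "tot s (4 * p + 3) (4 * q + 1) =
    of_bool (s (4 * p + 2) (4 * q + 1)) + of_bool (s (4 * p + 3) (4 * q + 2)) + of_bool (s (4 * (p + 1)) (4 * q + 1))" (is ?t3)
  "tot s (4 * p + 3) (4 * q + 3) =
    of_bool (s (4 * p + 2) (4 * q + 3)) + of_bool (s (4 * p + 3) (4 * q + 2)) + of_bool (s (4 * p + 3) (4 * (q + 1))) +
      of_bool (inc p q \<and> s (4 * (p + 1)) (4 * q + 3))" (is ?t4)
  "tot s (4 * p + 2) (4 * q + 2) =
    of_bool (s (4 * p + 1) (4 * q + 2)) + of_bool (s (4 * p + 2) (4 * q + 1)) + of_bool (s (4 * p + 3) (4 * q + 2)) +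
      of_bool (s (4 * p + 2) (4 * q + 3))" (is ?t5)
  "tot s (4 * p) (4 * q + 2) = of_bool (s (4 * p) (4 * q + 1)) + of_bool (s (4 * p) (4 * q + 3))" (is ?t6)
  "tot s (4 * p + 2) (4 * q) = of_bool (s (4 * p + 3) (4 * q)) + of_bool (s (4 * p + 1) (4 * q))" (is ?t7)
proof -
  have e: "4 * p + 3 + 1 = 4 * (p + 1)" "4 * p + 3 - 1 = 4 * p + 2" "4 * p + 2 + 1 = 4 * p + 3" "4 * p + 2 - 1 = 4 * p + 1"
    "4 * p + 1 + 1 = 4 * p + 2" "4 * p + 1 - 1 = 4 * p" for p :: nat by simp_all
  have m: "(4 * p + 1) mod 4 = 1" "(4 * p + 2) mod 4 = 2" "(4 * p + 3) mod 4 = 3" "(4 * p) mod 4 = 0"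
    "(4 * p + 3) div 4 = p" for p :: nat
    by (simp_all add: dm_Suc)
  note defs = tot_def rt_def lf_def up_def dn_def m e
  show ?t1 ?t2 ?t3 ?t4 ?t5 ?t6 ?t7 unfolding defs by simp_all
qed

definition pos :: "nat \<Rightarrow> nat \<Rightarrow> nat \<Rightarrow> nat \<Rightarrow> bool" where
  "pos p q X Y \<longleftrightarrow> (X = 4 * p + 1 \<and> Y = 4 * q + 3) \<or> (X = 4 * p + 1 \<and> Y = 4 * q + 1) \<or>
     (X = 4 * p + 3 \<and> Y = 4 * q + 1) \<or> (X = 4 * p + 3 \<and> Y = 4 * q + 3) \<or> (X = 4 * p + 2 \<and> Y = 4 * q + 2) \<or>
     (X = 4 * (p + 1) \<and> Y = 4 * q + 2) \<or> (X = 4 * p + 2 \<and> Y = 4 * (q + 1))"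

lemma clause_iff: "clause X Y \<longleftrightarrow> (\<exists>p<P. \<exists>q<Q. pos p q X Y)"
proof
  assume cl: "clause X Y"
  define p q dx dy where "p = X div 4" and "q = Y div 4" and "dx = X mod 4" and "dy = Y mod 4"
  note defs = this
  have X: "X = 4 * p + dx" and Y: "Y = 4 * q + dy" by (simp_all add: defs)
  from cl consider "p < P" "q < Q" "dx = 1 \<or> dx = 3" "dy = 1 \<or> dy = 3"
    | "p < P" "q < Q" "dx = 2" "dy = 2" | "dx = 0" "dy = 2" "0 < p" "p \<le> P" "q < Q"
    | "dx = 2" "dy = 0" "p < P" "0 < q" "q \<le> Q"
    unfolding clause_def defs[symmetric] by blast
  then show "\<exists>p<P. \<exists>q<Q. pos p q X Y"
  proof cases
    case 1
    then show ?thesis using X Y unfolding pos_def by blast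
  next
    case 2
    then show ?thesis using X Y unfolding pos_def by blast
  next
    case 3
    then have "p - 1 < P" "X = 4 * (p - 1 + 1)" "Y = 4 * q + 2" using X Y by simp_all
    with 3 show ?thesis unfolding pos_def by blast
  next
    case 4
    then have "q - 1 < Q" "X = 4 * p + 2" "Y = 4 * (q - 1 + 1)" using X Y by simp_all
    with 4 show ?thesis unfolding pos_def by blast
  qed
next
  assume "\<exists>p<P. \<exists>q<Q. pos p q X Y"
  then show "clause X Y"
    unfolding pos_def by (elim exE disjE conjE) (simp_all add: clause_def dm_Suc)
qed

lemma assignment_iff_blk: "(\<forall>X Y. clause X Y \<longrightarrow> tot s X Y = 1) \<longleftrightarrow> (\<forall>p<P. \<forall>q<Q. blk s p q)"
proof -
  have "blk s p q \<longleftrightarrow> (\<forall>X Y. pos p q X Y \<longrightarrow> tot s X Y = 1)" for p q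
    unfolding blk_def pos_def by blast
  then show ?thesis unfolding clause_iff by blast
qed

text \<open>Let \<open>r\<close> and \<open>c\<close> be the incoming horizontal and vertical
  signal. The corners \<open>(1, 1)\<close> and \<open>(1, 3)\<close> tie the ring to them. The
  corner \<open>(3, 1)\<close> collects the two combinations containing \<open>r\<close>, and
  \<open>(3, 3)\<close> the two containing \<open>c\<close>, together with the outgoing
  \<open>r\<close> if \<open>inc p q\<close>. The border constraints complement the results.\<close>

lemma blk_step:
  assumes "blk s p q" "inc p q \<Longrightarrow> \<not> s (4 * p + 3) (4 * q + 2)"
  shows "s (4 * (p + 1)) (4 * q + 3) \<longleftrightarrow> s (4 * p) (4 * q + 3)"
    "of_bool (s (4 * p + 1) (4 * (q + 1))) = of_bool (s (4 * p + 1) (4 * q)) + (of_bool (s (4 * p) (4 * q + 3) \<and> inc p q) :: nat)"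
  using assms unfolding blk_def tot_block by (cases "inc p q"; auto split: if_splits simp: of_bool_def)+

lemma net_iff_cover:
  assumes "Q > 0"
  shows "(\<exists>s. (\<forall>X Y. X < W \<and> Y < H \<and> s X Y \<longrightarrow> free X Y) \<and> (\<forall>X Y. clause X Y \<longrightarrow> tot s X Y = 1)) \<longleftrightarrow>
    (\<exists>r. (\<forall>q<Q. r q \<longrightarrow> ok q) \<and> (\<forall>p<P. card {q. q < Q \<and> r q \<and> inc p q} = 1))"
proof
  assume "\<exists>s. (\<forall>X Y. X < W \<and> Y < H \<and> s X Y \<longrightarrow> free X Y) \<and> (\<forall>X Y. clause X Y \<longrightarrow> tot s X Y = 1)"
  then obtain s where fr: "\<And>X Y. X < W \<Longrightarrow> Y < H \<Longrightarrow> s X Y \<Longrightarrow> free X Y"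
    and b: "\<And>p q. p < P \<Longrightarrow> q < Q \<Longrightarrow> blk s p q"
    unfolding assignment_iff_blk by blast
  have xr: "\<not> s (4 * p + 3) (4 * q + 2)" if "p < P" "q < Q" "inc p q" for p q
    using fr[of "4 * p + 3" "4 * q + 2"] that by (auto simp: free_def W_def H_def dm_Suc)
  note step = blk_step[OF b xr]
  have r: "s (4 * p) (4 * q + 3) \<longleftrightarrow> s 0 (4 * q + 3)" if "p \<le> P" "q < Q" for p q
    using that by (induction p) (use step(1) in auto)
  \<comment> \<open>A truth value equals a count here, so no element is ever covered twice.\<close>
  have c: "of_bool (s (4 * p + 1) (4 * q)) = card {q'. q' < q \<and> s 0 (4 * q' + 3) \<and> inc p q'}"
    if "p < P" "q \<le> Q" for p q
    using that(2)
  proof (induction q)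
    case 0
    have "\<not> s (4 * p + 1) 0" using fr[of "4 * p + 1" 0] that by (auto simp: free_def W_def H_def dm_Suc)
    then show ?case by simp
  next
    case (Suc q)
    have "{q'. q' < Suc q \<and> s 0 (4 * q' + 3) \<and> inc p q'} = {q'. q' < q \<and> s 0 (4 * q' + 3) \<and> inc p q'} \<union>
        (if s 0 (4 * q + 3) \<and> inc p q then {q} else {})" by (auto simp: less_Suc_eq)
    then have "card {q'. q' < Suc q \<and> s 0 (4 * q' + 3) \<and> inc p q'} =
        card {q'. q' < q \<and> s 0 (4 * q' + 3) \<and> inc p q'} + of_bool (s 0 (4 * q + 3) \<and> inc p q)" by simp
    then show ?case using Suc step(2)[of p q] r[of p q] that(1) by simp
  qed
  have "card {q. q < Q \<and> s 0 (4 * q + 3) \<and> inc p q} = 1" if p: "p < P" for p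
  proof -
    obtain q where q: "Q = q + 1" using assms by (metis Suc_eq_plus1 gr0_implies_Suc)
    \<comment> \<open>The complement is banned on the upper border, so the column signal must be
      present there.\<close>
    have "\<not> s (4 * p + 3) (4 * Q)" using fr[of "4 * p + 3" "4 * Q"] p by (auto simp: free_def W_def H_def dm_Suc)
    moreover have "of_bool (s (4 * p + 3) (4 * Q)) + of_bool (s (4 * p + 1) (4 * Q)) = (1 :: nat)"
      using b[of p q] p unfolding q blk_def tot_block by simp
    ultimately have "s (4 * p + 1) (4 * Q)" by (cases "s (4 * p + 1) (4 * Q)") simp_all
    then show ?thesis using c[OF p, of Q] by simp
  qed
  moreover have "ok q" if "q < Q" "s 0 (4 * q + 3)" for q
    using fr[of 0 "4 * q + 3"] that by (auto simp: free_def W_def H_def dm_Suc)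
  ultimately show "\<exists>r. (\<forall>q<Q. r q \<longrightarrow> ok q) \<and> (\<forall>p<P. card {q. q < Q \<and> r q \<and> inc p q} = 1)"
    by (intro exI[of _ "\<lambda>q. s 0 (4 * q + 3)"]) blast
next
  assume "\<exists>r. (\<forall>q<Q. r q \<longrightarrow> ok q) \<and> (\<forall>p<P. card {q. q < Q \<and> r q \<and> inc p q} = 1)"
  then obtain r where ok: "\<And>q. q < Q \<Longrightarrow> r q \<Longrightarrow> ok q"
    and card: "\<And>p. p < P \<Longrightarrow> card {q. q < Q \<and> r q \<and> inc p q} = 1" by blast
  \<comment> \<open>The signal of column \<open>p\<close> on entering row \<open>q\<close>.\<close>
  define c where "c p q \<longleftrightarrow> (\<exists>q'<q. r q' \<and> inc p q')" for p q
  have uniq: "q = q'" if "p < P" "q < Q" "r q" "inc p q" "q' < Q" "r q'" "inc p q'" for p q q'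
  proof -
    from card[OF that(1)] obtain a where "{q. q < Q \<and> r q \<and> inc p q} = {a}" by (rule card_1_singletonE)
    moreover have "q \<in> {q. q < Q \<and> r q \<and> inc p q}" "q' \<in> {q. q < Q \<and> r q \<and> inc p q}" using that by simp_all
    ultimately show ?thesis by simp
  qed
  have c_inc: "\<not> c p q" if "p < P" "q < Q" "r q" "inc p q" for p q
  proof
    assume "c p q"
    then obtain q' where q': "q' < q" "r q'" "inc p q'" unfolding c_def by blast
    then have "q = q'" using uniq[OF that, of q'] that(2) by simp
    with q'(1) show False by simp
  qed
  have c_Suc: "c p (q + 1) \<longleftrightarrow> c p q \<or> r q \<and> inc p q" for p q
    unfolding c_def by (auto simp: less_Suc_eq)
  have c_Q: "c p Q" if "p < P" for p
  proof -
    have "{q. q < Q \<and> r q \<and> inc p q} \<noteq> {}" using card[OF that] by force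
    then show ?thesis unfolding c_def by blast
  qed
  \<comment> \<open>The last group is the ring: each of its variables stands for one combination of
    \<open>r q\<close> and \<open>c p q\<close>.\<close>
  define s where "s X Y = (let p = X div 4; q = Y div 4; dx = X mod 4; dy = Y mod 4 in
     p \<le> P \<and> q \<le> Q \<and> (
      dx = 0 \<and> dy = 3 \<and> q < Q \<and> r q \<or> dx = 0 \<and> dy = 1 \<and> q < Q \<and> \<not> r q \<or>
      dx = 1 \<and> dy = 0 \<and> p < P \<and> c p q \<or> dx = 3 \<and> dy = 0 \<and> p < P \<and> \<not> c p q \<or>
      p < P \<and> q < Q \<and> (dx = 1 \<and> dy = 2 \<and> \<not> r q \<and> \<not> c p q \<or> dx = 2 \<and> dy = 1 \<and> r q \<and> \<not> c p q \<or>
        dx = 3 \<and> dy = 2 \<and> r q \<and> c p q \<or> dx = 2 \<and> dy = 3 \<and> \<not> r q \<and> c p q)))" for X Y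
  have s: "q < Q \<Longrightarrow> p \<le> P \<Longrightarrow> s (4 * p) (4 * q + 3) \<longleftrightarrow> r q" "q < Q \<Longrightarrow> p \<le> P \<Longrightarrow> s (4 * p) (4 * q + 1) \<longleftrightarrow> \<not> r q"
    "p < P \<Longrightarrow> q \<le> Q \<Longrightarrow> s (4 * p + 1) (4 * q) \<longleftrightarrow> c p q" "p < P \<Longrightarrow> q \<le> Q \<Longrightarrow> s (4 * p + 3) (4 * q) \<longleftrightarrow> \<not> c p q"
    "p < P \<Longrightarrow> q < Q \<Longrightarrow> s (4 * p + 1) (4 * q + 2) \<longleftrightarrow> \<not> r q \<and> \<not> c p q"
    "p < P \<Longrightarrow> q < Q \<Longrightarrow> s (4 * p + 2) (4 * q + 1) \<longleftrightarrow> r q \<and> \<not> c p q"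
    "p < P \<Longrightarrow> q < Q \<Longrightarrow> s (4 * p + 3) (4 * q + 2) \<longleftrightarrow> r q \<and> c p q"
    "p < P \<Longrightarrow> q < Q \<Longrightarrow> s (4 * p + 2) (4 * q + 3) \<longleftrightarrow> \<not> r q \<and> c p q" for p q
    by (simp_all add: s_def dm_Suc)
  have "blk s p q" if "p < P" "q < Q" for p q
  proof -
    have le: "p \<le> P" "p + 1 \<le> P" "q \<le> Q" "q + 1 \<le> Q" using that by simp_all
    show ?thesis
      unfolding blk_def tot_block s(1)[OF that(2) le(1)] s(1,2)[OF that(2) le(2)] s(3)[OF that(1) le(3)]
        s(3,4)[OF that(1) le(4)] s(5-8)[OF that] c_Suc
      using c_inc[OF that] by auto
  qed
  moreover have "free X Y" if "s X Y" for X Y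
  proof -
    have "odd (X + Y)"
      unfolding even_add even_even_mod_4_iff[of X] even_even_mod_4_iff[of Y] using that by (auto simp: s_def Let_def)
    moreover have "ok (Y div 4)" if "X = 0" "Y mod 4 = 3"
      using \<open>s X Y\<close> that ok by (auto simp: s_def Let_def)
    moreover have "\<not> (Y = 0 \<and> X mod 4 = 1)"
      using \<open>s X Y\<close> by (auto simp: s_def Let_def c_def)
    moreover have "\<not> (Y = 4 * Q \<and> X mod 4 = 3)"
      using \<open>s X Y\<close> c_Q by (auto simp: s_def Let_def)
    moreover have "\<not> (X mod 4 = 3 \<and> Y mod 4 = 2 \<and> inc (X div 4) (Y div 4))"
      using \<open>s X Y\<close> c_inc by (auto simp: s_def Let_def)
    ultimately show ?thesis unfolding free_def by blast
  qed
  ultimately show "\<exists>s. (\<forall>X Y. X < W \<and> Y < H \<and> s X Y \<longrightarrow> free X Y) \<and> (\<forall>X Y. clause X Y \<longrightarrow> tot s X Y = 1)"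
    unfolding assignment_iff_blk by blast
qed

end

section \<open>Bipartiteness, degree and a straight-line drawing\<close>

context net
begin

lemma E_cases:
  assumes "e \<in> E"
  obtains X Y k X' Y' k' where "lnk X Y k X' Y' k'" "e = {vid X Y k, vid X' Y' k'}"
  using assms unfolding E_def by blast

text \<open>The parity of \<open>X + Y + k\<close> is a proper coloring: an edge changes one
  coordinate by one, or the layer from \<open>0\<close> to \<open>3\<close>.\<close>

lemma bipartite_E: "bipartite {..<size} E"
proof -
  define col where "col v \<longleftrightarrow> even (v div 4 mod W + v div 4 div W + v mod 4)" for v
  have col: "col (vid X Y k) \<longleftrightarrow> even (X + Y + k)" if "X < W" "k < 4" for X Y k
    using that by (simp add: col_def vid_div vid_mod)
  have "\<exists>x\<in>{v \<in> {..<size}. col v}. \<exists>y\<in>{v \<in> {..<size}. \<not> col v}. e = {x, y}" if "e \<in> E" for e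
  proof -
    from that obtain X Y k X' Y' k' where l: "lnk X Y k X' Y' k'" and e: "e = {vid X Y k, vid X' Y' k'}"
      by (rule E_cases)
    note b = lnk_bounds[OF l]
    have "even (X + Y + k) \<noteq> even (X' + Y' + k')"
      using l clause_even[of X Y] by (auto simp: lnk_def)
    then have "col (vid X Y k) \<noteq> col (vid X' Y' k')" using b by (simp add: col)
    moreover have "vid X Y k < size" "vid X' Y' k' < size" using b by (simp_all add: vid_less)
    ultimately show ?thesis unfolding e by (cases "col (vid X Y k)") (auto simp: doubleton_eq_iff)
  qed
  then show ?thesis
    unfolding bipartite_def
    by (intro exI[of _ "{v \<in> {..<size}. col v}"] exI[of _ "{v \<in> {..<size}. \<not> col v}"]) auto
qed

text \<open>Four lattice neighbors and the four layers at the same point are all candidates for a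
  neighbor, eight in total.\<close>

lemma max_degree_E: "max_degree_at_most 9 {..<size} E"
  unfolding max_degree_at_most_def
proof
  fix v assume "v \<in> {..<size}"
  then have "v < size" by simp
  then obtain X Y k where v: "v = vid X Y k" and b: "X < W" "Y < H" "k < 4" by (rule vid_cases)
  let ?l = "[vid (X + 1) Y 0, vid (X - 1) Y 0, vid X (Y + 1) 0, vid X (Y - 1) 0,
    vid X Y 0, vid X Y 1, vid X Y 2, vid X Y 3]"
  have "{u \<in> {..<size}. {u, v} \<in> E} \<subseteq> set ?l"
  proof
    fix u assume "u \<in> {u \<in> {..<size}. {u, v} \<in> E}"
    then obtain A B c where u: "u = vid A B c" and l: "lnk X Y k A B c \<or> lnk A B c X Y k"
      unfolding v neighbors_iff[OF b] by blast
    from l have "(A = X + 1 \<and> B = Y \<or> A = X - 1 \<and> B = Y \<or> A = X \<and> B = Y + 1 \<or> A = X \<and> B = Y - 1) \<and> c = 0 \<or>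
        A = X \<and> B = Y \<and> c \<le> 3"
      by (auto simp: lnk_def)
    moreover have "c \<le> 3 \<longleftrightarrow> c = 0 \<or> c = 1 \<or> c = 2 \<or> c = 3" by auto
    ultimately show "u \<in> set ?l" unfolding u by auto
  qed
  then have "card {u \<in> {..<size}. {u, v} \<in> E} \<le> card (set ?l)" by (intro card_mono) auto
  also have "\<dots> \<le> length ?l" by (rule card_length)
  finally show "deg_in E {..<size} v \<le> 9" by (simp add: deg_in_def)
qed

text \<open>Pendant paths leave a constraint diagonally to the upper right, layer \<open>3\<close>
  vertices to the lower right, clear of the lattice lines.\<close>

definition ox :: "nat \<Rightarrow> real" where
  "ox k = (if k = 0 then 0 else if k = 1 then 1 / 8 else 1 / 4)"

definition oy :: "nat \<Rightarrow> real" where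
  "oy k = (if k = 0 then 0 else if k = 1 then 1 / 8 else if k = 2 then 1 / 4 else - 1 / 4)"

definition pt :: "nat \<Rightarrow> complex" where
  "pt v = Complex (real (v div 4 mod W) + ox (v mod 4)) (real (v div 4 div W) + oy (v mod 4))"

lemma pt_vid: "X < W \<Longrightarrow> k < 4 \<Longrightarrow> pt (vid X Y k) = Complex (real X + ox k) (real Y + oy k)"
  by (simp add: pt_def vid_div vid_mod)

text \<open>The seven kinds of edges as segments, in coordinates relative to the constraint that
  owns them.\<close>

definition region :: "nat \<Rightarrow> nat \<Rightarrow> nat \<Rightarrow> nat \<Rightarrow> nat \<Rightarrow> nat \<Rightarrow> real \<Rightarrow> real \<Rightarrow> bool" where
  "region X Y k X' Y' k' u v \<longleftrightarrow>
     k = 0 \<and> k' = 0 \<and> X' = X + 1 \<and> Y' = Y \<and> v = 0 \<and> 0 \<le> u \<and> u \<le> 1 \<or>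
     k = 0 \<and> k' = 0 \<and> X' + 1 = X \<and> Y' = Y \<and> v = 0 \<and> - 1 \<le> u \<and> u \<le> 0 \<or>
     k = 0 \<and> k' = 0 \<and> X' = X \<and> Y' = Y + 1 \<and> u = 0 \<and> 0 \<le> v \<and> v \<le> 1 \<or>
     k = 0 \<and> k' = 0 \<and> X' = X \<and> Y' + 1 = Y \<and> u = 0 \<and> - 1 \<le> v \<and> v \<le> 0 \<or>
     k = 0 \<and> k' = 1 \<and> X' = X \<and> Y' = Y \<and> v = u \<and> 0 \<le> u \<and> u \<le> 1 / 8 \<or>
     k = 0 \<and> k' = 3 \<and> X' = X \<and> Y' = Y \<and> v = - u \<and> 0 \<le> u \<and> u \<le> 1 / 4 \<or>
     k = 1 \<and> k' = 2 \<and> X' = X \<and> Y' = Y \<and> v = u \<and> 1 / 8 \<le> u \<and> u \<le> 1 / 4"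

lemma segment_region:
  assumes "lnk X Y k X' Y' k'" "p \<in> closed_segment (pt (vid X Y k)) (pt (vid X' Y' k'))"
  shows "region X Y k X' Y' k' (Re p - real X) (Im p - real Y)"
proof -
  note b = lnk_bounds[OF assms(1)]
  obtain t where t: "0 \<le> t" "t \<le> 1"
    and p: "p = (1 - t) *\<^sub>R pt (vid X Y k) + t *\<^sub>R pt (vid X' Y' k')"
    using assms(2) by (auto simp: in_segment)
  have re: "Re p - real X = ox k + t * (real X' - real X + ox k' - ox k)"
    and im: "Im p - real Y = oy k + t * (real Y' - real Y + oy k' - oy k)"
    unfolding p using b by (simp_all add: pt_vid algebra_simps)
  from assms(1) consider "k = 0" "k' = 0" "X' = X + 1" "Y' = Y" | "k = 0" "k' = 0" "X = X' + 1" "Y' = Y"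
    | "k = 0" "k' = 0" "X' = X" "Y' = Y + 1" | "k = 0" "k' = 0" "X' = X" "Y = Y' + 1"
    | "k = 0" "k' = 1" "X' = X" "Y' = Y" | "k = 0" "k' = 3" "X' = X" "Y' = Y" | "k = 1" "k' = 2" "X' = X" "Y' = Y"
    unfolding lnk_def by (metis (no_types))
  then show ?thesis
    unfolding re im region_def using t by cases (simp_all add: ox_def oy_def)
qed

text \<open>In the taxicab norm, an edge stays in the closed unit ball around its constraint and
  reaches the boundary only at a lattice variable. Crossings between edges of different constraints
  thereby reduce to distances.\<close>

lemma region_bound:
  assumes "region X Y k X' Y' k' u v"
  shows "\<bar>u\<bar> + \<bar>v\<bar> \<le> 1" "\<bar>u\<bar> + \<bar>v\<bar> = 1 \<Longrightarrow> k' = 0 \<and> real X + u = real X' \<and> real Y + v = real Y'"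
  using assms unfolding region_def by auto

text \<open>Offsets are at most \<open>1 / 4\<close> in size and cannot make up for an integral
  displacement. The four claims belong to vertical lines, horizontal lines, and the rising and the
  falling diagonal.\<close>

lemma offset_zero:
  fixes a b :: real
  assumes "a = 0 \<or> a = 1 \<or> a = - 1" "b = 0 \<or> b = 1 \<or> b = - 1" "c = 0 \<or> c = 1 \<or> c = 2 \<or> c = (3 :: nat)"
  shows "a + ox c = 0 \<Longrightarrow> c = 0 \<and> a = 0" "b + oy c = 0 \<Longrightarrow> c = 0 \<and> b = 0"
    "b + oy c = a + ox c \<Longrightarrow> 0 \<le> a + ox c \<Longrightarrow> a + ox c \<le> 1 / 4 \<Longrightarrow> a = 0 \<and> b = 0 \<and> c \<noteq> 3"
    "b + oy c = - (a + ox c) \<Longrightarrow> 0 \<le> a + ox c \<Longrightarrow> a + ox c \<le> 1 / 4 \<Longrightarrow> a = 0 \<and> b = 0 \<and> c \<noteq> 1 \<and> c \<noteq> 2"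
  subgoal using assms(1,3) by (elim disjE) (simp_all add: ox_def)
  subgoal using assms(2,3) by (elim disjE) (simp_all add: oy_def)
  subgoal using assms by (elim disjE) (simp_all add: ox_def oy_def)
  subgoal using assms by (elim disjE) (simp_all add: ox_def oy_def)
  done

lemma region_vertex:
  assumes "region X Y k X' Y' k' (real A + ox c - real X) (real B + oy c - real Y)" "c < 4"
  shows "A = X \<and> B = Y \<and> c = k \<or> A = X' \<and> B = Y' \<and> c = k'"
proof -
  define a b where "a = real A - real X" and "b = real B - real Y"
  have "0 \<le> ox c" "ox c \<le> 1 / 4" "- 1 / 4 \<le> oy c" "oy c \<le> 1 / 4" by (simp_all add: ox_def oy_def)
  moreover have "\<bar>real A + ox c - real X\<bar> \<le> 1" "\<bar>real B + oy c - real Y\<bar> \<le> 1"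
    using region_bound(1)[OF assms(1)] by linarith+
  ultimately have "real A < real (X + 2)" "real X < real (A + 2)" "real B < real (Y + 2)" "real Y < real (B + 2)"
    by (simp_all add: abs_le_iff)
  then have AX: "A = X \<or> A = X + 1 \<or> X = A + 1" and BY: "B = Y \<or> B = Y + 1 \<or> Y = B + 1"
    unfolding of_nat_less_iff by linarith+
  then have ab: "a = 0 \<or> a = 1 \<or> a = - 1" "b = 0 \<or> b = 1 \<or> b = - 1"
    by (auto simp: a_def b_def)
  have c: "c = 0 \<or> c = 1 \<or> c = 2 \<or> c = 3" using assms(2) by linarith
  have nat: "a = 0 \<longleftrightarrow> A = X" "b = 0 \<longleftrightarrow> B = Y" "a = 1 \<longleftrightarrow> A = X + 1" "a = - 1 \<longleftrightarrow> A + 1 = X"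
    "b = 1 \<longleftrightarrow> B = Y + 1" "b = - 1 \<longleftrightarrow> B + 1 = Y"
    using AX BY by (auto simp: a_def b_def)
  note off = offset_zero[OF ab c]
  have r: "region X Y k X' Y' k' (a + ox c) (b + oy c)"
    using assms(1) by (simp add: a_def b_def algebra_simps)
  have o0: "ox 0 = 0" "oy 0 = 0" "ox 1 = 1 / 8" "ox 2 = 1 / 4" "ox 3 = 1 / 4" by (simp_all add: ox_def oy_def)
  from r consider
      "k = 0" "k' = 0" "X' = X + 1" "Y' = Y" "b + oy c = 0" "0 \<le> a + ox c"
    | "k = 0" "k' = 0" "X' + 1 = X" "Y' = Y" "b + oy c = 0" "a + ox c \<le> 0"
    | "k = 0" "k' = 0" "X' = X" "Y' = Y + 1" "a + ox c = 0" "0 \<le> b + oy c"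
    | "k = 0" "k' = 0" "X' = X" "Y' + 1 = Y" "a + ox c = 0" "b + oy c \<le> 0"
    | "k = 0" "k' = 1" "X' = X" "Y' = Y" "b + oy c = a + ox c" "0 \<le> a + ox c" "a + ox c \<le> 1 / 8"
    | "k = 0" "k' = 3" "X' = X" "Y' = Y" "b + oy c = - (a + ox c)" "0 \<le> a + ox c" "a + ox c \<le> 1 / 4"
    | "k = 1" "k' = 2" "X' = X" "Y' = Y" "b + oy c = a + ox c" "1 / 8 \<le> a + ox c" "a + ox c \<le> 1 / 4"
    unfolding region_def by (elim disjE conjE) metis+
  then show ?thesis
  proof cases
    case 1
    then show ?thesis using off(2) ab(1) nat o0 by auto
  next
    case 2
    then show ?thesis using off(2) ab(1) nat o0 by auto
  next
    case 3
    then show ?thesis using off(1) ab(2) nat o0 by auto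
  next
    case 4
    then show ?thesis using off(1) ab(2) nat o0 by auto
  next
    case 5
    then have "a = 0 \<and> b = 0 \<and> c \<noteq> 3" by (intro off(3)) auto
    then show ?thesis using 5 c nat o0 by auto
  next
    case 6
    then have "a = 0 \<and> b = 0 \<and> c \<noteq> 1 \<and> c \<noteq> 2" by (intro off(4)) auto
    then show ?thesis using 6 c nat by auto
  next
    case 7
    then have "a = 0 \<and> b = 0 \<and> c \<noteq> 3" by (intro off(3)) auto
    then show ?thesis using 7 c nat o0 by auto
  qed
qed

text \<open>Edges leave their constraint in six directions. Apart from the center, only the two
  consecutive edges of the pendant path share a point.\<close>

lemma region_meet:
  assumes "region X Y k A B c u v" "region X Y k' A' B' c' u v" "(A, B, c) \<noteq> (A', B', c')"
  shows "u = 0 \<and> v = 0 \<and> k = 0 \<and> k' = 0 \<or>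
    u = 1 / 8 \<and> v = 1 / 8 \<and> (k = 0 \<and> c = 1 \<and> k' = 1 \<or> k = 1 \<and> k' = 0 \<and> c' = 1)"
  using assms unfolding region_def by (elim disjE conjE) simp_all

lemma inj_pt: "inj_on pt {..<size}"
proof (rule inj_onI)
  fix v v' assume v: "v \<in> {..<size}" "v' \<in> {..<size}" and eq: "pt v = pt v'"
  obtain X Y k where v1: "v = vid X Y k" "X < W" "Y < H" "k < 4" using v(1) vid_cases[of v] by auto
  obtain A B c where v2: "v' = vid A B c" "A < W" "B < H" "c < 4" using v(2) vid_cases[of v'] by auto
  have e: "real X + ox k = real A + ox c" "real Y + oy k = real B + oy c"
    using eq v1 v2 by (simp_all add: pt_vid)
  have o: "0 \<le> ox k" "ox k \<le> 1 / 4" "- 1 / 4 \<le> oy k" "oy k \<le> 1 / 4" for k by (simp_all add: ox_def oy_def)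
  have "real X < real (A + 1)" "real A < real (X + 1)" using e(1) o[of k] o[of c] by simp_all
  then have "X = A" unfolding of_nat_less_iff by simp
  moreover have "real Y < real (B + 1)" "real B < real (Y + 1)" using e(2) o[of k] o[of c] by simp_all
  then have "Y = B" unfolding of_nat_less_iff by simp
  ultimately have "ox k = ox c" "oy k = oy c" using e by simp_all
  moreover have "k = 0 \<or> k = 1 \<or> k = 2 \<or> k = 3" "c = 0 \<or> c = 1 \<or> c = 2 \<or> c = 3"
    using v1(4) v2(4) by linarith+
  ultimately have "k = c" by (elim disjE) (simp_all add: ox_def oy_def)
  with \<open>X = A\<close> \<open>Y = B\<close> show "v = v'" by (simp add: v1 v2)
qed

text \<open>Even coordinate sums put different constraints at taxicab distance at least
  \<open>2\<close>; by the triangle inequality, their unit balls share boundary points only.\<close>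

lemma different_centers:
  fixes px py :: real
  assumes "even (X + Y)" "even (A + B)" "(X, Y) \<noteq> (A, B)"
    and "\<bar>px - real X\<bar> + \<bar>py - real Y\<bar> \<le> 1" "\<bar>px - real A\<bar> + \<bar>py - real B\<bar> \<le> 1"
  shows "\<bar>px - real X\<bar> + \<bar>py - real Y\<bar> = 1" "\<bar>px - real A\<bar> + \<bar>py - real B\<bar> = 1"
proof -
  define m n where "m = int X - int A" and "n = int Y - int B"
  have "even (m + n)" using assms(1,2) by (simp add: m_def n_def)
  have "\<bar>m\<bar> + \<bar>n\<bar> \<ge> 2"
  proof (rule ccontr)
    assume "\<not> 2 \<le> \<bar>m\<bar> + \<bar>n\<bar>"
    then have "m + n = 0 \<or> m + n = 1 \<or> m + n = - 1" "\<bar>m\<bar> + \<bar>n\<bar> < 2" by linarith+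
    moreover have "m + n \<noteq> 1" "m + n \<noteq> - 1" using \<open>even (m + n)\<close> by (metis odd_one, metis even_minus odd_one)
    ultimately have "m + n = 0" "\<bar>m\<bar> + \<bar>n\<bar> < 2" by simp_all
    then have "m = 0" "n = 0" by linarith+
    then show False using assms(3) by (simp add: m_def n_def)
  qed
  then have "real_of_int (\<bar>m\<bar> + \<bar>n\<bar>) \<ge> 2" by linarith
  then have "\<bar>real X - real A\<bar> + \<bar>real Y - real B\<bar> \<ge> 2" by (simp add: m_def n_def)
  then show "\<bar>px - real X\<bar> + \<bar>py - real Y\<bar> = 1" "\<bar>px - real A\<bar> + \<bar>py - real B\<bar> = 1"
    using assms(4,5) by linarith+
qed

lemma planar_E: "planar {..<size} E"
proof -
  \<comment> \<open>An edge is a set without direction; minimum and maximum pick its two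
    ends.\<close>
  define crv where "crv e = linepath (pt (Min e)) (pt (Max e))" for e
  have img: "path_image (crv {a, b}) = closed_segment (pt a) (pt b)"
    and ends: "{pathstart (crv {a, b}), pathfinish (crv {a, b})} = pt ` {a, b}" for a b :: nat
    by (cases "a \<le> b"; auto simp: crv_def min_def max_def closed_segment_commute)+
  have arc: "arc (crv {a, b})" if "pt a \<noteq> pt b" for a b
    using that by (cases "a \<le> b") (auto simp: crv_def min_def max_def intro!: arc_linepath)
  have "plane_drawing {..<size} E pt crv"
    unfolding plane_drawing_def
  proof (intro conjI ballI impI inj_pt)
    fix e assume "e \<in> E"
    then obtain X Y k X' Y' k' where l: "lnk X Y k X' Y' k'" and e: "e = {vid X Y k, vid X' Y' k'}"
      by (rule E_cases)
    note b = lnk_bounds[OF l]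
    have V: "vid X Y k \<in> {..<size}" "vid X' Y' k' \<in> {..<size}" using b by (simp_all add: vid_less)
    have "vid X Y k \<noteq> vid X' Y' k'" using l b by (auto simp: vid_eq lnk_def)
    then have ne: "pt (vid X Y k) \<noteq> pt (vid X' Y' k')" using inj_pt V by (auto dest: inj_onD)
    show "arc (crv e)" unfolding e using ne by (rule arc)
    show "{pathstart (crv e), pathfinish (crv e)} = pt ` e" unfolding e by (rule ends)
    show "path_image (crv e) \<inter> pt ` {..<size} = pt ` e"
    proof
      show "pt ` e \<subseteq> path_image (crv e) \<inter> pt ` {..<size}"
        using V unfolding e img by auto
      show "path_image (crv e) \<inter> pt ` {..<size} \<subseteq> pt ` e"
      proof
        fix p assume "p \<in> path_image (crv e) \<inter> pt ` {..<size}"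
        then obtain v where p: "p = pt v" "v < size" and seg: "p \<in> closed_segment (pt (vid X Y k)) (pt (vid X' Y' k'))"
          unfolding e img by auto
        obtain A B c where v: "v = vid A B c" "A < W" "B < H" "c < 4" using p(2) by (rule vid_cases)
        have "region X Y k X' Y' k' (real A + ox c - real X) (real B + oy c - real Y)"
          using segment_region[OF l seg] v by (simp add: p pt_vid)
        then have "A = X \<and> B = Y \<and> c = k \<or> A = X' \<and> B = Y' \<and> c = k'"
          using v(4) by (rule region_vertex)
        then show "p \<in> pt ` e" by (auto simp: e p v)
      qed
    qed
  next
    fix e e' assume "e \<in> E" "e' \<in> E" "e \<noteq> e'"
    from \<open>e \<in> E\<close> obtain X Y k A B c where l: "lnk X Y k A B c" and e: "e = {vid X Y k, vid A B c}"
      by (rule E_cases)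
    from \<open>e' \<in> E\<close> obtain X' Y' k' A' B' c' where l': "lnk X' Y' k' A' B' c'" and e': "e' = {vid X' Y' k', vid A' B' c'}"
      by (rule E_cases)
    note b = lnk_bounds[OF l] and b' = lnk_bounds[OF l']
    show "path_image (crv e) \<inter> path_image (crv e') \<subseteq> pt ` (e \<inter> e')"
    proof
      fix p assume p: "p \<in> path_image (crv e) \<inter> path_image (crv e')"
      have r: "region X Y k A B c (Re p - real X) (Im p - real Y)"
        using p segment_region[OF l] unfolding e img by blast
      have r': "region X' Y' k' A' B' c' (Re p - real X') (Im p - real Y')"
        using p segment_region[OF l'] unfolding e' img by blast
      show "p \<in> pt ` (e \<inter> e')"
      proof (cases "(X, Y) = (X', Y')")
        case True
        have "(A, B, c) \<noteq> (A', B', c')"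
        proof
          assume *: "(A, B, c) = (A', B', c')"
          then have "k = k'" using l l' by (auto simp: lnk_def)
          with * True have "e = e'" by (simp add: e e')
          with \<open>e \<noteq> e'\<close> show False ..
        qed
        from region_meet[OF r _ this] r' True
        consider "Re p = X" "Im p = Y" "k = 0" "k' = 0"
          | "Re p = X + 1 / 8" "Im p = Y + 1 / 8" "k = 0" "c = 1" "k' = 1"
          | "Re p = X + 1 / 8" "Im p = Y + 1 / 8" "k = 1" "k' = 0" "c' = 1" by fastforce
        then show ?thesis
        proof cases
          case 1
          then have "p = pt (vid X Y 0)" using b by (simp add: pt_vid complex_eq_iff ox_def oy_def)
          with 1 True show ?thesis by (simp add: e e')
        next
          case 2
          then have "p = pt (vid X Y 1)" using b by (simp add: pt_vid complex_eq_iff ox_def oy_def)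
          moreover have "A = X" "B = Y" using l 2 by (auto simp: lnk_def)
          ultimately show ?thesis using 2 True by (simp add: e e')
        next
          case 3
          then have "p = pt (vid X Y 1)" using b by (simp add: pt_vid complex_eq_iff ox_def oy_def)
          moreover have "A' = X" "B' = Y" using l' 3 True by (auto simp: lnk_def)
          ultimately show ?thesis using 3 True by (simp add: e e')
        qed
      next
        case False
        have ev: "even (X + Y)" "even (X' + Y')" using l l' clause_even by (auto simp: lnk_def)
        note one = different_centers[OF ev False region_bound(1)[OF r] region_bound(1)[OF r']]
        have 1: "c = 0" "Re p = A" "Im p = B" using region_bound(2)[OF r one(1)] by simp_all
        have 2: "c' = 0" "Re p = A'" "Im p = B'" using region_bound(2)[OF r' one(2)] by simp_all
        have "p = pt (vid A B 0)" using b 1 by (simp add: pt_vid complex_eq_iff ox_def oy_def)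
        moreover have "A' = A" "B' = B" using 1 2 by simp_all
        ultimately show ?thesis using 1 2 by (simp add: e e')
      qed
    qed
  qed
  then show ?thesis unfolding planar_def by blast
qed

end

section \<open>Tilings as exact covers\<close>

text \<open>
  The elements belonging to site \<open>b\<close> are \<open>b\<close> itself (\<open>\<kappa> = 0\<close>) and the colors of its right and of
  its upper edge. A tile at \<open>b\<close> covers all colors but its own, the neighboring tile covers just
  its own one, so that both together cover each color once iff they agree.
\<close>

definition cov :: "nat \<Rightarrow> nat \<Rightarrow> nat \<Rightarrow> (nat \<Rightarrow> nat) \<Rightarrow> (nat \<Rightarrow> nat) \<Rightarrow> (nat \<Rightarrow> nat) \<Rightarrow> (nat \<Rightarrow> nat) \<Rightarrow>
    nat \<Rightarrow> nat \<Rightarrow> nat \<Rightarrow> nat \<Rightarrow> bool" where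
  "cov h w k hR hL vU vD b \<kappa> a \<tau> \<longleftrightarrow>
     \<kappa> = 0 \<and> a = b \<or>
     0 < \<kappa> \<and> \<kappa> \<le> k \<and> (a = b \<and> (hR \<tau> + 1 \<noteq> \<kappa> \<or> b mod w + 1 = w) \<or>
                       a = b + 1 \<and> b mod w + 1 \<noteq> w \<and> hL \<tau> + 1 = \<kappa>) \<or>
     k < \<kappa> \<and> (a = b \<and> (vU \<tau> + k + 1 \<noteq> \<kappa> \<or> b div w + 1 = h) \<or> a = b + w \<and> vD \<tau> + k + 1 = \<kappa>)"

text \<open>Rows and columns are flattened for the net: set \<open>q\<close> is tile
  \<open>q mod C\<close> at site \<open>q div C\<close>, element \<open>p\<close> is item
  \<open>p mod m\<close> of site \<open>p div m\<close>.\<close>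

definition has_cover :: "nat \<Rightarrow> nat \<Rightarrow> nat \<Rightarrow> (nat \<Rightarrow> nat \<Rightarrow> bool) \<Rightarrow>
    (nat \<Rightarrow> nat \<Rightarrow> nat \<Rightarrow> nat \<Rightarrow> bool) \<Rightarrow> bool" where
  "has_cover n C m ok c \<longleftrightarrow> (\<exists>r. (\<forall>q<n * C. r q \<longrightarrow> ok (q div C) (q mod C)) \<and>
     (\<forall>p<n * m. card {q. q < n * C \<and> r q \<and> c (p div m) (p mod m) (q div C) (q mod C)} = 1))"

lemma card_selected:
  fixes C :: nat
  assumes "\<And>q. q < n * C \<Longrightarrow> r q \<longleftrightarrow> q mod C = T (q div C)" "\<And>a. a < n \<Longrightarrow> T a < C"
  shows "card {q. q < n * C \<and> r q \<and> c (q div C) (q mod C)} = card {a. a < n \<and> c a (T a)}"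
proof (rule bij_betw_same_card[symmetric])
  let ?s = "\<lambda>a. a * C + T a"
  have s: "?s a < n * C" "?s a div C = a" "?s a mod C = T a" if "a < n" for a
  proof -
    have "?s a < (a + 1) * C" using assms(2)[OF that] by simp
    also have "\<dots> \<le> n * C" using that by (intro mult_right_mono) auto
    finally show "?s a < n * C" .
    show "?s a div C = a" "?s a mod C = T a" using assms(2)[OF that] by simp_all
  qed
  show "bij_betw ?s {a. a < n \<and> c a (T a)} {q. q < n * C \<and> r q \<and> c (q div C) (q mod C)}"
  proof (rule bij_betwI[where g = "\<lambda>q. q div C"])
    show "?s \<in> {a. a < n \<and> c a (T a)} \<rightarrow> {q. q < n * C \<and> r q \<and> c (q div C) (q mod C)}"
      using s assms(1) by simp
    show "(\<lambda>q. q div C) \<in> {q. q < n * C \<and> r q \<and> c (q div C) (q mod C)} \<rightarrow> {a. a < n \<and> c a (T a)}"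
      using assms(1) by (auto simp: less_mult_imp_div_less)
    show "?s q div C = q" if "q \<in> {a. a < n \<and> c a (T a)}" for q using s that by simp
    show "?s (q div C) = q" if q: "q \<in> {q. q < n * C \<and> r q \<and> c (q div C) (q mod C)}" for q
    proof -
      have "T (q div C) = q mod C" using q assms(1)[of q] by simp
      then show ?thesis by simp
    qed
  qed
qed

text \<open>Item \<open>0\<close> of each site makes the choice of tiles a function
  \<open>T\<close>. On the border a tile covers all colors of its missing neighbor's edge.
  Horizontally the last column is excluded explicitly, since \<open>b + 1\<close> is then in the
  next row; vertically \<open>b + w\<close> leaves the range by itself.\<close>

lemma cover_iff_tiling:
  fixes C k w h :: nat
  defines "n \<equiv> h * w"
  assumes "C > 0" "w > 0" and col: "\<And>\<tau>. \<tau> < C \<Longrightarrow> hR \<tau> < k \<and> hL \<tau> < k \<and> vU \<tau> < k \<and> vD \<tau> < k"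
  shows "has_cover n C (1 + k + k) ok (cov h w k hR hL vU vD) \<longleftrightarrow>
    (\<exists>T. \<forall>b<n. T b < C \<and> ok b (T b) \<and> (b mod w + 1 \<noteq> w \<longrightarrow> hR (T b) = hL (T (b + 1))) \<and>
       (b div w + 1 \<noteq> h \<longrightarrow> vU (T b) = vD (T (b + w))))"
    (is "?cover \<longleftrightarrow> ?tiling")
proof -
  let ?K = "1 + k + k"
  let ?c = "cov h w k hR hL vU vD"
  have elem: "(\<forall>p<n * ?K. \<phi> (p div ?K) (p mod ?K)) \<longleftrightarrow> (\<forall>b<n. \<forall>\<kappa><?K. \<phi> b \<kappa>)" for \<phi> :: "nat \<Rightarrow> nat \<Rightarrow> bool"
  proof (intro iffI allI impI)
    fix b \<kappa> assume *: "\<forall>p<n * ?K. \<phi> (p div ?K) (p mod ?K)" and b: "b < n" "\<kappa> < ?K"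
    have "b * ?K + \<kappa> < (b + 1) * ?K" using b by simp
    also have "\<dots> \<le> n * ?K" using b by (intro mult_right_mono) auto
    finally have "\<phi> ((b * ?K + \<kappa>) div ?K) ((b * ?K + \<kappa>) mod ?K)" using * by blast
    moreover have "(b * ?K + \<kappa>) div ?K = b" "(b * ?K + \<kappa>) mod ?K = \<kappa>"
      using b(2) by (subst div_mult_self3 mod_mult_self3; simp)+
    ultimately show "\<phi> b \<kappa>" by (simp only:)
  next
    fix p assume "\<forall>b<n. \<forall>\<kappa><?K. \<phi> b \<kappa>" "p < n * ?K"
    moreover have "p div ?K < n" using \<open>p < n * ?K\<close> by (rule less_mult_imp_div_less)
    moreover have "p mod ?K < ?K" by (rule mod_less_divisor) simp
    ultimately show "\<phi> (p div ?K) (p mod ?K)" by blast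
  qed
  have div: "b div w < h" if "b < n" for b
    using that unfolding n_def by (rule less_mult_imp_div_less)
  have right: "b + 1 < n" if "b < n" "b mod w + 1 \<noteq> w" for b
  proof -
    have "b mod w + 1 < w" using that(2) mod_less_divisor[OF \<open>w > 0\<close>, of b] by linarith
    then have "b div w * w + (b mod w + 1) < (b div w + 1) * w"
      unfolding add_mult_distrib mult_1 by (rule add_strict_left_mono)
    also have "\<dots> \<le> n" using div[OF that(1)] unfolding n_def by (intro mult_right_mono) auto
    finally show ?thesis by simp
  qed
  have up: "b + w < n \<longleftrightarrow> b div w + 1 \<noteq> h" if "b < n" for b
  proof -
    have "b + w < n \<longleftrightarrow> (b + w) div w < h"
      unfolding n_def by (rule div_less_iff_less_mult[OF \<open>w > 0\<close>, symmetric])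
    then show ?thesis using div[OF that] \<open>w > 0\<close> by auto
  qed
  show ?thesis
  proof
    assume ?tiling
    then obtain T where T: "\<And>b. b < n \<Longrightarrow> T b < C" "\<And>b. b < n \<Longrightarrow> ok b (T b)"
      and hor: "\<And>b. b < n \<Longrightarrow> b mod w + 1 \<noteq> w \<Longrightarrow> hR (T b) = hL (T (b + 1))"
      and ver: "\<And>b. b < n \<Longrightarrow> b div w + 1 \<noteq> h \<Longrightarrow> vU (T b) = vD (T (b + w))" by blast
    define r where "r q \<longleftrightarrow> q mod C = T (q div C)" for q
    have single: "{a. a < n \<and> ?c b \<kappa> a (T a)} = {b} \<or> {a. a < n \<and> ?c b \<kappa> a (T a)} = {b + 1} \<or>
        {a. a < n \<and> ?c b \<kappa> a (T a)} = {b + w}" if b: "b < n" for b \<kappa>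
    proof -
      consider "\<kappa> = 0" | "0 < \<kappa>" "\<kappa> \<le> k" "b mod w + 1 = w" | "0 < \<kappa>" "\<kappa> \<le> k" "b mod w + 1 \<noteq> w"
        | "k < \<kappa>" "b div w + 1 = h" | "k < \<kappa>" "b div w + 1 \<noteq> h" by linarith
      then show ?thesis
      proof cases
        case 3
        then show ?thesis
          using b right[OF b 3(3)] hor[OF b 3(3)] by (cases "hR (T b) + 1 = \<kappa>") (auto simp: cov_def)
      next
        case 4
        then show ?thesis using b up[OF b] by (auto simp: cov_def)
      next
        case 5
        have "b + w < n" using up[OF b] 5(2) by blast
        have iff: "?c b \<kappa> a (T a) \<longleftrightarrow> (if vU (T b) + k + 1 = \<kappa> then a = b + w else a = b)" for a
        proof -
          have "vD (T a) = vU (T b)" if "a = b + w" using ver[OF b 5(2)] that by simp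
          moreover have "b \<noteq> b + w" using \<open>w > 0\<close> by simp
          ultimately show ?thesis using 5 unfolding cov_def by (cases "a = b + w"; cases "a = b") simp_all
        qed
        show ?thesis unfolding iff using b \<open>b + w < n\<close> by (cases "vU (T b) + k + 1 = \<kappa>") (simp_all add: conj_commute cong: conj_cong)
      qed (use b in \<open>auto simp: cov_def\<close>)
    qed
    have "card {a. a < n \<and> ?c b \<kappa> a (T a)} = 1" if "b < n" for b \<kappa>
      using single[OF that, of \<kappa>] by (elim disjE) simp_all
    then have "\<forall>p<n * ?K. card {q. q < n * C \<and> r q \<and> ?c (p div ?K) (p mod ?K) (q div C) (q mod C)} = 1"
      using card_selected[of n C r T "?c b \<kappa>" for b \<kappa>] T(1)
      by (subst elem[of "\<lambda>b \<kappa>. card {q. q < n * C \<and> r q \<and> ?c b \<kappa> (q div C) (q mod C)} = 1"]) (simp add: r_def)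
    moreover have "\<forall>q<n * C. r q \<longrightarrow> ok (q div C) (q mod C)"
      using T(2) by (auto simp: r_def less_mult_imp_div_less)
    ultimately show ?cover unfolding has_cover_def by blast
  next
    assume ?cover
    then obtain r where ok: "\<And>q. q < n * C \<Longrightarrow> r q \<Longrightarrow> ok (q div C) (q mod C)"
      and p: "\<forall>p<n * ?K. card {q. q < n * C \<and> r q \<and> ?c (p div ?K) (p mod ?K) (q div C) (q mod C)} = 1"
      unfolding has_cover_def by blast
    have 1: "card {q. q < n * C \<and> r q \<and> ?c b \<kappa> (q div C) (q mod C)} = 1" if "b < n" "\<kappa> < ?K" for b \<kappa>
      using p that by (subst (asm) elem[of "\<lambda>b \<kappa>. card {q. q < n * C \<and> r q \<and> ?c b \<kappa> (q div C) (q mod C)} = 1"]) blast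
    define T where "T b = (THE q. q < n * C \<and> r q \<and> q div C = b) mod C" for b
    have T: "\<exists>q. q < n * C \<and> r q \<and> q div C = b \<and> T b = q mod C \<and> (\<forall>q'. q' < n * C \<and> r q' \<and> q' div C = b \<longrightarrow> q' = q)"
      if b: "b < n" for b
    proof -
      have "card {q. q < n * C \<and> r q \<and> ?c b 0 (q div C) (q mod C)} = 1"
        by (rule 1[OF b]) simp
      then obtain q where "{q. q < n * C \<and> r q \<and> ?c b 0 (q div C) (q mod C)} = {q}"
        by (rule card_1_singletonE)
      then have q: "q' < n * C \<and> r q' \<and> q' div C = b \<longleftrightarrow> q' = q" for q'
        by (auto simp: cov_def set_eq_iff)
      then have "(THE q. q < n * C \<and> r q \<and> q div C = b) = q" by simp
      with q show ?thesis unfolding T_def by metis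
    qed
    have TC: "T b < C" for b unfolding T_def using \<open>C > 0\<close> by simp
    have rT: "r q \<longleftrightarrow> q mod C = T (q div C)" if "q < n * C" for q
    proof -
      have "q div C < n" using that by (rule less_mult_imp_div_less)
      from T[OF this] obtain q0 where q0: "q0 < n * C" "r q0" "q0 div C = q div C" "T (q div C) = q0 mod C"
        "\<And>q'. q' < n * C \<Longrightarrow> r q' \<Longrightarrow> q' div C = q div C \<Longrightarrow> q' = q0" by blast
      show ?thesis
      proof
        assume "r q"
        then show "q mod C = T (q div C)" using q0(4,5) that by simp
      next
        assume "q mod C = T (q div C)"
        then have "q = q0" using q0(3,4) by (metis div_mult_mod_eq)
        then show "r q" using q0(2) by simp
      qed
    qed
    have card: "card {a. a < n \<and> ?c b \<kappa> a (T a)} = 1" if "b < n" "\<kappa> < ?K" for b \<kappa>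
      using 1[OF that] card_selected[of n C r T "?c b \<kappa>", OF rT TC] by simp
    have ne: "{a. a < n \<and> ?c b \<kappa> a (T a)} \<noteq> {}" if "b < n" "\<kappa> < ?K" for b \<kappa>
      using card[OF that] by force
    show ?tiling
    proof (intro exI[of _ T] allI impI conjI TC)
      fix b assume b: "b < n"
      show "ok b (T b)" using T[OF b] ok by metis
      \<comment> \<open>The tile at \<open>b\<close> does not cover its own color, so only the
        neighbor can do so.\<close>
      show "hR (T b) = hL (T (b + 1))" if "b mod w + 1 \<noteq> w"
        using ne[OF b, of "hR (T b) + 1"] col[OF TC, of b] that by (auto simp: cov_def)
      show "vU (T b) = vD (T (b + w))" if "b div w + 1 \<noteq> h"
        using ne[OF b, of "vU (T b) + k + 1"] col[OF TC, of b] that by (auto simp: cov_def)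
    qed
  qed
qed

section \<open>Computations as tilings\<close>

text \<open>
  A tile records the situation of one cell at one time: the position class of the cell (\<open>0\<close>, \<open>1\<close>, \<open>2\<close>
  for the cells \<open>-1\<close>, \<open>0\<close>, \<open>1\<close> relative to the heads, \<open>3\<close> otherwise), the state, the scanned symbols,
  and the symbols in the left neighbor, in the cell itself, and in the right neighbor, on all tapes.
\<close>

type_synonym tile = "nat \<times> nat \<times> nat list \<times> nat list \<times> nat list \<times> nat list"

definition vecs :: "tm \<Rightarrow> nat list set" where
  "vecs M = {v. set v \<subseteq> {..<num_symbols M} \<and> length v = num_tapes M}"

definition tiles :: "tm \<Rightarrow> tile set" where
  "tiles M = {(c, q, ss, l, m, r). c < 4 \<and> q \<le> num_states M \<and> ss \<in> vecs M \<and> l \<in> vecs M \<and> m \<in> vecs M \<and>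
     r \<in> vecs M \<and> (c = 1 \<longrightarrow> m = ss)}"

text \<open>Neighboring windows overlap in two cells. State and scanned symbols are part of the
  color, hence constant along a row, so that every cell knows what the heads read.\<close>

definition right_col :: "tile \<Rightarrow> nat \<times> nat list \<times> nat list \<times> nat list" where
  "right_col = (\<lambda>(c, q, ss, l, m, r). (q, ss, m, r))"

definition left_col :: "tile \<Rightarrow> nat \<times> nat list \<times> nat list \<times> nat list" where
  "left_col = (\<lambda>(c, q, ss, l, m, r). (q, ss, l, m))"

definition down_col :: "tile \<Rightarrow> nat \<times> nat list" where
  "down_col = (\<lambda>(c, q, ss, l, m, r). (q, m))"

text \<open>The content of a cell after one action. As the tape shifts under a fixed head, it stems
  from cell \<open>i - 1\<close>, \<open>i\<close> or \<open>i + 1\<close>, and the class of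
  \<open>i\<close> tells whether this was the rewritten cell \<open>0\<close>.\<close>

fun source :: "nat \<Rightarrow> nat \<times> dir \<Rightarrow> nat \<Rightarrow> nat \<Rightarrow> nat \<Rightarrow> nat" where
  "source c (a, Lft) x y z = (if c = 2 then a else x)"
| "source c (a, Stay) x y z = (if c = 1 then a else y)"
| "source c (a, Rgt) x y z = (if c = 0 then a else z)"

definition up_col :: "tm \<Rightarrow> tile \<Rightarrow> nat \<times> nat list" where
  "up_col M = (\<lambda>(c, q, ss, l, m, r).
     if q < num_states M
     then (fst (delta M q ss),
       map (\<lambda>j. source c (snd (delta M q ss) ! j) (l ! j) (m ! j) (r ! j)) [0..<num_tapes M])
     else (q, m))"

definition pos_class :: "int \<Rightarrow> nat" where
  "pos_class i = (if i = - 1 then 0 else if i = 0 then 1 else if i = 1 then 2 else 3)"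

definition cell :: "tape list \<Rightarrow> int \<Rightarrow> nat list" where
  "cell ts i = map (\<lambda>t. t i) ts"

definition tile_of :: "config \<Rightarrow> int \<Rightarrow> tile" where
  "tile_of cf i = (pos_class i, fst cf, cell (snd cf) 0, cell (snd cf) (i - 1), cell (snd cf) i, cell (snd cf) (i + 1))"

definition wf_config :: "tm \<Rightarrow> config \<Rightarrow> bool" where
  "wf_config M cf \<longleftrightarrow> fst cf \<le> num_states M \<and> (\<forall>i. cell (snd cf) i \<in> vecs M)"

section \<open>A machine step is determined locally\<close>

lemma act_source: "act a t i = source (pos_class i) a (t (i - 1)) (t i) (t (i + 1))"
  by (cases a; cases "snd a") (auto simp: act_def pos_class_def)

lemma step_up_col:
  assumes "wf_tm M" "wf_config M cf"
  shows "down_col (tile_of (step M cf) i) = up_col M (tile_of cf i)" "wf_config M (step M cf)"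
proof -
  obtain q ts where cf: "cf = (q, ts)" by (cases cf)
  have len: "length ts = num_tapes M" and q: "q \<le> num_states M" and v: "\<And>i. cell ts i \<in> vecs M"
    using assms(2) by (auto simp: wf_config_def cf vecs_def cell_def)
  have both: "down_col (tile_of (step M cf) i) = up_col M (tile_of cf i) \<and> wf_config M (step M cf)"
  proof (cases "q < num_states M")
    case True
    obtain q' as where d: "delta M q (cell ts 0) = (q', as)" by (cases "delta M q (cell ts 0)")
    have ok: "q' \<le> num_states M" "length as = num_tapes M" "\<And>a. a \<in> set as \<Longrightarrow> fst a < num_symbols M"
      using assms(1) True v[of 0] d unfolding wf_tm_def vecs_def by force+
    have s: "step M cf = (q', map2 act as ts)"
      using True d by (simp add: cf cell_def)
    have c: "cell (map2 act as ts) i =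
        map (\<lambda>j. source (pos_class i) (as ! j) (cell ts (i - 1) ! j) (cell ts i ! j) (cell ts (i + 1) ! j)) [0..<num_tapes M]" for i
      using len ok(2) by (intro nth_equalityI) (simp_all add: cell_def act_source)
    have "source (pos_class i) (as ! j) (cell ts (i - 1) ! j) (cell ts i ! j) (cell ts (i + 1) ! j) < num_symbols M"
      if "j < num_tapes M" for i j
    proof -
      have "cell ts i ! j < num_symbols M" for i
      proof -
        have "cell ts i ! j \<in> set (cell ts i)"
          using v[of i] that by (intro nth_mem) (simp add: vecs_def)
        moreover have "set (cell ts i) \<subseteq> {..<num_symbols M}" using v[of i] by (simp add: vecs_def)
        ultimately show ?thesis by (auto simp del: nth_mem)
      qed
      moreover have "fst (as ! j) < num_symbols M" using ok(2,3) that by simp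
      ultimately show ?thesis by (cases "as ! j"; cases "snd (as ! j)") auto
    qed
    then have "cell (map2 act as ts) i \<in> vecs M" for i
      unfolding c vecs_def by auto
    then show ?thesis
      unfolding s using True ok(1) c by (simp add: wf_config_def down_col_def up_col_def tile_of_def cf d)
  next
    case False
    then have s: "step M cf = cf" by (simp add: cf)
    with False assms(2) show ?thesis by (simp add: down_col_def up_col_def tile_of_def cf)
  qed
  then show "down_col (tile_of (step M cf) i) = up_col M (tile_of cf i)" "wf_config M (step M cf)" by simp_all
qed

lemma wf_init:
  assumes "wf_tm M"
  shows "wf_config M (init_config M z)"
proof -
  have "num_tapes M \<ge> 1" "num_symbols M \<ge> 3" using assms by (auto simp: wf_tm_def)
  moreover have "input_tape z i < 3" for i by (simp add: input_tape_def bit_symbol_def)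
  ultimately show ?thesis
    by (auto simp: wf_config_def init_config_def cell_def vecs_def blank_tape_def intro: less_le_trans)
qed

lemma wf_run: "wf_tm M \<Longrightarrow> wf_config M ((step M ^^ t) (init_config M z))"
  by (induction t) (auto simp: wf_init step_up_col(2))

lemma step_halted:
  assumes "fst cf = num_states M"
  shows "(step M ^^ t) cf = cf"
proof -
  have "step M cf = cf" using assms by (cases cf) simp
  then show ?thesis by (induction t) simp_all
qed

lemma tile_of_tiles: "wf_config M cf \<Longrightarrow> tile_of cf i \<in> tiles M"
  by (auto simp: tile_of_def tiles_def wf_config_def pos_class_def)

lemma finite_tiles: "finite (tiles M)"
proof -
  have "finite (vecs M)" unfolding vecs_def by (rule finite_lists_length_eq) simp
  then have "finite ({..<4 :: nat} \<times> {..num_states M} \<times> vecs M \<times> vecs M \<times> vecs M \<times> vecs M)" by simp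
  then show ?thesis by (rule finite_subset[rotated]) (auto simp: tiles_def)
qed

text \<open>Input classes: blank, \<open>False\<close>, \<open>True\<close>, and \<open>3\<close> for the cells available to the certificate.\<close>

definition input_class :: "bool list \<Rightarrow> nat \<Rightarrow> int \<Rightarrow> nat" where
  "input_class x B i =
     (if i < 0 then 0
      else if i < 2 * int (length x) then (if even i then 2 else if x ! nat (i div 2) then 2 else 1)
      else if i = 2 * int (length x) then 1
      else if i \<le> 2 * int (length x) + int B then 3
      else 0)"

text \<open>A blank in an open cell forces a blank to its right on the input tape, so the open cells
  spell a word followed by blanks only.\<close>

definition initial :: "nat \<Rightarrow> tile \<Rightarrow> bool" where
  "initial a = (\<lambda>(c, q, ss, l, m, r). q = 0 \<and> (\<forall>j. 1 \<le> j \<and> j < length m \<longrightarrow> m ! j = 0) \<and>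
     (if a = 3 then m ! 0 < 3 \<and> (m ! 0 = 0 \<longrightarrow> r ! 0 = 0) else m ! 0 = a))"

definition final :: "tm \<Rightarrow> tile \<Rightarrow> bool" where
  "final M = (\<lambda>(c, q, ss, l, m, r). q = num_states M \<and> (c = 1 \<longrightarrow> m ! 0 = 2 \<and> r ! 0 = 0))"

text \<open>Row \<open>t\<close> is the time and column \<open>c\<close> the cell
  \<open>c - h\<close>, so that the heads stand in column \<open>h\<close>.\<close>

definition valid_tiling :: "tm \<Rightarrow> bool list \<Rightarrow> nat \<Rightarrow> nat \<Rightarrow> (nat \<Rightarrow> nat \<Rightarrow> tile) \<Rightarrow> bool" where
  "valid_tiling M x B h F \<longleftrightarrow> (\<forall>t<h. \<forall>c<2 * h + 1.
     F t c \<in> tiles M \<and> fst (F t c) = pos_class (int c - int h) \<and>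
     (t = 0 \<longrightarrow> initial (input_class x B (int c - int h)) (F t c)) \<and>
     (t + 1 = h \<longrightarrow> final M (F t c)) \<and>
     (c + 1 \<noteq> 2 * h + 1 \<longrightarrow> right_col (F t c) = left_col (F t (c + 1))) \<and>
     (t + 1 \<noteq> h \<longrightarrow> up_col M (F t c) = down_col (F (t + 1) c)))"

section \<open>Accepting runs are tilings\<close>

lemma tape_output_True: "tape_output t [True] \<longleftrightarrow> t 0 = 2 \<and> t 1 = 0"
  by (simp add: tape_output_def bit_symbol_def)

lemma tape_output_unique:
  assumes "tape_output t y" "t 0 = 2" "t 1 = 0"
  shows "y = [True]"
proof -
  have y: "\<And>i. i < length y \<Longrightarrow> t (int i) = bit_symbol (y ! i)" "t (int (length y)) = 0"
    using assms(1) by (auto simp: tape_output_def)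
  have "length y \<noteq> 0" using y(2) assms(2) by (metis of_nat_0 zero_neq_numeral)
  moreover have "\<not> 1 < length y" using y(1)[of 1] assms(3) by (auto simp: bit_symbol_def split: if_splits)
  ultimately have "length y = 1" by linarith
  then obtain b where b: "y = [b]" by (auto simp: length_Suc_conv)
  then show ?thesis using y(1)[of 0] assms(2) by (auto simp: bit_symbol_def split: if_splits)
qed

lemma pair_cell:
  assumes "length u \<le> B"
  shows "input_class x B i \<noteq> 3 \<Longrightarrow> input_tape (pair x u) i = input_class x B i"
    "input_class x B i = 3 \<Longrightarrow> input_tape (pair x u) i < 3"
    "input_class x B i = 3 \<Longrightarrow> input_tape (pair x u) i = 0 \<Longrightarrow> input_tape (pair x u) (i + 1) = 0"
proof -
  let ?n = "length x"
  show "input_tape (pair x u) i < 3" by (simp add: input_tape_def bit_symbol_def)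
  show "input_class x B i = 3 \<Longrightarrow> input_tape (pair x u) i = 0 \<Longrightarrow> input_tape (pair x u) (i + 1) = 0"
    by (auto simp: input_tape_def bit_symbol_def input_class_def split: if_splits)
  assume c: "input_class x B i \<noteq> 3"
  consider "i < 0" | "0 \<le> i" "i < 2 * int ?n" | "i = 2 * int ?n" | "2 * int ?n + int B < i"
    using c unfolding input_class_def by (auto split: if_splits)
  then show "input_tape (pair x u) i = input_class x B i"
  proof cases
    case 2
    define m where "m = nat (i div 2)"
    have m: "m < ?n" using 2 by (auto simp: m_def)
    show ?thesis
    proof (cases "even i")
      case True
      then have "nat i = 2 * m" using 2 by (auto simp: m_def elim!: evenE)
      then show ?thesis
        using 2 True pair_nth(1)[OF m, of u] by (simp add: input_tape_def length_pair bit_symbol_def input_class_def)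
    next
      case False
      then have "nat i = 2 * m + 1" using 2 by (auto simp: m_def elim!: oddE)
      then show ?thesis
        using 2 False pair_nth(2)[OF m, of u]
        by (simp add: input_tape_def length_pair bit_symbol_def input_class_def m_def)
    qed
  next
    case 3
    then have "nat i = 2 * ?n" by simp
    then show ?thesis
      using 3 pair_nth(3)[of x u] by (simp add: input_tape_def length_pair bit_symbol_def input_class_def)
  qed (use assms in \<open>auto simp: input_tape_def length_pair input_class_def\<close>)
qed

lemma input_tape_int: "input_tape z (int k) = (if k < length z then bit_symbol (z ! k) else 0)"
  by (simp add: input_tape_def)

text \<open>A halted configuration persists, so the last row at time \<open>h - 1\<close> still
  shows the result.\<close>

lemma completeness:
  assumes M: "wf_tm M" "computes_within M V T" and u: "length u \<le> B" "V (pair x u) = [True]"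
    and h: "h > T (length (pair x u))"
  shows "valid_tiling M x B h (\<lambda>t c. tile_of ((step M ^^ t) (init_config M (pair x u))) (int c - int h))"
proof -
  define cf where "cf t = (step M ^^ t) (init_config M (pair x u))" for t
  have wf: "wf_config M (cf t)" for t unfolding cf_def by (rule wf_run[OF M(1)])
  obtain k ts where k: "k \<le> T (length (pair x u))" "cf k = (num_states M, ts)" "tape_output (hd ts) [True]"
    using M(2) u(2) unfolding computes_within_def cf_def by metis
  have "cf (h - 1) = cf k"
  proof -
    have "cf (h - 1) = (step M ^^ (h - 1 - k)) (cf k)"
      using k(1) h unfolding cf_def by (simp flip: funpow_add[THEN fun_cong, unfolded comp_apply])
    then show ?thesis using k(2) by (simp add: step_halted)
  qed
  then have final_cf: "cf (h - 1) = (num_states M, ts)" using k(2) by simp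
  have ts: "ts \<noteq> []"
    using wf[of k] M(1) k(2) by (auto simp: wf_config_def vecs_def cell_def wf_tm_def)
  have "num_tapes M \<ge> 1" using M(1) by (simp add: wf_tm_def)
  show ?thesis
    unfolding valid_tiling_def cf_def[symmetric]
  proof (intro allI impI conjI)
    fix t c assume t: "t < h" and c: "c < 2 * h + 1"
    show "tile_of (cf t) (int c - int h) \<in> tiles M" by (rule tile_of_tiles[OF wf])
    show "fst (tile_of (cf t) (int c - int h)) = pos_class (int c - int h)" by (simp add: tile_of_def)
    show "initial (input_class x B (int c - int h)) (tile_of (cf t) (int c - int h))" if "t = 0"
      using pair_cell[OF u(1), of x "int c - int h"] \<open>num_tapes M \<ge> 1\<close>
      by (auto simp: that cf_def init_config_def tile_of_def initial_def cell_def nth_Cons' blank_tape_def)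
    show "final M (tile_of (cf t) (int c - int h))" if "t + 1 = h"
    proof -
      have "t = h - 1" using that by simp
      then show ?thesis
        using final_cf k(3) ts
        by (auto simp: final_def tile_of_def tape_output_True pos_class_def cell_def hd_conv_nth split: if_splits)
    qed
    show "right_col (tile_of (cf t) (int c - int h)) = left_col (tile_of (cf t) (int (c + 1) - int h))"
      by (simp add: right_col_def left_col_def tile_of_def algebra_simps)
    show "up_col M (tile_of (cf t) (int c - int h)) = down_col (tile_of (cf (t + 1)) (int c - int h))"
      using step_up_col(1)[OF M(1) wf[of t]] by (simp add: cf_def)
  qed
qed

text \<open>Nothing controls what enters at the left and right end of a row, and such errors travel
  one cell per step. The run is therefore recovered only where \<open>t \<le> c\<close> and
  \<open>c + t \<le> 2 * h\<close>; with \<open>2 * h + 1\<close> columns this triangle contains the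
  middle column in every row.\<close>

lemma soundness:
  assumes M: "wf_tm M" "computes_within M V T" and F: "valid_tiling M x B h F"
    and h: "h \<ge> 2 * length x + B + 2" "\<And>u. length u \<le> B \<Longrightarrow> h > T (length (pair x u))"
  shows "\<exists>u. length u \<le> B \<and> V (pair x u) = [True]"
proof -
  let ?w = "2 * h + 1"
  define q where "q t c = fst (snd (F t c))" for t c
  define ss where "ss t c = fst (snd (snd (F t c)))" for t c
  define lf where "lf t c = fst (snd (snd (snd (F t c))))" for t c
  define mid where "mid t c = fst (snd (snd (snd (snd (F t c)))))" for t c
  define rg where "rg t c = snd (snd (snd (snd (snd (F t c)))))" for t c
  note comps = q_def ss_def lf_def mid_def rg_def
  have Feq: "F t c = (fst (F t c), q t c, ss t c, lf t c, mid t c, rg t c)" for t c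
    by (simp add: comps)
  have ok: "F t c \<in> tiles M" "fst (F t c) = pos_class (int c - int h)"
    "t = 0 \<Longrightarrow> initial (input_class x B (int c - int h)) (F t c)"
    "t + 1 = h \<Longrightarrow> final M (F t c)" "c + 1 \<noteq> ?w \<Longrightarrow> right_col (F t c) = left_col (F t (c + 1))"
    "t + 1 \<noteq> h \<Longrightarrow> up_col M (F t c) = down_col (F (t + 1) c)" if "t < h" "c < ?w" for t c
    using F that unfolding valid_tiling_def by blast+
  have hor: "q t (c + 1) = q t c" "ss t (c + 1) = ss t c" "lf t (c + 1) = mid t c" "mid t (c + 1) = rg t c"
    if "t < h" "c + 1 < ?w" for t c
    using ok(5)[OF that(1), of c] that(2) by (auto simp: right_col_def left_col_def comps split: prod.splits)
  have row: "q t c = q t 0" "ss t c = ss t 0" if "t < h" "c < ?w" for t c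
    using that(2) by (induction c) (use hor[OF that(1)] in auto)
  \<comment> \<open>Position class \<open>1\<close> ties the scanned symbols, otherwise merely
    constant along the row, to the true content under the heads.\<close>
  have center: "mid t h = ss t h" if "t < h" for t
    using ok(1,2)[OF that, of h] by (auto simp: tiles_def comps pos_class_def split: prod.splits)
  define sym where "sym c = mid 0 c ! 0" for c
  have h0: "0 < h" using h(1) by simp
  let ?n = "length x"
  have class3: "c + 1 < ?w" if "input_class x B (int c - int h) = 3" for c
    using that h(1) by (auto simp: input_class_def split: if_splits)
  have init: "q 0 c = 0" "\<And>j. 1 \<le> j \<Longrightarrow> j < length (mid 0 c) \<Longrightarrow> mid 0 c ! j = 0"
    "input_class x B (int c - int h) \<noteq> 3 \<Longrightarrow> sym c = input_class x B (int c - int h)"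
    "input_class x B (int c - int h) = 3 \<Longrightarrow> sym c < 3"
    "input_class x B (int c - int h) = 3 \<Longrightarrow> sym c = 0 \<Longrightarrow> rg 0 c ! 0 = 0" if "c < ?w" for c
  proof -
    have "initial (input_class x B (int c - int h)) (fst (F 0 c), q 0 c, ss 0 c, lf 0 c, mid 0 c, rg 0 c)"
      unfolding Feq[symmetric] by (rule ok(3)[OF h0 that refl])
    note I = this[unfolded initial_def prod.case, folded sym_def]
    show "q 0 c = 0" using I by (elim conjE)
    show "\<And>j. 1 \<le> j \<Longrightarrow> j < length (mid 0 c) \<Longrightarrow> mid 0 c ! j = 0" using I by blast
    show "input_class x B (int c - int h) \<noteq> 3 \<Longrightarrow> sym c = input_class x B (int c - int h)"
      "input_class x B (int c - int h) = 3 \<Longrightarrow> sym c < 3"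
      "input_class x B (int c - int h) = 3 \<Longrightarrow> sym c = 0 \<Longrightarrow> rg 0 c ! 0 = 0" using I by simp_all
  qed
  have sym_next: "sym (c + 1) = 0" if "input_class x B (int c - int h) = 3" "sym c = 0" for c
  proof -
    have "c + 1 < ?w" by (rule class3[OF that(1)])
    then show ?thesis using init(5)[OF _ that] hor(4)[OF h0] by (simp add: sym_def)
  qed
  define f where "f m = sym (h + 2 * ?n + 1 + m)" for m
  have cls: "input_class x B (int (h + 2 * ?n + 1 + m) - int h) = (if m < B then 3 else 0)" for m
    by (simp add: input_class_def)
  have fB: "f m = 0" if "m \<ge> B" "h + 2 * ?n + 1 + m < ?w" for m
    unfolding f_def using init(3)[OF that(2)] cls[of m] that(1) by simp
  \<comment> \<open>The certificate ends at the first blank among the open cells; the cell behind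
    them is blank, which bounds its length by \<open>B\<close>.\<close>
  define l where "l = (LEAST m. f m = 0)"
  have fB0: "f B = 0" using fB h(1) by simp
  then have l: "f l = 0" "l \<le> B" "\<And>m. m < l \<Longrightarrow> f m \<noteq> 0"
    unfolding l_def by (auto intro: LeastI Least_le dest: not_less_Least)
  have f0: "f (l + d) = 0" if "l + d \<le> B" for d
    using that
  proof (induction d)
    case (Suc d)
    then show ?case using sym_next[of "h + 2 * ?n + 1 + (l + d)"] cls[of "l + d"] by (simp add: f_def)
  qed (use l in simp)
  define u where "u = map (\<lambda>m. f m = 2) [0..<l]"
  have lu: "length u = l" "length u \<le> B" using l(2) by (simp_all add: u_def)
  define z where "z = pair x u"
  have sym: "sym c = input_tape z (int c - int h)" if c: "c < ?w" for c
  proof (cases "input_class x B (int c - int h) = 3")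
    case False
    then show ?thesis using init(3)[OF c] pair_cell(1)[OF lu(2)] by (simp add: z_def)
  next
    case True
    define m where "m = c - (h + 2 * ?n + 1)"
    have m: "m < B" "c = h + 2 * ?n + 1 + m"
      using True by (auto simp: input_class_def m_def split: if_splits)
    have i: "int c - int h = int (2 * ?n + 1 + m)" using m(2) by simp
    show ?thesis
    proof (cases "m < l")
      case True
      then have "f m < 3" "f m \<noteq> 0" using init(4)[OF c] cls[of m] m l(3) by (auto simp: f_def)
      then have "f m = bit_symbol (f m = 2)" by (auto simp: bit_symbol_def)
      also have "(f m = 2) = z ! (2 * ?n + 1 + m)"
        using True unfolding z_def pair_nth(4) by (simp add: u_def)
      finally show ?thesis
        unfolding i input_tape_int using True m(2) by (simp add: f_def z_def length_pair lu)
    next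
      case False
      then have "f m = 0" using f0[of "m - l"] m(1) by simp
      then show ?thesis
        unfolding i input_tape_int using False m(2) by (simp add: f_def z_def length_pair lu)
    qed
  qed
  define cf where "cf t = (step M ^^ t) (init_config M z)" for t
  have wf: "wf_config M (cf t)" for t unfolding cf_def by (rule wf_run[OF M(1)])
  have tapes1: "num_tapes M \<ge> 1" using M(1) by (simp add: wf_tm_def)
  have run: "q t c = fst (cf t) \<and> mid t c = cell (snd (cf t)) (int c - int h)" if "t < h" "t \<le> c" "c + t \<le> 2 * h" for t c
    using that
  proof (induction t arbitrary: c)
    case 0
    then have c: "c < ?w" by simp
    have len: "length (mid 0 c) = num_tapes M"
    proof -
      have "(fst (F 0 c), q 0 c, ss 0 c, lf 0 c, mid 0 c, rg 0 c) \<in> tiles M"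
        unfolding Feq[symmetric] by (rule ok(1)[OF h0 c])
      then show ?thesis by (simp add: tiles_def vecs_def)
    qed
    have "mid 0 c = cell (snd (cf 0)) (int c - int h)"
    proof (rule nth_equalityI)
      fix j assume j: "j < length (mid 0 c)"
      show "mid 0 c ! j = cell (snd (cf 0)) (int c - int h) ! j"
      proof (cases j)
        case 0
        then show ?thesis using sym[OF c] by (simp add: cf_def init_config_def cell_def sym_def)
      next
        case (Suc i)
        then show ?thesis using init(2)[OF c, of j] j len
          by (simp add: cf_def init_config_def cell_def blank_tape_def)
      qed
    qed (use len tapes1 in \<open>simp add: cf_def init_config_def cell_def\<close>)
    then show ?case using init(1)[OF c] by (simp add: cf_def init_config_def)
  next
    case (Suc t)
    have t: "t < h" and c: "c < ?w" "c - 1 + 1 = c" "c - 1 + 1 < ?w" "c + 1 < ?w" using Suc.prems by simp_all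
    have IH: "q t c = fst (cf t)" "mid t c = cell (snd (cf t)) (int c - int h)"
      "mid t (c - 1) = cell (snd (cf t)) (int c - int h - 1)" "mid t (c + 1) = cell (snd (cf t)) (int c - int h + 1)"
      "mid t h = cell (snd (cf t)) 0"
      using Suc.IH[of c] Suc.IH[of "c - 1"] Suc.IH[of "c + 1"] Suc.IH[of h] Suc.prems
      by (auto simp: of_nat_diff algebra_simps)
    have "ss t c = cell (snd (cf t)) 0"
      using row(2)[OF t c(1)] row(2)[OF t, of h] center[OF t] IH(5) by simp
    moreover have "lf t c = cell (snd (cf t)) (int c - int h - 1)"
      using hor(3)[OF t c(3)] IH(3) c(2) by simp
    moreover have "rg t c = cell (snd (cf t)) (int c - int h + 1)"
      using hor(4)[OF t c(4)] IH(4) by simp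
    ultimately have "F t c = tile_of (cf t) (int c - int h)"
      using Feq[of t c] ok(2)[OF t c(1)] IH(1,2) by (simp add: tile_of_def)
    then have "down_col (F (t + 1) c) = up_col M (tile_of (cf t) (int c - int h))"
      using ok(6)[OF t c(1)] Suc.prems(1) by simp
    also have "\<dots> = down_col (tile_of (cf (t + 1)) (int c - int h))"
      using step_up_col(1)[OF M(1) wf[of t]] by (simp add: cf_def)
    finally have "down_col (fst (F (t + 1) c), q (t + 1) c, ss (t + 1) c, lf (t + 1) c, mid (t + 1) c, rg (t + 1) c) =
        down_col (tile_of (cf (t + 1)) (int c - int h))"
      unfolding Feq[symmetric] .
    then show ?case by (simp add: down_col_def tile_of_def)
  qed
  obtain ts where ts: "cf (h - 1) = (num_states M, ts)" "cell ts 0 ! 0 = 2" "cell ts 1 ! 0 = 0"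
  proof -
    have t: "h - 1 < h" "h - 1 + 1 = h" "h < ?w" "h + 1 < ?w" using h0 h(1) by simp_all
    have "final M (fst (F (h - 1) h), q (h - 1) h, ss (h - 1) h, lf (h - 1) h, mid (h - 1) h, rg (h - 1) h)"
      unfolding Feq[symmetric] by (rule ok(4)[OF t(1,3,2)])
    then have "q (h - 1) h = num_states M" "mid (h - 1) h ! 0 = 2" "rg (h - 1) h ! 0 = 0"
      using ok(2)[OF t(1,3)] by (simp_all add: final_def pos_class_def)
    moreover have "mid (h - 1) (h + 1) = cell (snd (cf (h - 1))) 1" using run[OF t(1), of "h + 1"] h0 by simp
    ultimately show ?thesis
      using that[of "snd (cf (h - 1))"] run[OF t(1), of h] hor(4)[OF t(1,4)] by (simp add: prod_eq_iff)
  qed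
  have "ts \<noteq> []" using wf[of "h - 1"] tapes1 unfolding ts(1) by (auto simp: wf_config_def vecs_def cell_def)
  then have hd: "hd ts 0 = 2" "hd ts 1 = 0" using ts(2,3) by (auto simp: cell_def hd_conv_nth)
  obtain k ts' where k: "k \<le> T (length z)" "cf k = (num_states M, ts')" "tape_output (hd ts') (V z)"
    using M(2) unfolding computes_within_def cf_def by metis
  have "cf (h - 1) = (step M ^^ (h - 1 - k)) (cf k)"
    using k(1) h(2)[OF lu(2)] unfolding cf_def z_def by (simp flip: funpow_add[THEN fun_cong, unfolded comp_apply])
  then have "ts = ts'" using ts(1) k(2) by (simp add: step_halted)
  then have "V z = [True]" using tape_output_unique[OF k(3)] hd by simp
  with lu(2) show ?thesis unfolding z_def by blast
qed

section \<open>The reduction\<close>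

definition sites :: "nat \<Rightarrow> nat" where "sites h = h * (2 * h + 1)"

text \<open>Classes are restated by column because terms have no negative values.\<close>

definition col_class :: "nat \<Rightarrow> nat \<Rightarrow> nat" where
  "col_class h c = (if c + 1 = h then 0 else if c = h then 1 else if c = h + 1 then 2 else 3)"

definition col_input :: "bool list \<Rightarrow> nat \<Rightarrow> nat \<Rightarrow> nat \<Rightarrow> nat" where
  "col_input x B h c =
     (if c < h then 0
      else if c - h < 2 * length x then
        (if (c - h) mod 2 = 0 then 2 else if bitat x ((c - h) div 2) then 2 else 1)
      else if c - h = 2 * length x then 1
      else if c - h \<le> 2 * length x + B then 3
      else 0)"

lemma pos_class_col: "pos_class (int c - int h) = col_class h c"
  by (auto simp: pos_class_def col_class_def)

lemma input_class_col: "input_class x B (int c - int h) = col_input x B h c"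
proof (cases "c < h")
  case False
  then obtain m where m: "c = h + m" using le_Suc_ex[of h c] by auto
  have "even (int m) \<longleftrightarrow> m mod 2 = 0" by presburger
  moreover have "nat (int m div 2) = m div 2" by (simp add: zdiv_int[symmetric])
  ultimately show ?thesis
    by (simp add: input_class_def col_input_def m bitat_def; linarith)
qed (simp add: input_class_def col_input_def)

definition tile_ok :: "(nat \<Rightarrow> nat \<Rightarrow> bool) \<Rightarrow> (nat \<Rightarrow> nat \<Rightarrow> bool) \<Rightarrow> (nat \<Rightarrow> bool) \<Rightarrow>
    bool list \<Rightarrow> nat \<Rightarrow> nat \<Rightarrow> nat \<Rightarrow> nat \<Rightarrow> bool" where
  "tile_ok Pos Ini Fin x B h b \<tau> \<longleftrightarrow> Pos (col_class h (b mod (2 * h + 1))) \<tau> \<and>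
     (b div (2 * h + 1) = 0 \<longrightarrow> Ini (col_input x B h (b mod (2 * h + 1))) \<tau>) \<and>
     (b div (2 * h + 1) + 1 = h \<longrightarrow> Fin \<tau>)"

text \<open>Tiles and colors are numbered by countability. The default color \<open>0\<close> may
  coincide with a genuine one, but \<open>tile_ok\<close> confines every site to numbers in
  \<open>\<tau>s\<close>.\<close>

lemma tiling_numbers:
  assumes "finite (tiles M)" "h > 0"
  defines "g \<equiv> to_nat :: tile \<Rightarrow> nat" and "\<tau>s \<equiv> to_nat ` tiles M"
  defines "num \<equiv> \<lambda>\<phi> :: tile \<Rightarrow> nat. \<lambda>\<tau>. if \<tau> \<in> \<tau>s then \<phi> (from_nat \<tau>) else 0"
  assumes C: "\<And>\<tau>. \<tau> \<in> \<tau>s \<Longrightarrow> \<tau> < C"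
  shows "(\<exists>F. valid_tiling M x B h F) \<longleftrightarrow>
    (\<exists>T. \<forall>b<sites h. T b < C \<and>
      tile_ok (\<lambda>c \<tau>. \<tau> \<in> \<tau>s \<and> fst (from_nat \<tau> :: tile) = c) (\<lambda>a \<tau>. \<tau> \<in> \<tau>s \<and> initial a (from_nat \<tau>))
        (\<lambda>\<tau>. \<tau> \<in> \<tau>s \<and> final M (from_nat \<tau>)) x B h b (T b) \<and>
      (b mod (2 * h + 1) + 1 \<noteq> 2 * h + 1 \<longrightarrow>
        num (\<lambda>t. to_nat (right_col t)) (T b) = num (\<lambda>t. to_nat (left_col t)) (T (b + 1))) \<and>
      (b div (2 * h + 1) + 1 \<noteq> h \<longrightarrow>
        num (\<lambda>t. to_nat (up_col M t)) (T b) = num (\<lambda>t. to_nat (down_col t)) (T (b + (2 * h + 1)))))"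
    (is "_ \<longleftrightarrow> (\<exists>T. \<forall>b<sites h. ?\<phi> T b)")
proof -
  let ?w = "2 * h + 1"
  have site: "t * ?w + c < sites h" "(t * ?w + c) div ?w = t" "(t * ?w + c) mod ?w = c"
    if "t < h" "c < ?w" for t c
  proof -
    have "t * ?w + c < (t + 1) * ?w" using that by simp
    also have "\<dots> \<le> h * ?w" using that by (intro mult_right_mono) auto
    finally show "t * ?w + c < sites h" by (simp add: sites_def)
    show "(t * ?w + c) div ?w = t" "(t * ?w + c) mod ?w = c"
      using that(2) by (subst div_mult_self3 mod_mult_self3; simp)+
  qed
  show ?thesis
  proof
    assume "\<exists>F. valid_tiling M x B h F"
    then obtain F where F: "valid_tiling M x B h F" ..
    define T where "T b = to_nat (F (b div ?w) (b mod ?w))" for b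
    have "?\<phi> T b" if b: "b < sites h" for b
    proof -
      define t c where "t = b div ?w" and "c = b mod ?w"
      have t: "t < h" using b unfolding t_def sites_def by (rule less_mult_imp_div_less)
      have c: "c < ?w" unfolding c_def by (rule mod_less_divisor) simp
      have bt: "b = t * ?w + c" unfolding t_def c_def by (rule div_mult_mod_eq[symmetric])
      have F1: "F t c \<in> tiles M" "fst (F t c) = pos_class (int c - int h)"
        "t = 0 \<Longrightarrow> initial (input_class x B (int c - int h)) (F t c)" "t + 1 = h \<Longrightarrow> final M (F t c)"
        "c + 1 \<noteq> ?w \<Longrightarrow> right_col (F t c) = left_col (F t (c + 1)) \<and> F t (c + 1) \<in> tiles M"
        "t + 1 \<noteq> h \<Longrightarrow> up_col M (F t c) = down_col (F (t + 1) c) \<and> F (t + 1) c \<in> tiles M"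
        using F t c unfolding valid_tiling_def by auto
      have Tb: "T b = to_nat (F t c)" by (simp add: T_def t_def c_def)
      have T1: "T (b + 1) = to_nat (F t (c + 1))" if "c + 1 \<noteq> ?w"
      proof -
        have "b + 1 = t * ?w + (c + 1)" "c + 1 < ?w" using bt c that by simp_all
        then show ?thesis unfolding T_def using site[OF t, of "c + 1"] by simp
      qed
      have T2: "T (b + ?w) = to_nat (F (t + 1) c)" if "t + 1 \<noteq> h"
      proof -
        have "b + ?w = (t + 1) * ?w + c" "t + 1 < h" using bt t that by simp_all
        then show ?thesis unfolding T_def using site[of "t + 1" c] c by (simp only:)
      qed
      have "T b \<in> \<tau>s" using F1(1) by (simp add: Tb \<tau>s_def)
      then show ?thesis
        unfolding tile_ok_def t_def[symmetric] c_def[symmetric] pos_class_col[symmetric] input_class_col[symmetric]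
        using C F1 T1 T2 by (auto simp: Tb num_def \<tau>s_def)
    qed
    then show "\<exists>T. \<forall>b<sites h. ?\<phi> T b" by blast
  next
    assume "\<exists>T. \<forall>b<sites h. ?\<phi> T b"
    then obtain T where T: "\<And>b. b < sites h \<Longrightarrow> ?\<phi> T b" by blast
    define F where "F t c = (from_nat (T (t * ?w + c)) :: tile)" for t c
    have \<tau>s: "T b \<in> \<tau>s" if "b < sites h" for b using T[OF that] by (simp add: tile_ok_def)
    have fromT: "from_nat \<tau> \<in> tiles M" if "\<tau> \<in> \<tau>s" for \<tau> using that by (auto simp: \<tau>s_def)
    have "valid_tiling M x B h F"
      unfolding valid_tiling_def
    proof (intro allI impI)
      fix t c assume t: "t < h" and c: "c < ?w"
      let ?b = "t * ?w + c"
      note s = site[OF t c]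
      note T' = T[OF s(1), unfolded tile_ok_def s(2,3) pos_class_col[symmetric] input_class_col[symmetric]]
      have "?b \<in> {..<sites h}" using s(1) by simp
      have F0: "F t c = from_nat (T ?b)" by (simp only: F_def)
      have 1: "F t c \<in> tiles M" "fst (F t c) = pos_class (int c - int h)"
        "t = 0 \<Longrightarrow> initial (input_class x B (int c - int h)) (F t c)" "t + 1 = h \<Longrightarrow> final M (F t c)"
        using T' fromT unfolding F0 by simp_all
      have 2: "right_col (F t c) = left_col (F t (c + 1))" if "c + 1 \<noteq> ?w"
      proof -
        have c': "c + 1 < ?w" using c that by simp
        have b': "?b + 1 = t * ?w + (c + 1)" by simp
        have "T (?b + 1) \<in> \<tau>s" unfolding b' by (rule \<tau>s[OF site(1)[OF t c']])
        moreover have "num (\<lambda>t. to_nat (right_col t)) (T ?b) = num (\<lambda>t. to_nat (left_col t)) (T (?b + 1))"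
          using T' that by blast
        ultimately show ?thesis
          unfolding F_def b'[symmetric] using \<tau>s[OF s(1)] by (simp add: num_def)
      qed
      have 3: "up_col M (F t c) = down_col (F (t + 1) c)" if "t + 1 \<noteq> h"
      proof -
        have t': "t + 1 < h" using t that by simp
        have b': "?b + ?w = (t + 1) * ?w + c" by simp
        have "T (?b + ?w) \<in> \<tau>s" unfolding b' by (rule \<tau>s[OF site(1)[OF t' c]])
        moreover have "num (\<lambda>t. to_nat (up_col M t)) (T ?b) = num (\<lambda>t. to_nat (down_col t)) (T (?b + ?w))"
          using T' that by blast
        ultimately show ?thesis
          unfolding F_def b'[symmetric] using \<tau>s[OF s(1)] by (simp add: num_def)
      qed
      show "F t c \<in> tiles M \<and> fst (F t c) = pos_class (int c - int h) \<and>
         (t = 0 \<longrightarrow> initial (input_class x B (int c - int h)) (F t c)) \<and> (t + 1 = h \<longrightarrow> final M (F t c)) \<and>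
         (c + 1 \<noteq> 2 * h + 1 \<longrightarrow> right_col (F t c) = left_col (F t (c + 1))) \<and>
         (t + 1 \<noteq> h \<longrightarrow> up_col M (F t c) = down_col (F (t + 1) c))"
        using 1 2 3 by blast
    qed
    then show "\<exists>F. valid_tiling M x B h F" by blast
  qed
qed

lemma poly_mono_nat: "a \<le> b \<Longrightarrow> poly p a \<le> poly p (b :: nat)"
  by (induction p) (auto intro!: add_mono mult_mono)

text \<open>The tables and the constants \<open>C\<close> and \<open>k\<close> depend on the
  language alone; the input enters through \<open>B\<close>, \<open>h\<close> and the initial
  row.\<close>

lemma NP_cover:
  assumes "K \<in> NP"
  obtains C k Pos Ini Fin hR hL vU vD B h
  where "C > 0" "\<And>c \<tau>. Pos c \<tau> \<Longrightarrow> \<tau> < C" "\<And>c \<tau>. Ini c \<tau> \<Longrightarrow> \<tau> < C" "\<And>\<tau>. Fin \<tau> \<Longrightarrow> \<tau> < C"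
    "\<And>\<tau>. \<tau> \<ge> C \<Longrightarrow> hR \<tau> = 0 \<and> hL \<tau> = 0 \<and> vU \<tau> = 0 \<and> vD \<tau> = 0"
    "D (\<lambda>x e. B x)" "D (\<lambda>x e. h x)" "\<And>x. h x > 0"
    "\<And>x. x \<in> K \<longleftrightarrow> has_cover (sites (h x)) C (1 + k + k) (tile_ok Pos Ini Fin x (B x) (h x))
      (cov (h x) (2 * h x + 1) k hR hL vU vD)"
proof -
  obtain V p where "polytime V"
    and K: "\<And>x. x \<in> K \<longleftrightarrow> (\<exists>u. length u \<le> poly p (length x) \<and> V (pair x u) = [True])"
    using assms unfolding NP_def by blast
  then obtain M r where M: "wf_tm M" "computes_within M V (poly r)" unfolding polytime_def by blast
  define B where "B x = poly p (length x)" for x :: "bool list"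
  \<comment> \<open>The sum of the width asked for by \<open>soundness\<close> and the running time
    on the longest pair, of length \<open>2 * length x + 1 + B x\<close>; the final \<open>1\<close>
    makes the bound strict.\<close>
  define h where "h x = 2 * length x + B x + 2 + poly r (2 * length x + 1 + B x) + 1" for x
  have x_in_K: "x \<in> K \<longleftrightarrow> (\<exists>F. valid_tiling M x (B x) (h x) F)" for x
  proof -
    have h: "h x > poly r (length (pair x u))" if "length u \<le> B x" for u
    proof -
      have "poly r (length (pair x u)) \<le> poly r (2 * length x + 1 + B x)"
        using that by (intro poly_mono_nat) (simp add: length_pair)
      then show ?thesis by (simp add: h_def)
    qed
    show ?thesis
    proof
      assume "x \<in> K"
      then obtain u where u: "length u \<le> B x" "V (pair x u) = [True]" unfolding K B_def by blast
      from completeness[OF M u h[OF u(1)]] show "\<exists>F. valid_tiling M x (B x) (h x) F" by blast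
    next
      assume "\<exists>F. valid_tiling M x (B x) (h x) F"
      then obtain F where F: "valid_tiling M x (B x) (h x) F" by blast
      have "h x \<ge> 2 * length x + B x + 2" by (simp add: h_def)
      from soundness[OF M F this h] show "x \<in> K" unfolding K B_def by blast
    qed
  qed
  define \<tau>s where "\<tau>s = (to_nat :: tile \<Rightarrow> nat) ` tiles M"
  define num where "num \<phi> \<tau> = (if \<tau> \<in> \<tau>s then \<phi> (from_nat \<tau>) else 0 :: nat)" for \<phi> :: "tile \<Rightarrow> nat" and \<tau>
  have fin: "finite \<tau>s" using finite_tiles by (simp add: \<tau>s_def)
  then obtain C where C: "\<And>\<tau>. \<tau> \<in> \<tau>s \<Longrightarrow> \<tau> < C" "C > 0"
    unfolding finite_nat_set_iff_bounded by (metis less_SucI zero_less_Suc)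
  define hR where "hR = num (\<lambda>t. to_nat (right_col t))"
  define hL where "hL = num (\<lambda>t. to_nat (left_col t))"
  define vU where "vU = num (\<lambda>t. to_nat (up_col M t))"
  define vD where "vD = num (\<lambda>t. to_nat (down_col t))"
  have "finite (hR ` {..<C} \<union> hL ` {..<C} \<union> vU ` {..<C} \<union> vD ` {..<C})" by simp
  then have "\<exists>k. \<forall>v\<in>hR ` {..<C} \<union> hL ` {..<C} \<union> vU ` {..<C} \<union> vD ` {..<C}. v < k"
    by (simp only: finite_nat_set_iff_bounded)
  then obtain k where k: "\<forall>v\<in>hR ` {..<C} \<union> hL ` {..<C} \<union> vU ` {..<C} \<union> vD ` {..<C}. v < k"
    by (elim exE)
  define Pos where "Pos c \<tau> \<longleftrightarrow> \<tau> \<in> \<tau>s \<and> fst (from_nat \<tau> :: tile) = c" for c \<tau>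
  define Ini where "Ini a \<tau> \<longleftrightarrow> \<tau> \<in> \<tau>s \<and> initial a (from_nat \<tau>)" for a \<tau>
  define Fin where "Fin \<tau> \<longleftrightarrow> \<tau> \<in> \<tau>s \<and> final M (from_nat \<tau>)" for \<tau>
  show ?thesis
  proof (rule that[of C Pos Ini Fin hR hL vU vD B h k])
    show "C > 0" "\<And>c \<tau>. Pos c \<tau> \<Longrightarrow> \<tau> < C" "\<And>c \<tau>. Ini c \<tau> \<Longrightarrow> \<tau> < C" "\<And>\<tau>. Fin \<tau> \<Longrightarrow> \<tau> < C"
      using C by (auto simp: Pos_def Ini_def Fin_def)
    show "hR \<tau> = 0 \<and> hL \<tau> = 0 \<and> vU \<tau> = 0 \<and> vD \<tau> = 0" if "\<tau> \<ge> C" for \<tau>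
      using that C(1)[of \<tau>] by (auto simp: hR_def hL_def vU_def vD_def num_def)
    show B: "D (\<lambda>x e. B x)" unfolding B_def by (intro D_intros)
    show "D (\<lambda>x e. h x)" unfolding h_def by (intro D_intros B)
    show "h x > 0" for x by (simp add: h_def)
    have cols: "hR \<tau> < k \<and> hL \<tau> < k \<and> vU \<tau> < k \<and> vD \<tau> < k" if "\<tau> < C" for \<tau>
      using that k by simp
    fix x
    have "x \<in> K \<longleftrightarrow> (\<exists>T. \<forall>b<sites (h x). T b < C \<and> tile_ok Pos Ini Fin x (B x) (h x) b (T b) \<and>
      (b mod (2 * h x + 1) + 1 \<noteq> 2 * h x + 1 \<longrightarrow> hR (T b) = hL (T (b + 1))) \<and>
      (b div (2 * h x + 1) + 1 \<noteq> h x \<longrightarrow> vU (T b) = vD (T (b + (2 * h x + 1)))))"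
      unfolding x_in_K Pos_def Ini_def Fin_def hR_def hL_def vU_def vD_def num_def \<tau>s_def
      by (rule tiling_numbers) (use C finite_tiles in \<open>auto simp: h_def \<tau>s_def\<close>)
    also have "\<dots> \<longleftrightarrow> has_cover (sites (h x)) C (1 + k + k) (tile_ok Pos Ini Fin x (B x) (h x))
      (cov (h x) (2 * h x + 1) k hR hL vU vD)"
      unfolding sites_def by (rule cover_iff_tiling[symmetric]) (use C cols in auto)
    finally show "x \<in> K \<longleftrightarrow> has_cover (sites (h x)) C (1 + k + k) (tile_ok Pos Ini Fin x (B x) (h x))
      (cov (h x) (2 * h x + 1) k hR hL vU vD)" .
  qed
qed

section \<open>The reduction is computable in polynomial time\<close>

text \<open>Cases on a class below \<open>4\<close> leave predicates with a fixed class, which are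
  finite tables.\<close>

lemma DP_fin_arg:
  assumes "D f" "DP (\<lambda>x e. R x e 0)" "DP (\<lambda>x e. R x e 1)" "DP (\<lambda>x e. R x e 2)" "DP (\<lambda>x e. R x e 3)"
    and "\<And>x e. f x e < (4 :: nat)"
  shows "DP (\<lambda>x e. R x e (f x e))"
proof -
  have "DP (\<lambda>x e. (f x e = 0 \<and> R x e 0) \<or> (f x e = 1 \<and> R x e 1) \<or> (f x e = 2 \<and> R x e 2) \<or> (f x e = 3 \<and> R x e 3))"
    by (intro D_intros assms(1-5))
  moreover have "(f x e = 0 \<and> R x e 0) \<or> (f x e = 1 \<and> R x e 1) \<or> (f x e = 2 \<and> R x e 2) \<or> (f x e = 3 \<and> R x e 3) \<longleftrightarrow>
      R x e (f x e)" for x e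
  proof -
    have "f x e = 0 \<or> f x e = 1 \<or> f x e = 2 \<or> f x e = 3" using assms(6)[of x e] by linarith
    then show ?thesis by (elim disjE) simp_all
  qed
  ultimately show ?thesis by (simp only:)
qed

lemma DP_tile_ok:
  assumes "\<And>c \<tau>. Pos c \<tau> \<Longrightarrow> \<tau> < C" "\<And>c \<tau>. Ini c \<tau> \<Longrightarrow> \<tau> < C" "\<And>\<tau>. Fin \<tau> \<Longrightarrow> \<tau> < C"
    and BH: "D (\<lambda>x e. B x)" "D (\<lambda>x e. h x)" and fg: "D f" "D g"
  shows "DP (\<lambda>x e. tile_ok Pos Ini Fin x (B x) (h x) (f x e) (g x e))"
proof -
  have P: "DP (\<lambda>x e. Pos c (g x e))" "DP (\<lambda>x e. Ini c (g x e))" "DP (\<lambda>x e. Fin (g x e))" for c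
    using assms(1-3) by (intro DP_fin[OF fg(2), where b = C]; blast)+
  have 1: "D (\<lambda>x e. col_class (h x) (f x e mod (2 * h x + 1)))"
    unfolding col_class_def by (intro D_if D_intros BH fg)
  have 2: "D (\<lambda>x e. col_input x (B x) (h x) (f x e mod (2 * h x + 1)))"
    unfolding col_input_def by (intro D_if D_intros DP_bitat BH fg)
  have "DP (\<lambda>x e. Pos (col_class (h x) (f x e mod (2 * h x + 1))) (g x e))"
    by (rule DP_fin_arg[OF 1, where R = "\<lambda>x e c. Pos c (g x e)"]) (rule P | simp add: col_class_def)+
  moreover have "DP (\<lambda>x e. Ini (col_input x (B x) (h x) (f x e mod (2 * h x + 1))) (g x e))"
    by (rule DP_fin_arg[OF 2, where R = "\<lambda>x e c. Ini c (g x e)"]) (rule P | simp add: col_input_def)+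
  ultimately show ?thesis
    unfolding tile_ok_def by (intro D_intros BH fg P) 
qed

lemma DP_cov:
  assumes "\<And>\<tau>. \<tau> \<ge> C \<Longrightarrow> hR \<tau> = 0 \<and> hL \<tau> = 0 \<and> vU \<tau> = 0 \<and> vD \<tau> = 0"
    and "D (\<lambda>x e. h x)" "D (\<lambda>x e. w x)" and fg: "D b" "D \<kappa>" "D a" "D \<tau>"
  shows "DP (\<lambda>x e. cov (h x) (w x) k hR hL vU vD (b x e) (\<kappa> x e) (a x e) (\<tau> x e))"
proof -
  have "D (\<lambda>x e. hR (\<tau> x e))" "D (\<lambda>x e. hL (\<tau> x e))" "D (\<lambda>x e. vU (\<tau> x e))" "D (\<lambda>x e. vD (\<tau> x e))"
    using assms(1) by (intro D_fin[OF fg(4), where b = C]; blast)+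
  then show ?thesis unfolding cov_def by (intro D_intros assms(2,3) fg)
qed

context net
begin

text \<open>Decoding coordinates from a vertex number turns adjacency and membership into definable
  predicates of numbers.\<close>

definition xc :: "nat \<Rightarrow> nat" where "xc v = v div 4 mod W"

definition yc :: "nat \<Rightarrow> nat" where "yc v = v div 4 div W"

definition adj :: "nat \<Rightarrow> nat \<Rightarrow> bool" where
  "adj a b \<longleftrightarrow> lnk (xc a) (yc a) (a mod 4) (xc b) (yc b) (b mod 4) \<or>
     lnk (xc b) (yc b) (b mod 4) (xc a) (yc a) (a mod 4)"

definition forced :: "nat \<Rightarrow> bool" where
  "forced v \<longleftrightarrow> v mod 4 \<le> 1 \<and> clause (xc v) (yc v)"

definition banned :: "nat \<Rightarrow> bool" where
  "banned v \<longleftrightarrow> \<not> forced v \<and> \<not> (v mod 4 = 0 \<and> free (xc v) (yc v))"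

lemma coords: "X < W \<Longrightarrow> k < 4 \<Longrightarrow> xc (vid X Y k) = X" "X < W \<Longrightarrow> k < 4 \<Longrightarrow> yc (vid X Y k) = Y"
  by (simp_all add: xc_def yc_def vid_div)

lemma adj_iff:
  assumes "a < size" "b < size"
  shows "{a, b} \<in> E \<longleftrightarrow> adj a b"
proof -
  obtain X Y k where a: "a = vid X Y k" "X < W" "Y < H" "k < 4" using assms(1) by (rule vid_cases)
  obtain X' Y' k' where b: "b = vid X' Y' k'" "X' < W" "Y' < H" "k' < 4" using assms(2) by (rule vid_cases)
  show ?thesis
    unfolding adj_def a(1) b(1) coords[OF a(2,4)] coords[OF b(2,4)] vid_mod[OF a(4)] vid_mod[OF b(4)]
    by (rule edge_iff[OF a(2,4) b(2,4)])
qed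

lemma forced_iff:
  assumes "v < size"
  shows "v \<in> U \<longleftrightarrow> forced v"
proof -
  obtain X Y k where v: "v = vid X Y k" "X < W" "Y < H" "k < 4" using assms by (rule vid_cases)
  show ?thesis
    unfolding forced_def v(1) coords[OF v(2,4)] vid_mod[OF v(4)] U_def Un_iff vid_mem[OF v(2,4)] by auto
qed

lemma banned_iff:
  assumes "v < size"
  shows "v \<in> N \<longleftrightarrow> banned v"
proof -
  obtain X Y k where v: "v = vid X Y k" "X < W" "Y < H" "k < 4" using assms by (rule vid_cases)
  have "v \<in> Fr \<longleftrightarrow> v mod 4 = 0 \<and> free (xc v) (yc v)"
    unfolding v(1) coords[OF v(2,4)] vid_mod[OF v(4)] vid_mem[OF v(2,4)] using v(3) by auto
  then show ?thesis
    unfolding banned_def N_def using assms forced_iff[OF assms] by simp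
qed

lemma instance_ok_net: "instance_ok size E U N"
  unfolding instance_ok_def using simple_graph_E U_N_bounds by blast

lemma encode_planar: "encode size E U N \<in> planar_bipartite_inputs 9"
  unfolding planar_bipartite_inputs_def
  using instance_ok_net planar_E bipartite_E max_degree_E by blast

lemma encode_Ext_LMDA:
  assumes "P > 0" "Q > 0"
  shows "encode size E U N \<in> Ext_LMDA \<longleftrightarrow>
    (\<exists>r. (\<forall>q<Q. r q \<longrightarrow> ok q) \<and> (\<forall>p<P. card {q. q < Q \<and> r q \<and> inc p q} = 1))"
proof -
  have "encode size E U N \<in> Ext_LMDA \<longleftrightarrow>
    (\<exists>A. A \<subseteq> {..<size} - N \<and> U \<subseteq> A \<and> locally_minimal_defensive_alliance {..<size} E A)"
  proof
    assume "encode size E U N \<in> Ext_LMDA"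
    then obtain n' E' U' N' A where eq: "encode size E U N = encode n' E' U' N'" and ok': "instance_ok n' E' U' N'"
      and A: "A \<subseteq> {..<n'} - N' \<and> U' \<subseteq> A \<and> locally_minimal_defensive_alliance {..<n'} E' A"
      unfolding Ext_LMDA_def by blast
    \<comment> \<open>Membership speaks of any instance with this encoding; injectivity leaves only
      the net itself.\<close>
    from encode_inject[OF instance_ok_net ok' eq] A
    show "\<exists>A. A \<subseteq> {..<size} - N \<and> U \<subseteq> A \<and> locally_minimal_defensive_alliance {..<size} E A" by blast
  next
    assume "\<exists>A. A \<subseteq> {..<size} - N \<and> U \<subseteq> A \<and> locally_minimal_defensive_alliance {..<size} E A"
    then show "encode size E U N \<in> Ext_LMDA" unfolding Ext_LMDA_def using instance_ok_net by blast
  qed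
  then show ?thesis
    unfolding lmda_iff_net[OF assms] net_iff_assignment net_iff_cover[OF assms(2)] .
qed

lemma encode_net: "encode size E U N = map (code_bit size adj forced banned) [0..<size + 1 + size * size + size + size]"
  by (rule encode_map) (simp_all add: adj_iff forced_iff banned_iff)

end

lemma DP_code_bit:
  assumes "D (\<lambda>x e. n x)" "\<And>f g. D f \<Longrightarrow> D g \<Longrightarrow> DP (\<lambda>x e. a x (f x e) (g x e))"
    and "\<And>f. D f \<Longrightarrow> DP (\<lambda>x e. U x (f x e))" "\<And>f. D f \<Longrightarrow> DP (\<lambda>x e. N x (f x e))" "D f"
  shows "DP (\<lambda>x e. code_bit (n x) (a x) (U x) (N x) (f x e))"
  unfolding code_bit_def by (intro D_intros assms)

text \<open>Definability is passed from \<open>P\<close>, \<open>Q\<close>, \<open>inc\<close> and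
  \<open>ok\<close> up to adjacency and membership, and finally to single bits of the
  encoding.\<close>

lemma polytime_net:
  assumes PQ: "D (\<lambda>x e. P x)" "D (\<lambda>x e. Q x)"
    and inc: "\<And>f g. D f \<Longrightarrow> D g \<Longrightarrow> DP (\<lambda>x e. inc x (f x e) (g x e))"
    and ok: "\<And>f. D f \<Longrightarrow> DP (\<lambda>x e. ok x (f x e))"
  shows "polytime (\<lambda>x. encode (net.size (P x) (Q x)) (net.E (P x) (Q x) (inc x)) (net.U (P x) (Q x))
    (net.N (P x) (Q x) (inc x) (ok x)))"
proof -
  have W: "D (\<lambda>x e. net.W (P x))" unfolding net.W_def by (intro D_intros PQ)
  have H: "D (\<lambda>x e. net.H (Q x))" unfolding net.H_def by (intro D_intros PQ)
  have size: "D (\<lambda>x e. net.size (P x) (Q x))" unfolding net.size_def by (intro D_intros W H)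
  have clause: "DP (\<lambda>x e. net.clause (P x) (Q x) (f x e) (g x e))" if "D f" "D g" for f g
    unfolding net.clause_def by (intro D_intros PQ that)
  have dirs: "DP (\<lambda>x e. net.rt (inc x) (f x e) (g x e))" "DP (\<lambda>x e. net.lf (f x e) (g x e))"
    "DP (\<lambda>x e. net.up (f x e) (g x e))" "DP (\<lambda>x e. net.dn (f x e) (g x e))" "DP (\<lambda>x e. net.neg (f x e) (g x e))"
    if "D f" "D g" for f g
    unfolding net.rt_def net.lf_def net.up_def net.dn_def net.neg_def by (intro D_intros inc that)+
  have lnk: "DP (\<lambda>x e. net.lnk (P x) (Q x) (inc x) (f x e) (g x e) (i x e) (f' x e) (g' x e) (i' x e))"
    if "D f" "D g" "D i" "D f'" "D g'" "D i'" for f g i f' g' i'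
    unfolding net.lnk_def by (intro D_intros clause dirs that)
  have free: "DP (\<lambda>x e. net.free (Q x) (inc x) (ok x) (f x e) (g x e))" if "D f" "D g" for f g
    unfolding net.free_def odd_iff_mod_2_eq_one by (intro D_intros inc ok PQ that)
  have xy: "D (\<lambda>x e. net.xc (P x) (f x e))" "D (\<lambda>x e. net.yc (P x) (f x e))" if "D f" for f
    unfolding net.xc_def net.yc_def by (intro D_intros W that)+
  have adj: "DP (\<lambda>x e. net.adj (P x) (Q x) (inc x) (f x e) (g x e))" if "D f" "D g" for f g
    unfolding net.adj_def by (intro D_intros lnk xy that)
  have forced: "DP (\<lambda>x e. net.forced (P x) (Q x) (f x e))" if "D f" for f
    unfolding net.forced_def by (intro D_intros clause xy that)
  have banned: "DP (\<lambda>x e. net.banned (P x) (Q x) (inc x) (ok x) (f x e))" if "D f" for f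
    unfolding net.banned_def by (intro D_intros forced free xy that)
  show ?thesis
    unfolding net.encode_net
  proof (rule polytime_map)
    show "DP (\<lambda>x e. code_bit (net.size (P x) (Q x)) (net.adj (P x) (Q x) (inc x)) (net.forced (P x) (Q x))
        (net.banned (P x) (Q x) (inc x) (ok x)) (e 0))"
      by (intro DP_code_bit size adj forced banned D_env)
    show "D (\<lambda>x e. net.size (P x) (Q x) + 1 + net.size (P x) (Q x) * net.size (P x) (Q x) +
        net.size (P x) (Q x) + net.size (P x) (Q x))"
      by (intro D_add D_mult D_const size)
  qed
qed

theorem NP_hard_planar: "NP_hard_on (planar_bipartite_inputs 9) Ext_LMDA"
  unfolding NP_hard_on_def
proof
  fix K assume "K \<in> NP"
  then show "\<exists>f. polytime f \<and> (\<forall>x. f x \<in> planar_bipartite_inputs 9 \<and> (x \<in> K \<longleftrightarrow> f x \<in> Ext_LMDA))"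
  proof (rule NP_cover)
    fix C k :: nat and Pos Ini :: "nat \<Rightarrow> nat \<Rightarrow> bool" and Fin :: "nat \<Rightarrow> bool" and hR hL vU vD :: "nat \<Rightarrow> nat"
      and B h :: "bool list \<Rightarrow> nat"
    assume C: "C > 0" and tile: "\<And>c \<tau>. Pos c \<tau> \<Longrightarrow> \<tau> < C" "\<And>c \<tau>. Ini c \<tau> \<Longrightarrow> \<tau> < C" "\<And>\<tau>. Fin \<tau> \<Longrightarrow> \<tau> < C"
      and cols: "\<And>\<tau>. \<tau> \<ge> C \<Longrightarrow> hR \<tau> = 0 \<and> hL \<tau> = 0 \<and> vU \<tau> = 0 \<and> vD \<tau> = 0"
      and Bh: "D (\<lambda>x e. B x)" "D (\<lambda>x e. h x)" and h: "\<And>x. h x > 0"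
      and K: "\<And>x. x \<in> K \<longleftrightarrow> has_cover (sites (h x)) C (1 + k + k) (tile_ok Pos Ini Fin x (B x) (h x))
        (cov (h x) (2 * h x + 1) k hR hL vU vD)"
    \<comment> \<open>Columns are elements, \<open>1 + k + k\<close> for each site; rows are sets,
      one for each site and tile number.\<close>
    define P where "P x = sites (h x) * (1 + k + k)" for x
    define Q where "Q x = sites (h x) * C" for x
    define inc where "inc x p q = cov (h x) (2 * h x + 1) k hR hL vU vD (p div (1 + k + k)) (p mod (1 + k + k)) (q div C) (q mod C)"
      for x p q
    define ok where "ok x q = tile_ok Pos Ini Fin x (B x) (h x) (q div C) (q mod C)" for x q
    let ?f = "\<lambda>x. encode (net.size (P x) (Q x)) (net.E (P x) (Q x) (inc x)) (net.U (P x) (Q x)) (net.N (P x) (Q x) (inc x) (ok x))"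
    have PQ: "D (\<lambda>x e. P x)" "D (\<lambda>x e. Q x)"
      unfolding P_def Q_def sites_def by (intro D_intros Bh)+
    have "DP (\<lambda>x e. inc x (f x e) (g x e))" if "D f" "D g" for f g
      unfolding inc_def by (intro DP_cov[OF cols] D_intros Bh that)
    moreover have "DP (\<lambda>x e. ok x (f x e))" if "D f" for f
      unfolding ok_def by (intro DP_tile_ok[OF tile] D_intros Bh that)
    ultimately have "polytime ?f" by (intro polytime_net PQ)
    moreover have "?f x \<in> planar_bipartite_inputs 9" for x by (rule net.encode_planar)
    moreover have "x \<in> K \<longleftrightarrow> ?f x \<in> Ext_LMDA" for x
    proof -
      have "P x > 0" "Q x > 0" using h[of x] C by (simp_all add: P_def Q_def sites_def)
      from net.encode_Ext_LMDA[OF this, of "inc x" "ok x"] show ?thesis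
        unfolding K has_cover_def inc_def ok_def P_def Q_def by simp
    qed
    ultimately show ?thesis
      by (intro exI[of _ ?f]) blast
  qed
qed

lemma NP_complete_onI: "L \<in> NP \<Longrightarrow> NP_hard_on I L \<Longrightarrow> NP_complete_on I L"
  unfolding NP_complete_on_def by (intro conjI bexI[of _ L] refl)

text \<open>With everything as the larger set, hardness on restricted inputs becomes ordinary
  hardness.\<close>

lemma NP_hard_on_mono:
  assumes "NP_hard_on I L" "I \<subseteq> J"
  shows "NP_hard_on J L"
  unfolding NP_hard_on_def
proof
  fix K assume "K \<in> NP"
  with assms(1) obtain f where "polytime f" "\<And>x. f x \<in> I" "\<And>x. x \<in> K \<longleftrightarrow> f x \<in> L"
    unfolding NP_hard_on_def by metis
  with assms(2) show "\<exists>f. polytime f \<and> (\<forall>x. f x \<in> J \<and> (x \<in> K \<longleftrightarrow> f x \<in> L))"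
    by (intro exI[of _ f]) auto
qed

theorem corollary4:
  shows "NP_complete Ext_LMDA \<and> NP_complete_on (planar_bipartite_inputs 9) Ext_LMDA"
  using NP_complete_onI[OF Ext_LMDA_NP NP_hard_on_mono[OF NP_hard_planar subset_UNIV]]
    NP_complete_onI[OF Ext_LMDA_NP NP_hard_planar]
  by (rule conjI)

end
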